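(* Let $L$ be the Lelek fan. There exists a Suslinian smooth dendroid $D$ such that $E(D)$ is homeomorphic to $E(L)$.
   Context: A continuum is a compact connected metric space. It is hereditarily unicoherent if every two of its subcontinua have connected intersection. A dendroid is a hereditarily unicoherent, arcwise connected continuum (hence uniquely arcwise connected); for $x,y$ in a dendroid $X$, $\alpha(x,y)$ denotes the unique arc in $X$ with endpoints $x$ and $y$ (with $\alpha(x,x)=\{x\}$). A dendroid $X$ is smooth if there exists $p\in X$ such that whenever $x_n\to x$ in $X$, $\alpha(x_n,p)\to\alpha(x,p)$ in the Hausdorff distance. A point $e\in X$ is an endpoint if $e$ is an endpoint of every arc in $X$ that contains it; $E(X)$ is the set of all endpoints of $X$, with the subspace topology. The order of $x\in X$ is the number of arc components of $X\setminus\{x\}$; a ramification point is a point of order at least $3$. A fan is a dendroid with only one ramification point. The Lelek fan is the (unique up to homeomorphism) smooth fan whose set of endpoints is dense. A continuum is Suslinian if it contains no uncountable collection of non-degenerate, pairwise-disjoint subcontinua. The dendroid $D$ is not required to embed in the plane. *)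

theory Defs
  imports "HOL-Analysis.Analysis"
begin

text \<open>
  Spaces are subsets of metric types, with the induced metric.  Every compact metric space
  is homeomorphic to a subset of \<^typ>\<open>nat \<Rightarrow> real\<close> (product topology), so quantifying over
  such subsets covers all continua, and all notions below are invariant under homeomorphism.
\<close>

definition continuum :: "'a::metric_space set \<Rightarrow> bool" where
  "continuum X \<longleftrightarrow> X \<noteq> {} \<and> compact X \<and> connected X"

definition subcontinuum :: "'a::metric_space set \<Rightarrow> 'a set \<Rightarrow> bool" where
  "subcontinuum A X \<longleftrightarrow> A \<subseteq> X \<and> continuum A"

definition nondegenerate :: "'a set \<Rightarrow> bool" where
  "nondegenerate A \<longleftrightarrow> (\<exists>x\<in>A. \<exists>y\<in>A. x \<noteq> y)"

text \<open>
  Disjoint subcontinua are allowed here: the empty set is \<^const>\<open>connected\<close>.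
\<close>

definition hereditarily_unicoherent :: "'a::metric_space set \<Rightarrow> bool" where
  "hereditarily_unicoherent X \<longleftrightarrow>
     continuum X \<and>
     (\<forall>A B. subcontinuum A X \<and> subcontinuum B X \<longrightarrow> connected (A \<inter> B))"

text \<open>
  \<^term>\<open>arc_from_to A x y\<close>: \<^term>\<open>A\<close>, as a set of points, is an arc with endpoints
  \<^term>\<open>x\<close> and \<^term>\<open>y\<close>; in particular \<^prop>\<open>x \<noteq> y\<close>.
\<close>

definition arc_from_to :: "'a::metric_space set \<Rightarrow> 'a \<Rightarrow> 'a \<Rightarrow> bool" where
  "arc_from_to A x y \<longleftrightarrow>
     (\<exists>g. arc g \<and> path_image g = A \<and> pathstart g = x \<and> pathfinish g = y)"

definition arcwise_connected :: "'a::metric_space set \<Rightarrow> bool" where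
  "arcwise_connected X \<longleftrightarrow>
     (\<forall>x\<in>X. \<forall>y\<in>X. x \<noteq> y \<longrightarrow> (\<exists>A\<subseteq>X. arc_from_to A x y))"

definition dendroid :: "'a::metric_space set \<Rightarrow> bool" where
  "dendroid X \<longleftrightarrow> continuum X \<and> hereditarily_unicoherent X \<and> arcwise_connected X"

definition the_arc :: "'a::metric_space set \<Rightarrow> 'a \<Rightarrow> 'a \<Rightarrow> 'a set" where
  "the_arc X x y = (if x = y then {x} else (THE A. A \<subseteq> X \<and> arc_from_to A x y))"

definition hausdorff_dist :: "'a::metric_space set \<Rightarrow> 'a set \<Rightarrow> real" where
  "hausdorff_dist A B = max (SUP a\<in>A. infdist a B) (SUP b\<in>B. infdist b A)"

definition smooth_dendroid :: "'a::metric_space set \<Rightarrow> bool" where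
  "smooth_dendroid X \<longleftrightarrow>
     dendroid X \<and>
     (\<exists>p\<in>X. \<forall>s. \<forall>x\<in>X. (\<forall>n::nat. s n \<in> X) \<and> s \<longlonglongrightarrow> x \<longrightarrow>
        (\<lambda>n. hausdorff_dist (the_arc X (s n) p) (the_arc X x p)) \<longlonglongrightarrow> 0)"

definition endpoints :: "'a::metric_space set \<Rightarrow> 'a set" where
  "endpoints X =
     {e \<in> X. \<forall>A x y. A \<subseteq> X \<and> arc_from_to A x y \<and> e \<in> A \<longrightarrow> e = x \<or> e = y}"

definition arc_component :: "'a::metric_space set \<Rightarrow> 'a \<Rightarrow> 'a set" where
  "arc_component S x = {y \<in> S. y = x \<or> (\<exists>A\<subseteq>S. arc_from_to A x y)}"

definition order_at :: "'a::metric_space set \<Rightarrow> 'a \<Rightarrow> enat" where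
  "order_at X x =
     (let C = arc_component (X - {x}) ` (X - {x})
      in if finite C then enat (card C) else \<infinity>)"

definition ramification_point :: "'a::metric_space set \<Rightarrow> 'a \<Rightarrow> bool" where
  "ramification_point X x \<longleftrightarrow> x \<in> X \<and> order_at X x \<ge> 3"

definition fan :: "'a::metric_space set \<Rightarrow> bool" where
  "fan X \<longleftrightarrow> dendroid X \<and> (\<exists>!x. ramification_point X x)"

definition lelek_fan :: "'a::metric_space set \<Rightarrow> bool" where
  "lelek_fan X \<longleftrightarrow> fan X \<and> smooth_dendroid X \<and> X \<subseteq> closure (endpoints X)"

definition suslinian :: "'a::metric_space set \<Rightarrow> bool" where
  "suslinian X \<longleftrightarrow>
     continuum X \<and>
     \<not> (\<exists>\<C>. uncountable \<C> \<and> pairwise disjnt \<C> \<and>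
            (\<forall>A\<in>\<C>. subcontinuum A X \<and> nondegenerate A))"

text \<open>
  In a dendroid the description in \<^const>\<open>the_arc\<close> picks out the unique arc.
\<close>

lemma connected_subset_arc_eq:
  assumes A: "arc_from_to A x y" and C: "C \<subseteq> A" "connected C" "x \<in> C" "y \<in> C"
  shows "C = A"
proof -
  from A obtain g where g: "arc g" "path_image g = A" "pathstart g = x" "pathfinish g = y"
    unfolding arc_from_to_def by blast
  then obtain h where h: "homeomorphism {0..1} A g h"
    using homeomorphism_compact[of "{0..1::real}" g A]
    by (auto simp: arc_def path_def path_image_def)
  have "connected (h ` C)"
    using C(1,2) homeomorphism_cont2[OF h]
    by (blast intro: connected_continuous_image continuous_on_subset)
  moreover have "h x = 0" "h y = 1"
    using homeomorphism_apply1[OF h, of 0] homeomorphism_apply1[OF h, of 1] g(3,4)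
    by (simp_all add: pathstart_def pathfinish_def)
  then have "0 \<in> h ` C" "1 \<in> h ` C"
    using C(3,4) by (metis imageI)+
  ultimately have "{0..1} \<subseteq> h ` C"
    by (rule connected_contains_Icc)
  then have "A \<subseteq> g ` h ` C"
    using image_mono[of "{0..1}" "h ` C" g] homeomorphism_image1[OF h] by simp
  also have "g ` h ` C = (\<lambda>z. z) ` C"
    unfolding image_image using C(1) homeomorphism_apply2[OF h]
    by (intro image_cong) auto
  finally show ?thesis using C(1) by simp
qed

lemma arc_from_to_ends: "arc_from_to A x y \<Longrightarrow> x \<in> A \<and> y \<in> A"
  by (auto simp: arc_from_to_def)

lemma arc_from_to_subcontinuum: "A \<subseteq> X \<Longrightarrow> arc_from_to A x y \<Longrightarrow> subcontinuum A X"
  by (auto simp: arc_from_to_def subcontinuum_def continuum_def compact_arc_image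
      connected_arc_image path_image_nonempty)

lemma dendroid_arc_unique:
  assumes "dendroid X" "A \<subseteq> X" "arc_from_to A x y" "B \<subseteq> X" "arc_from_to B x y"
  shows "A = B"
proof -
  have "connected (A \<inter> B)"
    using assms(1) arc_from_to_subcontinuum[OF assms(2,3)] arc_from_to_subcontinuum[OF assms(4,5)]
    unfolding dendroid_def hereditarily_unicoherent_def by blast
  moreover have "x \<in> A \<inter> B" "y \<in> A \<inter> B"
    using assms arc_from_to_ends by blast+
  ultimately have "A \<inter> B = A" and "A \<inter> B = B"
    by (intro connected_subset_arc_eq[OF assms(3)] connected_subset_arc_eq[OF assms(5)];
        simp)+
  then show ?thesis by simp
qed

lemma the_arc_props:
  assumes "dendroid X" "x \<in> X" "y \<in> X" "x \<noteq> y"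
  shows "the_arc X x y \<subseteq> X \<and> arc_from_to (the_arc X x y) x y"
proof -
  obtain A where A: "A \<subseteq> X" "arc_from_to A x y"
    using assms unfolding dendroid_def arcwise_connected_def by blast
  have "\<exists>!A. A \<subseteq> X \<and> arc_from_to A x y"
    using A dendroid_arc_unique[OF assms(1)] by metis
  from theI'[OF this] show ?thesis
    using assms(4) by (simp add: the_arc_def)
qed

end

theory Submission
  imports Defs
begin

text \<open>
  A smooth fan \<open>L\<close> is smooth at its vertex \<open>v\<close>, and a Whitney-type function \<open>h\<close> measures height along
  its legs.  For each \<open>n\<close> the endpoints are partitioned into countably many pieces of small diameter on
  which the height \<open>h e\<close> varies little: the endpoints with height in an interval of a geometric grid
  correspond to a relatively open subset of a compact zero-dimensional level set \<open>{h = b}\<close>, which is a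
  disjoint union of a null sequence of clopen sets.  Let \<open>sig n\<close> be the index of the \<open>n\<close>-th piece and
  \<open>thresh n\<close> a number slightly below all heights in it.  Identify two points of equal height \<open>t\<close> on the
  legs of \<open>e\<close> and \<open>e'\<close> if for some \<open>n\<close> with \<open>t \<le> thresh n\<close> the endpoints agree in \<open>sig 0, \<dots>, sig n\<close>.
  Since the pieces form null sequences this relation is closed, so the quotient \<open>D\<close> is a compact metric
  space.  Endpoints are never identified with anything, and their set is mapped homeomorphically.  As the
  thresholds at \<open>e\<close> tend to \<open>h e\<close>, only countably many points of \<open>D\<close> at height \<open>a\<close> lie below a point of
  height \<open>b > a\<close>.  This makes the level sets of \<open>D\<close> totally disconnected, whence \<open>D\<close> is a smooth
  dendroid, and it makes \<open>D\<close> Suslinian.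
\<close>

section \<open>Compact metric spaces\<close>

text \<open>The obstacle is a conflict: to be Suslinian, \<open>D\<close> may have only countably
  many points at height \<open>a\<close> below any larger height, while the endpoints must keep
  their topology. Gluing strictly below the endpoints, with thresholds that climb to them, leaves
  every endpoint alone in its class, and a continuous map on a compact space is a homeomorphism on a
  set of points that form singleton classes. The pieces are cut out on level sets, not among the
  endpoints, because compactness provides clopen partitions there. The height of the endpoint above
  a point of a level need not be continuous but is upper semicontinuous, so the legs that rise too
  high form a compact set, which is removed. The pieces have to shrink towards the removed set,
  since otherwise glued pairs could converge to pairs that are not glued. Density of the endpoints
  enters at the vertex: legs short enough are never glued to a given longer one, so the root of
  \<open>D\<close> lies inside an arc and is no additional endpoint.\<close>

lemma compact_closed_subset:
  fixes S :: "'a::t2_space set"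
  assumes "compact S" "closed T" "T \<subseteq> S"
  shows "compact T"
  using compact_Int_closed[OF assms(1,2)] assms(3) by (simp add: Int_absorb1)

lemma compact_subseq:
  fixes f :: "nat \<Rightarrow> 'a::metric_space"
  assumes "compact K" "\<And>k. f k \<in> K"
  shows "\<exists>l r. l \<in> K \<and> strict_mono r \<and> (f \<circ> r) \<longlonglongrightarrow> l"
  using assms(1)[unfolded compact_def, rule_format, of f] assms(2) by blast

lemma compact_LIMSEQ:
  fixes f :: "nat \<Rightarrow> 'a::metric_space"
  assumes K: "compact K" "\<And>k. f k \<in> K"
    and lim: "\<And>s l'. strict_mono (s :: nat \<Rightarrow> nat) \<Longrightarrow> (\<lambda>k. f (s k)) \<longlonglongrightarrow> l' \<Longrightarrow> l' = l"
  shows "f \<longlonglongrightarrow> l"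
proof (rule ccontr)
  assume "\<not> f \<longlonglongrightarrow> l"
  then obtain e where e: "e > 0" "\<not> (\<forall>\<^sub>F k in sequentially. dist (f k) l < e)"
    unfolding tendsto_iff by blast
  then have "infinite {k. \<not> dist (f k) l < e}"
    unfolding cofinite_eq_sequentially[symmetric] eventually_cofinite by simp
  then obtain s :: "nat \<Rightarrow> nat" where s: "strict_mono s" "\<And>k. s k \<in> {k. \<not> dist (f k) l < e}"
    using infinite_enumerate by blast
  obtain l' s' where l': "strict_mono s'" "((\<lambda>k. f (s k)) \<circ> s') \<longlonglongrightarrow> l'"
    using compact_subseq[OF K(1), of "\<lambda>k. f (s k)"] K(2) by blast
  have "strict_mono (s \<circ> s')" using s(1) l'(1) by (rule strict_mono_o)
  then have "l' = l" using lim[of "s \<circ> s'" l'] l'(2) by (simp add: o_def)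
  then have "(\<lambda>k. dist (f (s (s' k))) l) \<longlonglongrightarrow> 0"
    using iffD1[OF tendsto_dist_iff l'(2)] by (simp add: o_def)
  then have "\<forall>\<^sub>F k in sequentially. dist (f (s (s' k))) l < e"
    by (rule order_tendstoD(2)) (rule e(1))
  then show False using s(2) eventually_sequentially by auto
qed

lemma compact_countable_dense:
  fixes S :: "'a::metric_space set"
  assumes "compact S"
  obtains d :: "nat \<Rightarrow> 'a" where "\<And>x e. x \<in> S \<Longrightarrow> 0 < e \<Longrightarrow> \<exists>n. dist x (d n) < e"
proof -
  have "\<exists>D. countable D \<and> S \<subseteq> closure D"
  proof -
    have "\<forall>n::nat. \<exists>k. finite k \<and> S \<subseteq> (\<Union>x\<in>k. ball x (1 / Suc n))"
      using assms unfolding compact_eq_totally_bounded by (auto simp del: of_nat_Suc)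
    then obtain k where k: "\<And>n::nat. finite (k n) \<and> S \<subseteq> (\<Union>x\<in>k n. ball x (1 / Suc n))"
      by metis
    have "S \<subseteq> closure (\<Union>n. k n)"
    proof
      fix x assume x: "x \<in> S"
      show "x \<in> closure (\<Union>n. k n)"
        unfolding closure_approachable
      proof (intro allI impI)
        fix e :: real assume "0 < e"
        then obtain n :: nat where n: "1 / Suc n < e" using nat_approx_posE by blast
        have "x \<in> (\<Union>y\<in>k n. ball y (1 / Suc n))" using k[of n] x by blast
        then obtain y where "y \<in> k n" "dist y x < 1 / Suc n" by auto
        then show "\<exists>y\<in>\<Union>n. k n. dist y x < e" using n by force
      qed
    qed
    moreover have "countable (\<Union>n. k n)" using k by (simp add: countable_finite)
    ultimately show ?thesis using k by blast
  qed
  then obtain D where D: "countable D" "S \<subseteq> closure D" by blast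
  show ?thesis
  proof (cases "D = {}")
    case True
    then show ?thesis using that[of undefined] D by auto
  next
    case False
    have "\<exists>n. dist x (from_nat_into D n) < e" if xe: "x \<in> S" "0 < e" for x e
    proof -
      have "x \<in> closure D" using D(2) xe by blast
      then obtain y where "y \<in> D" "dist y x < e" using xe(2) unfolding closure_approachable by blast
      then show ?thesis using from_nat_into_surj[OF D(1)] by (metis dist_commute)
    qed
    then show ?thesis using that by blast
  qed
qed

lemma infdist_lessD:
  assumes "A \<noteq> {}" "infdist x A < b"
  shows "\<exists>a\<in>A. dist x a < b"
  using cInf_lessD[of "dist x ` A" b] assms by (auto simp: infdist_notempty)

text \<open>By compactness \<open>F\<close> is a closed map onto its image, hence a quotient map, so
  continuity of \<open>g\<close> can be tested on \<open>S\<close>.\<close>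

lemma continuous_on_factor:
  fixes F :: "'a::metric_space \<Rightarrow> 'b::metric_space" and g :: "'b \<Rightarrow> 'c::topological_space"
  assumes "compact S" "continuous_on S F" "continuous_on S (\<lambda>x. g (F x))"
  shows "continuous_on (F ` S) g"
  unfolding continuous_on_closed_vimage[OF compact_imp_closed[OF compact_continuous_image[OF assms(2,1)]]]
proof (intro allI impI)
  fix B :: "'c set" assume "closed B"
  then have "closed (S \<inter> (\<lambda>x. g (F x)) -` B)"
    using continuous_closed_preimage[OF assms(3) compact_imp_closed[OF assms(1)]] by blast
  then have "compact (S \<inter> (\<lambda>x. g (F x)) -` B)"
    using compact_Int_closed[OF assms(1)] by (metis inf.left_idem)
  then have "compact (F ` (S \<inter> (\<lambda>x. g (F x)) -` B))"
    by (rule compact_continuous_image[OF continuous_on_subset[OF assms(2)], rotated]) blast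
  moreover have "F ` (S \<inter> (\<lambda>x. g (F x)) -` B) = g -` B \<inter> F ` S" by auto
  ultimately show "closed (g -` B \<inter> F ` S)" by (simp add: compact_imp_closed)
qed

section \<open>Clopen separation and null partitions\<close>

lemma clopen_separation_connected:
  fixes K :: "'a::metric_space set"
  assumes K: "compact K" and conn: "\<And>Z. Z \<subseteq> K \<Longrightarrow> connected Z \<Longrightarrow> z \<in> Z \<Longrightarrow> Z \<inter> F = {}"
    and z: "z \<in> K" and F: "closed F"
  obtains V where "V \<subseteq> K" "compact V" "compact (K - V)" "z \<in> V" "V \<inter> F = {}"
proof -
  let ?X = "top_of_set K"
  \<comment> \<open>Cut-wire fence: in a compact Hausdorff space components are quasi-components, so
    what no connected set joins is separated by a clopen set. Clopen is phrased as compactness of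
    both \<open>V\<close> and \<open>K - V\<close>.\<close>
  have "separated_between ?X {z} (K \<inter> F)"
  proof (rule cut_wire_fence_theorem_gen)
    show "compact_space ?X" using K by (simp add: compact_space_subtopology)
    show "Hausdorff_space ?X \<or> regular_space ?X \<or> normal_space ?X"
      by (simp add: Hausdorff_space_subtopology)
    show "compactin ?X {z}" using z by (simp add: compactin_subtopology)
    show "closedin ?X (K \<inter> F)" using F by (simp add: closedin_closed_Int)
    show "disjnt C {z} \<or> disjnt C (K \<inter> F)" if "connectedin ?X C" for C
      using that conn[of C] by (auto simp: connectedin_subtopology disjnt_def)
  qed
  then obtain U where U: "openin ?X U" "closedin ?X U" "z \<in> U" "K \<inter> F \<subseteq> K - U"
    unfolding separated_between by auto
  have "U \<subseteq> K" using U(2) closedin_subset by fastforce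
  moreover have "compact U" using U(2) K closedin_compact by blast
  moreover have "closedin ?X (K - U)" using U(1) by (metis closedin_diff closedin_topspace topspace_euclidean_subtopology)
  then have "compact (K - U)" using K closedin_compact by blast
  ultimately show ?thesis using that[of U] U by blast
qed

lemma clopen_separation:
  fixes K :: "'a::metric_space set"
  assumes K: "compact K" and td: "\<And>Z z z'. Z \<subseteq> K \<Longrightarrow> connected Z \<Longrightarrow> z \<in> Z \<Longrightarrow> z' \<in> Z \<Longrightarrow> z = z'"
    and z: "z \<in> K" "z \<notin> F" and F: "closed F"
  obtains V where "V \<subseteq> K" "compact V" "compact (K - V)" "z \<in> V" "V \<inter> F = {}"
proof (rule clopen_separation_connected[OF K _ z(1) F])
  show "Z \<inter> F = {}" if "Z \<subseteq> K" "connected Z" "z \<in> Z" for Z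
    using td[OF that] z(2) by blast
qed (rule that)

text \<open>Clopen sets inside small balls cover \<open>K - F\<close>. Countably many suffice, and
  assigning to each point the first one that contains it makes the cover disjoint. Radii
  proportional to the distance from \<open>F\<close> make the pieces shrink towards
  \<open>F\<close>.\<close>

lemma null_clopen_partition:
  fixes K :: "'a::metric_space set"
  assumes K: "compact K" and td: "\<And>Z z z'. Z \<subseteq> K \<Longrightarrow> connected Z \<Longrightarrow> z \<in> Z \<Longrightarrow> z' \<in> Z \<Longrightarrow> z = z'"
    and F: "closed F" and "0 < \<delta>"
  obtains \<iota> :: "'a \<Rightarrow> nat" where
    "\<And>u. u \<in> K - F \<Longrightarrow> \<exists>V. u \<in> V \<and> V \<subseteq> K - F \<and> compact V \<and> compact (K - V) \<and> (\<forall>w\<in>K - F. \<iota> w = \<iota> u \<longleftrightarrow> w \<in> V)"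
    "\<And>u w. u \<in> K - F \<Longrightarrow> w \<in> K - F \<Longrightarrow> \<iota> u = \<iota> w \<Longrightarrow> dist u w < \<delta> \<and> (F \<noteq> {} \<longrightarrow> dist u w \<le> infdist u F)"
proof -
  \<comment> \<open>\<open>infdist\<close> to the empty set is 0 by convention, so that case gets
    the value 1.\<close>
  define g where "g x = (if F = {} then 1 else infdist x F)" for x
  have g_cont: "continuous_on K g" unfolding g_def by (cases "F = {}") (auto intro!: continuous_intros)
  have g_pos: "g x > 0" if "x \<notin> F" for x
    using that in_closed_iff_infdist_zero[OF F] infdist_nonneg[of x F] unfolding g_def
    by (cases "F = {}") (auto simp: less_le)
  have g_tri: "g x \<le> g y + dist x y" for x y
    unfolding g_def by (cases "F = {}") (auto simp: infdist_triangle)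
  \<comment> \<open>A quarter: if \<open>u\<close> and \<open>w\<close> lie within
    \<open>g x / 4\<close> of \<open>x\<close>, then \<open>g x <= g u + g x / 4\<close>, so their
    distance, below \<open>g x / 2\<close>, is below \<open>g u\<close>.\<close>
  define \<rho> where "\<rho> x = min (\<delta>/2) (g x / 4)" for x
  have "\<exists>V. V \<subseteq> K \<and> compact V \<and> compact (K - V) \<and> x \<in> V \<and> V \<inter> (- ball x (\<rho> x) \<union> F) = {}" if x: "x \<in> K - F" for x
  proof -
    have "0 < \<rho> x" using g_pos[of x] x \<open>0 < \<delta>\<close> unfolding \<rho>_def by auto
    then have "x \<notin> - ball x (\<rho> x) \<union> F" using x by auto
    moreover have "closed (- ball x (\<rho> x) \<union> F)" using F by (intro closed_Un) auto
    moreover have "x \<in> K" using x by blast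
    ultimately show ?thesis
      by - (rule clopen_separation[where K = K and z = x and F = "- ball x (\<rho> x) \<union> F"],
        rule K, rule td, assumption+, iprover)
  qed
  then obtain V where V: "\<And>x. x \<in> K - F \<Longrightarrow> V x \<subseteq> K \<and> compact (V x) \<and> compact (K - V x) \<and> x \<in> V x \<and>
      V x \<inter> (- ball x (\<rho> x) \<union> F) = {}" by metis
  \<comment> \<open>A compact exhaustion of \<open>K - F\<close>: finitely many \<open>V x\<close>
    cover each \<open>C n\<close>, so countably many cover the union.\<close>
  define C where "C n = {x \<in> K. 1 / Suc n \<le> g x \<and> x \<notin> F}" for n :: nat
  have C_alt: "C n = {x \<in> K. 1 / Suc n \<le> g x}" for n
  proof -
    have "x \<notin> F" if "1 / Suc n \<le> g x" for x
    proof
      assume "x \<in> F"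
      then have "g x = 0" unfolding g_def by auto
      then show False using that by (simp add: field_simps)
    qed
    then show ?thesis unfolding C_def by blast
  qed
  have "compact (C n)" for n
  proof -
    have "closed {x \<in> K. 1 / Suc n \<le> g x}"
      using continuous_closed_preimage[OF g_cont compact_imp_closed[OF K], of "{1 / Suc n..}"]
      by (simp add: vimage_def Int_def)
    then show ?thesis unfolding C_alt by (rule compact_closed_subset[OF K]) blast
  qed
  moreover have "C n \<subseteq> (\<Union>x\<in>C n. - (K - V x))" for n
    using V unfolding C_def by blast
  moreover have "open (- (K - V x))" if "x \<in> C n" for x n
    using V[of x] that compact_imp_closed unfolding C_def by blast
  ultimately have "\<exists>D\<subseteq>C n. finite D \<and> C n \<subseteq> (\<Union>x\<in>D. - (K - V x))" for n
    using compactE_image[of "C n" "C n" "\<lambda>x. - (K - V x)"] by metis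
  then obtain D where D: "\<And>n. D n \<subseteq> C n \<and> finite (D n) \<and> C n \<subseteq> (\<Union>x\<in>D n. - (K - V x))" by metis
  define A where "A = (\<Union>n. D n)"
  have "countable A" unfolding A_def using D by (simp add: countable_finite)
  have AK: "A \<subseteq> K - F" unfolding A_def using D C_def by blast
  define e where "e = from_nat_into A"
  have covA: "\<exists>x\<in>A. u \<in> V x" if u: "u \<in> K - F" for u
  proof -
    obtain n :: nat where "1 / Suc n < g u" using nat_approx_posE[OF g_pos[of u]] u by blast
    then have "u \<in> C n" unfolding C_def using u by auto
    then obtain x where "x \<in> D n" "u \<in> V x" using D[of n] u by blast
    then show ?thesis unfolding A_def by blast
  qed
  have cov: "\<exists>n. u \<in> V (e n)" if "u \<in> K - F" for u
    using covA[OF that] from_nat_into_surj[OF \<open>countable A\<close>] unfolding e_def by metis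
  have eK: "e n \<in> K - F" if "K - F \<noteq> {}" for n
  proof -
    have "A \<noteq> {}" using covA that by blast
    then show ?thesis using AK from_nat_into[of A n] unfolding e_def by blast
  qed
  define \<iota> where "\<iota> u = (LEAST n. u \<in> V (e n))" for u
  have \<iota>: "u \<in> V (e (\<iota> u))" "\<And>m. m < \<iota> u \<Longrightarrow> u \<notin> V (e m)" if "u \<in> K - F" for u
  proof -
    show "u \<in> V (e (\<iota> u))" unfolding \<iota>_def using cov[OF that] by (metis LeastI)
    show "u \<notin> V (e m)" if "m < \<iota> u" for m
      using that not_less_Least unfolding \<iota>_def by blast
  qed
  show ?thesis
  proof (rule that)
    fix u assume u: "u \<in> K - F"
    define W where "W = V (e (\<iota> u)) \<inter> (\<Inter>m<\<iota> u. K - V (e m)) \<inter> K"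
    have ek: "e n \<in> K - F" for n using eK u by blast
    have "u \<in> W" unfolding W_def using \<iota>[OF u] u by blast
    moreover have "W \<subseteq> K - F" unfolding W_def using V[OF ek] by blast
    moreover have "compact W"
    proof -
      have "closed (\<Inter>m<\<iota> u. K - V (e m))"
        using V[OF ek] by (intro closed_INT ballI compact_imp_closed) blast
      moreover have "W = V (e (\<iota> u)) \<inter> (\<Inter>m<\<iota> u. K - V (e m))" unfolding W_def using V[OF ek] by blast
      ultimately show ?thesis using V[OF ek] by (simp add: compact_Int_closed)
    qed
    moreover have "compact (K - W)"
    proof -
      have "K - W = (K - V (e (\<iota> u))) \<union> (\<Union>m<\<iota> u. V (e m))"
        unfolding W_def using V[OF ek] by blast
      moreover have "compact (\<Union>m<\<iota> u. V (e m))" using V[OF ek] by (intro compact_UN) auto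
      ultimately show ?thesis using V[OF ek] by (simp add: compact_Un)
    qed
    moreover have "\<iota> w = \<iota> u \<longleftrightarrow> w \<in> W" if w: "w \<in> K - F" for w
    proof
      assume "\<iota> w = \<iota> u"
      then show "w \<in> W" unfolding W_def using \<iota>[OF w] w by auto
    next
      assume "w \<in> W"
      then have "w \<in> V (e (\<iota> u))" "\<forall>m<\<iota> u. w \<notin> V (e m)" unfolding W_def by blast+
      then show "\<iota> w = \<iota> u" using \<iota>[OF w] by (metis linorder_neqE_nat)
    qed
    ultimately show "\<exists>V. u \<in> V \<and> V \<subseteq> K - F \<and> compact V \<and> compact (K - V) \<and> (\<forall>w\<in>K - F. \<iota> w = \<iota> u \<longleftrightarrow> w \<in> V)"
      by blast
  next
    fix u w assume u: "u \<in> K - F" and w: "w \<in> K - F" and eq: "\<iota> u = \<iota> w"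
    let ?x = "e (\<iota> u)"
    have "?x \<in> K - F" using eK u by blast
    moreover have "u \<in> V ?x" "w \<in> V ?x" using \<iota>(1)[OF u] \<iota>(1)[OF w] eq by auto
    ultimately have d: "dist ?x u < \<rho> ?x" "dist ?x w < \<rho> ?x" using V[of ?x] by auto
    have "dist u w < \<rho> ?x + \<rho> ?x" using dist_triangle3[of u w ?x] d by linarith
    moreover have "g ?x \<le> g u + dist ?x u" by (rule g_tri)
    ultimately have "dist u w < \<delta>" "dist u w \<le> g u" using d g_pos[of u] u unfolding \<rho>_def by auto
    then show "dist u w < \<delta> \<and> (F \<noteq> {} \<longrightarrow> dist u w \<le> infdist u F)"
      by (cases "F = {}") (simp_all add: g_def)
  qed
qed

section \<open>Embedding quotients by closed equivalence relations\<close>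

text \<open>
  The saturated open sets form a normal (not Hausdorff) topology on \<open>L\<close>; its Urysohn functions are
  constant on the classes of \<open>E\<close>, and countably many of them separate the classes.
\<close>

lemma quotient_embedding:
  fixes L :: "'a::metric_space set" and E :: "'a \<Rightarrow> 'a \<Rightarrow> bool"
  assumes L: "compact L"
    and refl: "\<And>x. x \<in> L \<Longrightarrow> E x x"
    and sym: "\<And>x y. x \<in> L \<Longrightarrow> y \<in> L \<Longrightarrow> E x y \<Longrightarrow> E y x"
    and trans: "\<And>x y z. x \<in> L \<Longrightarrow> y \<in> L \<Longrightarrow> z \<in> L \<Longrightarrow> E x y \<Longrightarrow> E y z \<Longrightarrow> E x z"
    and closed_E: "\<And>x y a b. (\<And>n::nat. x n \<in> L) \<Longrightarrow> (\<And>n. y n \<in> L) \<Longrightarrow> (\<And>n. E (x n) (y n)) \<Longrightarrow>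
      x \<longlonglongrightarrow> a \<Longrightarrow> y \<longlonglongrightarrow> b \<Longrightarrow> E a b"
  obtains F :: "'a \<Rightarrow> nat \<Rightarrow> real" where "continuous_on L F"
    "\<And>x y. x \<in> L \<Longrightarrow> y \<in> L \<Longrightarrow> F x = F y \<longleftrightarrow> E x y"
proof -
  have clL: "closed L" using L compact_imp_closed by blast
  define sat where "sat U \<longleftrightarrow> (\<forall>x\<in>U. \<forall>y\<in>L. E x y \<longrightarrow> y \<in> U)" for U
  define op where "op U \<longleftrightarrow> openin (top_of_set L) U \<and> sat U" for U
  have "istopology op"
    unfolding istopology_def op_def sat_def by (auto; blast)
  define T where "T = topology op"
  have opT: "openin T U \<longleftrightarrow> openin (top_of_set L) U \<and> sat U" for U
    unfolding T_def using topology_inverse'[OF \<open>istopology op\<close>] op_def by simp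
  have topT: "topspace T = L"
  proof -
    have "openin T L" using opT openin_subtopology_self by (auto simp: sat_def)
    moreover have "U \<subseteq> L" if "openin T U" for U using that opT openin_imp_subset by blast
    ultimately show ?thesis using openin_subset openin_topspace by blast
  qed
  have satC: "sat (L - U)" if "sat U" "U \<subseteq> L" for U
    using that sym unfolding sat_def by blast
  have clT: "closedin T C \<longleftrightarrow> closed C \<and> C \<subseteq> L \<and> sat C" for C
  proof
    assume "closedin T C"
    then have "C \<subseteq> L" "openin (top_of_set L) (L - C)" "sat (L - C)"
      unfolding closedin_def topT opT by auto
    moreover then have "closedin (top_of_set L) C" by (simp add: closedin_def)
    ultimately show "closed C \<and> C \<subseteq> L \<and> sat C"
      using clL closedin_closed_trans satC[of "L - C"] by (auto simp: double_diff)
  next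
    assume "closed C \<and> C \<subseteq> L \<and> sat C"
    then have "closedin (top_of_set L) C" "sat (L - C)" "C \<subseteq> L"
      using satC closed_subset by auto
    then show "closedin T C"
      unfolding closedin_def topT opT by (simp add: closedin_def)
  qed
  \<comment> \<open>Compactness supplies limits for the partners in \<open>K\<close>, and closedness
    of \<open>E\<close> keeps the limits related.\<close>
  have sat_closed: "closedin T {y \<in> L. \<exists>x\<in>K. E x y}" if K: "closed K" "K \<subseteq> L" for K
  proof -
    have "closed {y \<in> L. \<exists>x\<in>K. E x y}"
      unfolding closed_sequential_limits
    proof (intro allI impI, elim conjE)
      fix y b assume y: "\<forall>n. y n \<in> {y \<in> L. \<exists>x\<in>K. E x y}" and lim: "y \<longlonglongrightarrow> b"
      then have "\<forall>n. \<exists>x. x \<in> K \<and> E x (y n)" by blast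
      then obtain x where x: "\<And>n. x n \<in> K \<and> E (x n) (y n)" by metis
      have "compact K" using K L compact_Int_closed by (metis inf.absorb_iff2)
      then obtain a s where a: "a \<in> K" "strict_mono s" "(x \<circ> s) \<longlonglongrightarrow> a"
        using x unfolding compact_def by blast
      have "E a b"
        by (rule closed_E[of "x \<circ> s" "y \<circ> s"])
           (use x y K a LIMSEQ_subseq_LIMSEQ[OF lim a(2)] in \<open>auto simp: o_def\<close>)
      moreover have "b \<in> L" using closed_sequentially[OF clL _ lim] y by blast
      ultimately show "b \<in> {y \<in> L. \<exists>x\<in>K. E x y}" using a by blast
    qed
    moreover have "sat {y \<in> L. \<exists>x\<in>K. E x y}"
      unfolding sat_def using trans K by blast
    ultimately show ?thesis unfolding clT by blast
  qed
  have "normal_space T"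
    unfolding normal_space_def
  proof (intro allI impI)
    fix A B assume AB: "closedin T A \<and> closedin T B \<and> disjnt A B"
    then have "closed A" "closed B" "A \<inter> B = {}" "A \<subseteq> L" "B \<subseteq> L" "sat A" "sat B"
      by (auto simp: clT disjnt_def)
    then obtain U V where UV: "open U" "open V" "A \<subseteq> U" "B \<subseteq> V" "U \<inter> V = {}"
      using t4_space by metis
    \<comment> \<open>The union of the classes contained in \<open>U\<close>; it is open because its
      complement is the saturation of a closed set.\<close>
    define W where "W U = L - {y \<in> L. \<exists>x\<in>L - U. E x y}" for U
    have "openin T (W U')" if "open U'" for U'
    proof -
      have "closed (L - U')" using clL that by (simp add: closed_Diff)
      then have "closedin T {y \<in> L. \<exists>x\<in>L - U'. E x y}" by (intro sat_closed) auto
      then have "openin T (topspace T - {y \<in> L. \<exists>x\<in>L - U'. E x y})" by blast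
      then show ?thesis by (simp add: W_def topT)
    qed
    then have "openin T (W U)" "openin T (W V)" using UV by auto
    moreover have WU: "W U' \<subseteq> U'" for U' unfolding W_def using refl by blast
    then have "disjnt (W U) (W V)" using UV(5) unfolding disjnt_def by blast
    moreover have "C \<subseteq> W U'" if "C \<subseteq> U'" "C \<subseteq> L" "sat C" for C U'
      using that sym unfolding W_def sat_def by blast
    then have "A \<subseteq> W U" "B \<subseteq> W V"
      using UV(3,4) \<open>A \<subseteq> L\<close> \<open>B \<subseteq> L\<close> \<open>sat A\<close> \<open>sat B\<close> by simp_all
    ultimately show "\<exists>U V. openin T U \<and> openin T V \<and> A \<subseteq> U \<and> B \<subseteq> V \<and> disjnt U V" by blast
  qed
  define good where "good f \<longleftrightarrow> continuous_on L f \<and> (\<forall>x\<in>L. \<forall>y\<in>L. E x y \<longrightarrow> f x = f y)"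
    for f :: "'a \<Rightarrow> real"
  have sep: "\<exists>f. good f \<and> f x = 0 \<and> f y = 1" if xy: "x \<in> L" "y \<in> L" "\<not> E x y" for x y
  proof -
    have "closedin T {z \<in> L. \<exists>w\<in>{x}. E w z}" "closedin T {z \<in> L. \<exists>w\<in>{y}. E w z}"
      using xy by (intro sat_closed; simp)+
    moreover have "disjnt {z \<in> L. \<exists>w\<in>{x}. E w z} {z \<in> L. \<exists>w\<in>{y}. E w z}"
      using xy sym trans unfolding disjnt_def by blast
    ultimately obtain f where f: "continuous_map T euclideanreal f"
      "f ` {z \<in> L. \<exists>w\<in>{x}. E w z} \<subseteq> {0}" "f ` {z \<in> L. \<exists>w\<in>{y}. E w z} \<subseteq> {1}"
      by (rule Urysohn_lemma_alt[OF \<open>normal_space T\<close>])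
    have op: "openin T {z \<in> L. f z \<in> U}" if "open U" for U
      using f(1) that unfolding continuous_map_def topT by auto
    have "continuous_on L f"
      unfolding continuous_on_open_gen[of f L UNIV, simplified]
      using op by (auto simp: opT vimage_def Int_def)
    moreover have "f a = f b" if ab: "a \<in> L" "b \<in> L" "E a b" for a b
    proof (rule ccontr)
      assume "f a \<noteq> f b"
      have "openin T {z \<in> L. f z \<in> - {f b}}" by (rule op) (simp add: open_Compl)
      then have "sat {z \<in> L. f z \<in> - {f b}}" using opT by blast
      then show False using ab \<open>f a \<noteq> f b\<close> unfolding sat_def by auto
    qed
    ultimately have "good f" unfolding good_def by blast
    moreover have "f x \<in> {0}"
      using xy refl by (intro subsetD[OF f(2)] imageI) simp
    moreover have "f y \<in> {1}"
      using xy refl by (intro subsetD[OF f(3)] imageI) simp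
    ultimately show ?thesis by blast
  qed
  obtain d :: "nat \<Rightarrow> 'a" where d: "\<And>x e. x \<in> L \<Longrightarrow> 0 < e \<Longrightarrow> \<exists>n. dist x (d n) < e"
    by (rule compact_countable_dense[OF L], rule that)
  \<comment> \<open>Countably many functions suffice: for each pair of small balls around points of
    the dense sequence, one good function with values below 1/3 on one ball and above 2/3 on the
    other is kept, if there is any. If a good \<open>f\<close> separates \<open>x\<close> from
    \<open>y\<close>, continuity yields such a pair of balls around them.\<close>
  define P where "P i j k f \<longleftrightarrow> good f \<and> (\<forall>z\<in>L. dist z (d i) < 1 / Suc k \<longrightarrow> f z < 1/3) \<and>
      (\<forall>z\<in>L. dist z (d j) < 1 / Suc k \<longrightarrow> f z > 2/3)" for i j k :: nat and f
  define G where "G i j k = (if \<exists>f. P i j k f then (SOME f. P i j k f) else (\<lambda>_. 0))" for i j k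
  have G_good: "good (G i j k)" for i j k
  proof (cases "\<exists>f. P i j k f")
    case True
    then have "P i j k (G i j k)" unfolding G_def by (metis someI_ex)
    then show ?thesis unfolding P_def by blast
  next
    case False
    then have "G i j k = (\<lambda>_. 0)" unfolding G_def by (rule if_not_P)
    then show ?thesis unfolding good_def by simp
  qed
  define F where "F x n = G (fst (prod_decode n)) (fst (prod_decode (snd (prod_decode n))))
    (snd (prod_decode (snd (prod_decode n)))) x" for x n
  have "continuous_on L F"
    unfolding F_def
    by (intro continuous_on_coordinatewise_then_product)
       (use G_good good_def in blast)
  moreover have "F x = F y \<longleftrightarrow> E x y" if xy: "x \<in> L" "y \<in> L" for x y
  proof
    assume "E x y"
    then have "G i j k x = G i j k y" for i j k using G_good xy unfolding good_def by blast
    then show "F x = F y" unfolding F_def by auto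
  next
    assume eq: "F x = F y"
    show "E x y"
    proof (rule ccontr)
      assume "\<not> E x y"
      then obtain f where f: "good f" "f x = 0" "f y = 1" using sep xy by blast
      have c: "continuous_on L f" using f(1) good_def by blast
      obtain e1 where e1: "e1 > 0" "\<And>z. z \<in> L \<Longrightarrow> dist z x < e1 \<Longrightarrow> dist (f z) (f x) < 1/3"
        using c xy(1) unfolding continuous_on_iff by (metis divide_pos_pos zero_less_numeral zero_less_one)
      obtain e2 where e2: "e2 > 0" "\<And>z. z \<in> L \<Longrightarrow> dist z y < e2 \<Longrightarrow> dist (f z) (f y) < 1/3"
        using c xy(2) unfolding continuous_on_iff by (metis divide_pos_pos zero_less_numeral zero_less_one)
      \<comment> \<open>Half, because \<open>z\<close> is reached from \<open>x\<close> through
        \<open>d i\<close> in two steps.\<close>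
      obtain k :: nat where k: "1 / Suc k < min e1 e2 / 2"
        using nat_approx_posE[of "min e1 e2 / 2"] e1 e2 by auto
      obtain i where i: "dist x (d i) < 1 / Suc k" using d[OF xy(1), of "1 / Suc k"] by auto
      obtain j where j: "dist y (d j) < 1 / Suc k" using d[OF xy(2), of "1 / Suc k"] by auto
      have "f z < 1/3" if "z \<in> L" "dist z (d i) < 1 / Suc k" for z
      proof -
        have "dist z x < e1" using dist_triangle2[of z x "d i"] that i k by linarith
        then show ?thesis using e1(2)[OF that(1)] f by (simp add: dist_real_def)
      qed
      moreover have "f z > 2/3" if "z \<in> L" "dist z (d j) < 1 / Suc k" for z
      proof -
        have "dist z y < e2" using dist_triangle2[of z y "d j"] that j k by linarith
        then have "\<bar>f z - 1\<bar> < 1/3" using e2(2)[OF that(1)] f by (simp add: dist_real_def)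
        then show ?thesis by linarith
      qed
      ultimately have ex: "\<exists>f. P i j k f" using f unfolding P_def by blast
      then have "P i j k (G i j k)" unfolding G_def by (metis someI_ex)
      then have "G i j k x < 1/3" "G i j k y > 2/3" using xy i j unfolding P_def by auto
      moreover have "F x (prod_encode (i, prod_encode (j, k))) = F y (prod_encode (i, prod_encode (j, k)))"
        using eq by simp
      then have "G i j k x = G i j k y" unfolding F_def by simp
      ultimately show False by linarith
    qed
  qed
  ultimately show ?thesis using that by blast
qed

section \<open>Arcs\<close>

lemma arc_from_to_image:
  fixes f :: "real \<Rightarrow> 'a::metric_space"
  assumes "a < b" "continuous_on {a..b} f" "inj_on f {a..b}"
  shows "arc_from_to (f ` {a..b}) (f a) (f b)"
proof -
  let ?l = "\<lambda>u. a + u * (b - a)"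
  have l: "?l ` {0..1} = {a..b}"
  proof -
    have "(\<lambda>x. (b - a) * x + a) ` {0..1} = {a..b}"
      using assms(1) by (subst image_affinity_atLeastAtMost) auto
    then show ?thesis by (simp add: algebra_simps)
  qed
  have "arc (f \<circ> ?l)"
    unfolding arc_def path_def
  proof
    show "continuous_on {0..1} (f \<circ> ?l)"
      by (intro continuous_on_compose continuous_intros) (simp add: l assms)
    show "inj_on (f \<circ> ?l) {0..1}"
      using assms(1,3) by (intro comp_inj_on) (auto simp: inj_on_def l)
  qed
  moreover have "path_image (f \<circ> ?l) = f ` {a..b}"
    unfolding path_image_def using l by (metis image_comp)
  ultimately show ?thesis
    unfolding arc_from_to_def by (intro exI[of _ "f \<circ> ?l"]) (auto simp: pathstart_def pathfinish_def)
qed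

lemma arc_from_to_sym: "arc_from_to A x y \<Longrightarrow> arc_from_to A y x"
  unfolding arc_from_to_def
  by (metis arc_reversepath path_image_reversepath pathfinish_reversepath pathstart_reversepath)

lemma arc_from_to_join:
  assumes "arc_from_to A x y" "arc_from_to B y z" "A \<inter> B \<subseteq> {y}"
  shows "arc_from_to (A \<union> B) x z"
  using assms unfolding arc_from_to_def
  by (metis arc_join path_image_join pathfinish_join pathstart_join)

lemma arc_from_to_cont:
  assumes "arc_from_to A x y"
  shows "continuum A" "compact A" "closed A" "connected A" "x \<in> A" "y \<in> A"
  using arc_from_to_subcontinuum[of A A x y] arc_from_to_ends[of A x y] assms
  by (auto simp: subcontinuum_def continuum_def compact_imp_closed)

lemma arc_from_to_param:
  assumes "arc_from_to A x y"
  obtains g where "continuous_on {0..1} g" "inj_on g {0..1::real}" "g ` {0..1} = A" "g 0 = x" "g 1 = y"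
  using assms unfolding arc_from_to_def arc_def path_def path_image_def pathstart_def pathfinish_def
  by blast

lemma arc_from_to_neq: "arc_from_to A x y \<Longrightarrow> x \<noteq> y"
  by (metis arc_from_to_def arc_distinct_ends)

text \<open>By hereditary unicoherence the arc meets \<open>K\<close> in a connected set, and a
  connected part of an arc that contains both ends is the whole arc.\<close>

lemma subcontinuum_contains_arc:
  assumes "dendroid X" "A \<subseteq> X" "arc_from_to A x y" "subcontinuum K X" "x \<in> K" "y \<in> K"
  shows "A \<subseteq> K"
proof -
  have "connected (A \<inter> K)"
    using assms arc_from_to_subcontinuum[OF assms(2,3)]
    unfolding dendroid_def hereditarily_unicoherent_def by blast
  then have "A \<inter> K = A"
    by (rule connected_subset_arc_eq[OF assms(3), rotated])
       (use assms arc_from_to_ends in blast)+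
  then show ?thesis by blast
qed

lemma hausdorff_dist_nonneg:
  assumes "compact A" "compact B" "A \<noteq> {}" "B \<noteq> {}"
  shows "0 \<le> hausdorff_dist A B"
proof -
  obtain a where "a \<in> A" using assms by blast
  have "bdd_above ((\<lambda>a. infdist a B) ` A)"
    by (intro compact_imp_bounded[THEN bounded_imp_bdd_above] compact_continuous_image continuous_intros assms)
  then have "infdist a B \<le> (SUP a\<in>A. infdist a B)"
    using \<open>a \<in> A\<close> by (rule cSUP_upper[rotated])
  then show ?thesis
    unfolding hausdorff_dist_def using infdist_nonneg[of a B] by linarith
qed

lemma infdist_hausdorff:
  assumes "compact A" "compact B" "a \<in> A"
  shows "infdist a B \<le> hausdorff_dist A B"
proof -
  have "bdd_above ((\<lambda>a. infdist a B) ` A)"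
    by (intro compact_imp_bounded[THEN bounded_imp_bdd_above] compact_continuous_image continuous_intros assms)
  then have "infdist a B \<le> (SUP a\<in>A. infdist a B)"
    using \<open>a \<in> A\<close> by (rule cSUP_upper[rotated])
  then show ?thesis
    unfolding hausdorff_dist_def by linarith
qed

section \<open>Spaces with a radial structure\<close>

text \<open>
  \<^term>\<open>r x t\<close> is the point of height \<^term>\<open>min t (h x)\<close> on the arc from the root \<^term>\<open>v\<close> to \<^term>\<open>x\<close>.
\<close>

locale radial =
  fixes X :: "'a::metric_space set" and h :: "'a \<Rightarrow> real" and r :: "'a \<Rightarrow> real \<Rightarrow> 'a" and v :: 'a
  assumes compact_X: "compact X" and v_in: "v \<in> X"
    and cont_h: "continuous_on X h"
    and cont_r: "continuous_on (X \<times> {0..1}) (\<lambda>p. r (fst p) (snd p))"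
    and h_nonneg: "x \<in> X \<Longrightarrow> 0 \<le> h x" and h_le_1: "x \<in> X \<Longrightarrow> h x \<le> 1"
    and r_0: "x \<in> X \<Longrightarrow> r x 0 = v"
    and r_h: "x \<in> X \<Longrightarrow> r x (h x) = x"
    and r_in: "x \<in> X \<Longrightarrow> t \<in> {0..1} \<Longrightarrow> r x t \<in> X"
    and h_r: "x \<in> X \<Longrightarrow> t \<in> {0..1} \<Longrightarrow> h (r x t) = min t (h x)"
    and r_r: "x \<in> X \<Longrightarrow> t \<in> {0..1} \<Longrightarrow> s \<in> {0..1} \<Longrightarrow> r (r x t) s = r x (min s t)"
begin

lemma h_v: "h v = 0"
  using h_r[OF v_in, of 0] h_nonneg[OF v_in] r_0[OF v_in] by simp

lemma h_in: "x \<in> X \<Longrightarrow> h x \<in> {0..1}"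
  using h_nonneg h_le_1 by simp

lemma h_eq_0: "x \<in> X \<Longrightarrow> h x = 0 \<longleftrightarrow> x = v"
  using h_v r_h r_0 by metis

lemma h_pos: "x \<in> X \<Longrightarrow> x \<noteq> v \<Longrightarrow> 0 < h x"
  using h_eq_0 h_nonneg by force

lemma r_ge: "x \<in> X \<Longrightarrow> h x \<le> t \<Longrightarrow> t \<le> 1 \<Longrightarrow> r x t = x"
  using r_r[of x "h x" t] r_h[of x] h_in[of x] by simp

lemma h_r': "x \<in> X \<Longrightarrow> 0 \<le> t \<Longrightarrow> t \<le> h x \<Longrightarrow> h (r x t) = t"
  using h_r[of x t] h_in[of x] by simp

lemma cont_r_snd: "x \<in> X \<Longrightarrow> continuous_on {0..1} (r x)"
  using continuous_on_compose2[OF cont_r, of "{0..1}" "\<lambda>t. (x, t)"]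
  by (force intro!: continuous_intros)

lemma cont_r_fst: "t \<in> {0..1} \<Longrightarrow> continuous_on X (\<lambda>x. r x t)"
  using continuous_on_compose2[OF cont_r, of X "\<lambda>x. (x, t)"]
  by (force intro!: continuous_intros)

lemma inj_r: "x \<in> X \<Longrightarrow> inj_on (r x) {0..h x}"
  by (rule inj_onI) (metis h_r' atLeastAtMost_iff)

lemma r_lim:
  assumes "x \<longlonglongrightarrow> l" "t \<longlonglongrightarrow> s" "\<And>n. x n \<in> X" "\<And>n. t n \<in> {0..1}"
  shows "(\<lambda>n. r (x n) (t n)) \<longlonglongrightarrow> r l s"
proof -
  have l: "l \<in> X" "s \<in> {0..1}"
    using closed_sequentially[OF compact_imp_closed[OF compact_X] assms(3,1)]
      closed_sequentially[OF closed_atLeastAtMost assms(4,2)] by auto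
  have "(\<lambda>n. (x n, t n)) \<longlonglongrightarrow> (l, s)" using assms by (intro tendsto_Pair)
  then show ?thesis
    using cont_r[unfolded continuous_on_sequentially, rule_format, of "(l,s)" "\<lambda>n. (x n, t n)"] l assms
    by (auto simp: o_def)
qed

lemma h_lim:
  assumes "x \<longlonglongrightarrow> l" "\<And>n. x n \<in> X"
  shows "(\<lambda>n. h (x n)) \<longlonglongrightarrow> h l"
proof -
  have l: "l \<in> X"
    using closed_sequentially[OF compact_imp_closed[OF compact_X] assms(2,1)] by auto
  then show ?thesis
    using cont_h[unfolded continuous_on_sequentially, rule_format, of l x] assms
    by (auto simp: o_def)
qed

lemma arc_segment:
  assumes "x \<in> X" "0 \<le> s" "s < h x"
  shows "arc_from_to (r x ` {s..h x}) (r x s) x" "r x ` {s..h x} \<subseteq> X"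
proof -
  have "{s..h x} \<subseteq> {0..1}" using assms h_in by auto
  then have c: "continuous_on {s..h x} (r x)" using cont_r_snd assms continuous_on_subset by blast
  have i: "inj_on (r x) {s..h x}"
    using inj_r[OF assms(1)] assms(2) by (auto intro: inj_on_subset)
  show "arc_from_to (r x ` {s..h x}) (r x s) x"
    using arc_from_to_image[OF assms(3) c i] r_h assms by simp
  show "r x ` {s..h x} \<subseteq> X" using r_in[OF assms(1)] \<open>{s..h x} \<subseteq> {0..1}\<close> by blast
qed

lemma segment_compact_connected:
  assumes "x \<in> X" "0 \<le> s" "s \<le> h x"
  shows "compact (r x ` {s..h x})" "connected (r x ` {s..h x})" "r x ` {s..h x} \<subseteq> X"
    "x \<in> r x ` {s..h x}" "r x s \<in> r x ` {s..h x}"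
proof -
  have sub: "{s..h x} \<subseteq> {0..1}" using assms h_in by auto
  then have c: "continuous_on {s..h x} (r x)" using cont_r_snd assms continuous_on_subset by blast
  show "compact (r x ` {s..h x})" "connected (r x ` {s..h x})"
    by (auto intro: compact_continuous_image connected_continuous_image c)
  show "r x ` {s..h x} \<subseteq> X" using r_in[OF assms(1)] sub by blast
  show "x \<in> r x ` {s..h x}" using r_h[OF assms(1)] assms by force
  show "r x s \<in> r x ` {s..h x}" using assms by force
qed

text \<open>The heights at which the two legs agree form a compact set containing 0. The greatest
  one is where the arcs from the root to \<open>x\<close> and to \<open>y\<close> part.\<close>

lemma meet:
  assumes "x \<in> X" "y \<in> X"
  obtains m where "0 \<le> m" "m \<le> h x" "m \<le> h y" "r x m = r y m"
    "\<And>t. 0 \<le> t \<Longrightarrow> t \<le> h x \<Longrightarrow> t \<le> h y \<Longrightarrow> r x t = r y t \<Longrightarrow> t \<le> m"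
proof -
  let ?S = "{t \<in> {0..min (h x) (h y)}. r x t = r y t}"
  have sub: "{0..min (h x) (h y)} \<subseteq> {0..1}" using assms h_in[of x] by auto
  have c: "continuous_on {0..min (h x) (h y)} (r x)" "continuous_on {0..min (h x) (h y)} (r y)"
    using cont_r_snd assms continuous_on_subset sub by blast+
  have "closed ?S"
    using c by (intro continuous_closed_preimage_constant[of _ "\<lambda>t. dist (r x t) (r y t)" 0, simplified] continuous_intros) auto
  then have "compact ?S"
    by (intro compact_eq_bounded_closed[THEN iffD2] conjI)
      (auto intro: bounded_subset[of "{0..min (h x) (h y)}"])
  moreover have "0 \<in> ?S" using assms r_0 h_nonneg by auto
  ultimately obtain m where "m \<in> ?S" "\<forall>t\<in>?S. t \<le> m"
    by (metis (no_types, lifting) compact_attains_sup empty_iff)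
  then show ?thesis using that[of m] by auto
qed

end

section \<open>Totally disconnected levels make the space a smooth dendroid\<close>

locale radial_dendroid = radial +
  assumes levels: "\<And>Z t z z'. Z \<subseteq> X \<Longrightarrow> connected Z \<Longrightarrow> 0 < t \<Longrightarrow> (\<And>z. z \<in> Z \<Longrightarrow> h z = t) \<Longrightarrow> z \<in> Z \<Longrightarrow> z' \<in> Z \<Longrightarrow> z = z'"
begin

lemma compact_level: "compact {z \<in> X. h z = t}"
proof -
  have "closed {z \<in> X. h z = t}"
    using continuous_closed_preimage_constant[OF cont_h compact_imp_closed[OF compact_X]] by simp
  then show ?thesis by (rule compact_closed_subset[OF compact_X]) blast
qed

text \<open>
  If \<open>A\<close> misses \<open>r x t\<close>, then the points of \<open>A\<close> lying over a small clopen neighbourhood of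
  \<open>r x t\<close> in the level set \<open>{h = t}\<close> form a clopen subset of \<open>A\<close> that contains \<open>x\<close> but not \<open>y\<close>.
\<close>

lemma connected_contains_segment:
  assumes A: "compact A" "connected A" "A \<subseteq> X" and x: "x \<in> A" and y: "y \<in> A"
    and t: "0 \<le> t" "t \<le> h x" "r x t \<noteq> r y t"
  shows "r x t \<in> A"
proof (rule ccontr)
  assume nin: "r x t \<notin> A"
  have xX: "x \<in> X" and yX: "y \<in> X" using A x y by auto
  have t01: "t \<in> {0..1}" using t h_in[OF xX] by auto
  have "0 < t"
    using t r_0[OF xX] r_0[OF yX] by (cases "t = 0") auto
  let ?K = "{z \<in> X. h z = t}" and ?z = "r x t"
  have zK: "?z \<in> ?K" using r_in[OF xX t01] h_r'[OF xX t(1,2)] by simp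
  \<comment> \<open>\<open>V\<close> has to avoid \<open>A\<close>, so that the two closed pieces
    below are disjoint, and \<open>r y t\<close>, so that \<open>y\<close> falls into the second
    piece.\<close>
  obtain V where V: "V \<subseteq> ?K" "compact V" "compact (?K - V)" "?z \<in> V" "V \<inter> (A \<union> {r y t}) = {}"
  proof (rule clopen_separation[OF compact_level[of t], of ?z "A \<union> {r y t}"])
    show "z = z'" if "Z \<subseteq> ?K" "connected Z" "z \<in> Z" "z' \<in> Z" for Z z z'
      using levels[of Z t z z'] that \<open>0 < t\<close> by blast
    show "closed (A \<union> {r y t})" using A(1) by (intro closed_Un compact_imp_closed) auto
  qed (use zK nin t in auto)
  have cl: "closed {w \<in> A. t \<le> h w \<and> r w t \<in> W}" if "compact W" for W
  proof -
    have 1: "closed {w \<in> A. t \<le> h w}"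
      using continuous_closed_preimage[OF continuous_on_subset[OF cont_h A(3)] compact_imp_closed[OF A(1)], of "{t..}"]
      by (simp add: vimage_def Int_def)
    have 2: "continuous_on {w \<in> A. t \<le> h w} (\<lambda>w. r w t)"
      using cont_r_fst[OF t01] A(3) by (auto intro: continuous_on_subset)
    show ?thesis
      using continuous_closed_preimage[OF 2 1 compact_imp_closed[OF that]]
      by (simp add: vimage_def Int_def conj_assoc)
  qed
  let ?A1 = "{w \<in> A. t \<le> h w \<and> r w t \<in> V}"
  let ?A2 = "{w \<in> A. t \<le> h w \<and> r w t \<in> ?K - V} \<union> {w \<in> A. h w \<le> t}"
  have c1: "closed ?A1" by (rule cl[OF V(2)])
  have "closed {w \<in> A. h w \<le> t}"
    using continuous_closed_preimage[OF continuous_on_subset[OF cont_h A(3)] compact_imp_closed[OF A(1)], of "{..t}"]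
    by (simp add: vimage_def Int_def)
  then have c2: "closed ?A2" by (intro closed_Un cl[OF V(3)])
  have "?A1 \<inter> ?A2 \<inter> A = {}"
  proof -
    have False if w: "w \<in> A" "t \<le> h w" "r w t \<in> V" "h w \<le> t" for w
    proof -
      have "t = h w" using w by simp
      then have "r w t = w" using r_h[of w] A(3) w(1) by auto
      then show False using V(5) w by auto
    qed
    then show ?thesis by blast
  qed
  moreover have "A \<subseteq> ?A1 \<union> ?A2"
  proof
    fix w assume w: "w \<in> A"
    then have "w \<in> X" using A(3) by blast
    then have "r w t \<in> ?K" if "t \<le> h w" using that r_in[OF _ t01] h_r'[OF _ t(1)] by simp
    then show "w \<in> ?A1 \<union> ?A2" using w by fastforce
  qed
  moreover have "x \<in> ?A1" using x t V(4) by simp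
  moreover have "y \<in> ?A2"
  proof (cases "t \<le> h y")
    case True
    then have "r y t \<in> ?K" using r_in[OF yX t01] h_r'[OF yX t(1)] by simp
    then show ?thesis using y True V(5) by auto
  qed (use y in auto)
  ultimately show False
    using A(2) c1 c2 x y unfolding connected_closed by (smt (verit) Int_iff empty_iff)
qed

text \<open>For distinct \<open>x\<close> and \<open>y\<close> with meet height \<open>m\<close>,
  this is the arc between them, bending at \<open>r x m\<close>.\<close>

definition span :: "'a \<Rightarrow> 'a \<Rightarrow> real \<Rightarrow> 'a set" where
  "span x y m = r x ` {m..h x} \<union> r y ` {m..h y}"

text \<open>Above the meet height the two legs differ, so \<open>connected_contains_segment\<close>
  applies; the point at height \<open>m\<close> is a limit of the others, and \<open>A\<close> is
  closed.\<close>

lemma span_subset: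
  assumes A: "compact A" "connected A" "A \<subseteq> X" and x: "x \<in> A" and y: "y \<in> A"
    and m: "0 \<le> m" "m \<le> h x" "m \<le> h y"
      "\<And>t. 0 \<le> t \<Longrightarrow> t \<le> h x \<Longrightarrow> t \<le> h y \<Longrightarrow> r x t = r y t \<Longrightarrow> t \<le> m"
  shows "r x ` {m..h x} \<subseteq> A"
proof -
  have xX: "x \<in> X" and yX: "y \<in> X" using A x y by auto
  have *: "r x t \<in> A" if t: "m < t" "t \<le> h x" for t
  proof (cases "r x t = r y t")
    case True
    \<comment> \<open>Beyond height \<open>h y\<close> the point \<open>r y t\<close> is
      \<open>y\<close> itself, too low to equal \<open>r x t\<close>. So the agreement lies in the
      common range and contradicts the choice of \<open>m\<close>.\<close>
    then have "h (r y t) = t" using h_r'[OF xX, of t] t m by auto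
    then have "t \<le> h y" using h_r[OF yX, of t] t m h_in[OF xX] by auto
    then have "t \<le> m" using m(1) t True by (intro m(4)) auto
    then show ?thesis using t by simp
  next
    case False
    then show ?thesis using connected_contains_segment[OF A x y] t m by auto
  qed
  have "r x m \<in> A"
  proof (cases "m < h x")
    case True
    have "{m..h x} \<subseteq> {0..1}" using m h_in[OF xX] by auto
    then have "continuous_on (closure {m<..h x}) (r x)"
      using cont_r_snd[OF xX] True by (auto intro: continuous_on_subset)
    then have "r x ` closure {m<..h x} \<subseteq> A"
      using * by (intro image_closure_subset compact_imp_closed A) auto
    then show ?thesis using True by auto
  next
    case False
    then show ?thesis using m r_h[OF xX] x by simp
  qed
  with * show ?thesis by force
qed

lemma span_least:
  assumes "compact A" "connected A" "A \<subseteq> X" "x \<in> A" "y \<in> A"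
    and "0 \<le> m" "m \<le> h x" "m \<le> h y"
      "\<And>t. 0 \<le> t \<Longrightarrow> t \<le> h x \<Longrightarrow> t \<le> h y \<Longrightarrow> r x t = r y t \<Longrightarrow> t \<le> m"
  shows "span x y m \<subseteq> A"
  unfolding span_def
  using span_subset[of A x y m] span_subset[of A y x m] assms by (metis Un_subset_iff)

lemma span_props:
  assumes "x \<in> X" "y \<in> X" "0 \<le> m" "m \<le> h x" "m \<le> h y" "r x m = r y m"
  shows "connected (span x y m)" "compact (span x y m)" "span x y m \<subseteq> X"
    "x \<in> span x y m" "y \<in> span x y m"
proof -
  note s = segment_compact_connected[OF assms(1,3,4)] segment_compact_connected[OF assms(2,3,5)]
  show "connected (span x y m)"
    unfolding span_def using s assms(6) by (intro connected_Un) auto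
  show "compact (span x y m)" "span x y m \<subseteq> X" "x \<in> span x y m" "y \<in> span x y m"
    unfolding span_def using s by auto
qed

lemma continuum_X: "continuum X"
proof -
  have "connected X"
  proof (rule connectedI_const)
    fix P assume P: "continuous_on X (P :: 'a \<Rightarrow> bool)"
    have "P x = P v" if x: "x \<in> X" for x
    proof -
      have "continuous_on (r x ` {0..h x}) P"
        using P segment_compact_connected(3)[OF x, of 0] h_nonneg[OF x] continuous_on_subset by auto
      moreover have "connected (r x ` {0..h x})" "x \<in> r x ` {0..h x}" "v \<in> r x ` {0..h x}"
        using segment_compact_connected[OF x, of 0] h_nonneg[OF x] r_0[OF x] by auto
      ultimately show ?thesis
        using connectedD_const by metis
    qed
    then show "\<exists>c. \<forall>s\<in>X. P s = c" by blast
  qed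
  then show ?thesis using compact_X v_in unfolding continuum_def by blast
qed

text \<open>Every subcontinuum that contains \<open>x\<close> and \<open>y\<close> contains their
  span, so the span survives in the intersection and joins them there.\<close>

lemma hereditarily_unicoherent_X: "hereditarily_unicoherent X"
  unfolding hereditarily_unicoherent_def
proof (intro conjI allI impI continuum_X)
  fix A B assume AB: "subcontinuum A X \<and> subcontinuum B X"
  show "connected (A \<inter> B)"
    unfolding connected_iff_connected_component
  proof (intro ballI)
    fix x y assume xy: "x \<in> A \<inter> B" "y \<in> A \<inter> B"
    then have X: "x \<in> X" "y \<in> X" using AB unfolding subcontinuum_def by auto
    obtain m where m: "0 \<le> m" "m \<le> h x" "m \<le> h y" "r x m = r y m"
      "\<And>t. 0 \<le> t \<Longrightarrow> t \<le> h x \<Longrightarrow> t \<le> h y \<Longrightarrow> r x t = r y t \<Longrightarrow> t \<le> m"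
      by (rule meet[OF X], rule that)
    have "span x y m \<subseteq> A" "span x y m \<subseteq> B"
      by (intro span_least; use AB xy m in \<open>auto simp: subcontinuum_def continuum_def\<close>)+
    then show "connected_component (A \<inter> B) x y"
      unfolding connected_component_def using span_props[OF X m(1-4)] by blast
  qed
qed

lemma arcwise_connected_X: "arcwise_connected X"
  unfolding arcwise_connected_def
proof (intro ballI impI)
  fix x y assume X: "x \<in> X" "y \<in> X" and "x \<noteq> y"
  obtain m where m: "0 \<le> m" "m \<le> h x" "m \<le> h y" "r x m = r y m"
      "\<And>t. 0 \<le> t \<Longrightarrow> t \<le> h x \<Longrightarrow> t \<le> h y \<Longrightarrow> r x t = r y t \<Longrightarrow> t \<le> m"
    by (rule meet[OF X], rule that)
  note ax = arc_segment[OF X(1) m(1)] and ay = arc_segment[OF X(2) m(1)]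
  consider "m = h x" | "m = h y" | "m < h x" "m < h y" using m by linarith
  then show "\<exists>A\<subseteq>X. arc_from_to A x y"
  proof cases
    case 1
    then have "r y m = x" using m r_h X by simp
    moreover have "m < h y" using 1 m \<open>x \<noteq> y\<close> r_h X by (metis order_le_less)
    ultimately show ?thesis using ay by auto
  next
    case 2
    then have "r x m = y" using m r_h X by simp
    moreover have "m < h x" using 2 m \<open>x \<noteq> y\<close> r_h X by (metis order_le_less)
    ultimately show ?thesis using ax arc_from_to_sym by blast
  next
    case 3
    have "r x ` {m..h x} \<inter> r y ` {m..h y} \<subseteq> {r x m}"
    proof
      fix z assume "z \<in> r x ` {m..h x} \<inter> r y ` {m..h y}"
      then obtain s t where st: "z = r x s" "z = r y t" "s \<in> {m..h x}" "t \<in> {m..h y}" by blast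
      then have "h z = s" "h z = t" using h_r'[OF X(1), of s] h_r'[OF X(2), of t] m by auto
      then have "s = t" by simp
      then have "s \<le> m" using m(1) st by (intro m(5)) auto
      then have "s = m" using st by simp
      then show "z \<in> {r x m}" using st by simp
    qed
    then have "arc_from_to (r x ` {m..h x} \<union> r y ` {m..h y}) x y"
      using arc_from_to_join[OF arc_from_to_sym[OF ax(1)[OF 3(1)]] , of _ y] ay(1)[OF 3(2)] m(4) by simp
    then show ?thesis using ax(2)[OF 3(1)] ay(2)[OF 3(2)] by (metis Un_subset_iff)
  qed
qed

lemma dendroid_X: "dendroid X"
  unfolding dendroid_def
  using continuum_X hereditarily_unicoherent_X arcwise_connected_X by blast

lemma the_arc_root:
  assumes "x \<in> X"
  shows "the_arc X x v = r x ` {0..1}"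
proof -
  have im: "r x ` {0..1} = r x ` {0..h x}"
  proof
    show "r x ` {0..1} \<subseteq> r x ` {0..h x}"
    proof
      fix z assume "z \<in> r x ` {0..1}"
      then obtain t where t: "z = r x t" "t \<in> {0..1}" by blast
      then show "z \<in> r x ` {0..h x}"
        using r_ge[OF assms, of t] r_h[OF assms] h_in[OF assms]
        by (cases "h x \<le> t") (force intro: image_eqI[of _ _ "h x"])+
    qed
    show "r x ` {0..h x} \<subseteq> r x ` {0..1}" using h_in[OF assms] by auto
  qed
  show ?thesis
  proof (cases "x = v")
    case True
    then show ?thesis using im h_v r_0[OF assms] by (simp add: the_arc_def)
  next
    case False
    then have "arc_from_to (r x ` {0..h x}) x v" "r x ` {0..h x} \<subseteq> X"
      using arc_segment[OF assms, of 0] h_pos[OF assms] r_0[OF assms] arc_from_to_sym by auto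
    moreover have "the_arc X x v \<subseteq> X \<and> arc_from_to (the_arc X x v) x v"
      using the_arc_props[OF dendroid_X assms v_in False] .
    ultimately show ?thesis using dendroid_arc_unique[OF dendroid_X] im by metis
  qed
qed

text \<open>\<open>r\<close> parametrises the arcs to the root by height. Its uniform continuity
  makes the arcs of nearby points close at equal heights, hence close in the Hausdorff
  distance.\<close>

lemma smooth_X: "smooth_dendroid X"
  unfolding smooth_dendroid_def
proof (intro conjI dendroid_X bexI[OF _ v_in] allI ballI impI)
  fix s x assume x: "x \<in> X" and s: "(\<forall>n::nat. s n \<in> X) \<and> s \<longlonglongrightarrow> x"
  have "compact (X \<times> {0..1::real})" using compact_X by (intro compact_Times) auto
  then have uc: "uniformly_continuous_on (X \<times> {0..1}) (\<lambda>p. r (fst p) (snd p))"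
    using compact_uniformly_continuous[OF cont_r] by blast
  have cp: "compact (r y ` {0..1})" if "y \<in> X" for y
    using cont_r_snd[OF that] by (intro compact_continuous_image) auto
  show "(\<lambda>n. hausdorff_dist (the_arc X (s n) v) (the_arc X x v)) \<longlonglongrightarrow> 0"
  proof (rule LIMSEQ_I)
    fix e :: real assume "0 < e"
    then obtain d where d: "d > 0" "\<And>p q. p \<in> X \<times> {0..1} \<Longrightarrow> q \<in> X \<times> {0..1} \<Longrightarrow> dist q p < d \<Longrightarrow>
        dist (r (fst q) (snd q)) (r (fst p) (snd p)) < e/2"
      using uc unfolding uniformly_continuous_on_def by (metis half_gt_zero)
    obtain N where N: "\<And>n. n \<ge> N \<Longrightarrow> dist (s n) x < d"
      using s d(1) unfolding lim_sequentially by blast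
    have "norm (hausdorff_dist (the_arc X (s n) v) (the_arc X x v) - 0) < e" if n: "n \<ge> N" for n
    proof -
      have sn: "s n \<in> X" using s by blast
      have *: "dist (r (s n) t) (r x t) < e/2" if "t \<in> {0..1}" for t
        using d(2)[of "(x,t)" "(s n,t)"] that x sn N[OF n] by (simp add: dist_Pair_Pair)
      have "(SUP a\<in>r (s n) ` {0..1}. infdist a (r x ` {0..1})) \<le> e/2"
      proof (rule cSUP_least)
        fix a assume "a \<in> r (s n) ` {0..1}"
        then obtain t where "a = r (s n) t" "t \<in> {0..1}" by blast
        then show "infdist a (r x ` {0..1}) \<le> e/2"
          using * infdist_le2[of "r x t" "r x ` {0..1}" a] by force
      qed auto
      moreover have "(SUP a\<in>r x ` {0..1}. infdist a (r (s n) ` {0..1})) \<le> e/2"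
      proof (rule cSUP_least)
        fix a assume "a \<in> r x ` {0..1}"
        then obtain t where "a = r x t" "t \<in> {0..1}" by blast
        then show "infdist a (r (s n) ` {0..1}) \<le> e/2"
          using * infdist_le2[of "r (s n) t" "r (s n) ` {0..1}" a] by (force simp: dist_commute)
      qed auto
      ultimately have "hausdorff_dist (r (s n) ` {0..1}) (r x ` {0..1}) \<le> e/2"
        unfolding hausdorff_dist_def by simp
      moreover have "0 \<le> hausdorff_dist (r (s n) ` {0..1}) (r x ` {0..1})"
        by (intro hausdorff_dist_nonneg cp x sn) auto
      ultimately show ?thesis
        using \<open>0 < e\<close> by (simp add: the_arc_root x sn)
    qed
    then show "\<exists>N. \<forall>n\<ge>N. norm (hausdorff_dist (the_arc X (s n) v) (the_arc X x v) - 0) < e" by blast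
  qed
qed

lemma arc_eq_span:
  assumes A: "A \<subseteq> X" "arc_from_to A x y"
    and m: "0 \<le> m" "m \<le> h x" "m \<le> h y" "r x m = r y m"
      "\<And>t. 0 \<le> t \<Longrightarrow> t \<le> h x \<Longrightarrow> t \<le> h y \<Longrightarrow> r x t = r y t \<Longrightarrow> t \<le> m"
  shows "A = span x y m"
proof -
  have X: "x \<in> X" "y \<in> X" using A arc_from_to_ends by blast+
  have "span x y m \<subseteq> A"
    using A X m arc_from_to_cont[OF A(2)] by (intro span_least) auto
  then show ?thesis
    using connected_subset_arc_eq[OF A(2)] span_props[OF X m(1-4)] by metis
qed

text \<open>An endpoint cannot lie inside the arc from the root to a point above it. Conversely
  every arc is a span, and a maximal point of a span is one of its two ends.\<close>

lemma endpoints_eq: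
  assumes "v \<notin> endpoints X"
  shows "endpoints X = {e \<in> X. e \<noteq> v \<and> (\<forall>x\<in>X. r x (h e) = e \<longrightarrow> x = e)}"
proof (intro set_eqI iffI)
  fix e assume e: "e \<in> endpoints X"
  then have eX: "e \<in> X" and ev: "e \<noteq> v" using assms unfolding endpoints_def by auto
  have "x = e" if x: "x \<in> X" "r x (h e) = e" for x
  proof (rule ccontr)
    assume "x \<noteq> e"
    have "h e = min (h e) (h x)" using h_r[OF x(1) h_in[OF eX]] x(2) by simp
    then have hx: "h e \<le> h x" by simp
    have pos: "0 < h e" using h_pos eX ev by blast
    then have "arc_from_to (r x ` {0..h x}) (r x 0) x" "r x ` {0..h x} \<subseteq> X"
      using arc_segment[OF x(1), of 0] hx by auto
    moreover have "e \<in> r x ` {0..h x}" using x hx pos by (intro image_eqI[of _ _ "h e"]) auto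
    ultimately have "e = r x 0 \<or> e = x"
      using e unfolding endpoints_def by simp
    then show False using \<open>x \<noteq> e\<close> ev r_0[OF x(1)] by auto
  qed
  then show "e \<in> {e \<in> X. e \<noteq> v \<and> (\<forall>x\<in>X. r x (h e) = e \<longrightarrow> x = e)}" using eX ev by blast
next
  fix e assume "e \<in> {e \<in> X. e \<noteq> v \<and> (\<forall>x\<in>X. r x (h e) = e \<longrightarrow> x = e)}"
  then have e: "e \<in> X" "e \<noteq> v" "\<And>x. x \<in> X \<Longrightarrow> r x (h e) = e \<Longrightarrow> x = e" by auto
  have "e = x \<or> e = y" if A: "A \<subseteq> X" "arc_from_to A x y" "e \<in> A" for A x y
  proof -
    have X: "x \<in> X" "y \<in> X" using A arc_from_to_ends by blast+
    obtain m where m: "0 \<le> m" "m \<le> h x" "m \<le> h y" "r x m = r y m"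
      "\<And>t. 0 \<le> t \<Longrightarrow> t \<le> h x \<Longrightarrow> t \<le> h y \<Longrightarrow> r x t = r y t \<Longrightarrow> t \<le> m"
      by (rule meet[OF X], rule that)
    have "A = span x y m" by (rule arc_eq_span[OF A(1,2) m(1-4)], rule m(5))
    then have "e \<in> span x y m" using A(3) by blast
    then have "\<exists>z t. (z = x \<or> z = y) \<and> e = r z t \<and> t \<in> {m..h z}"
      unfolding span_def by blast
    then obtain z t where z: "z = x \<or> z = y" "e = r z t" "t \<in> {m..h z}" by blast
    then have "h e = t" "z \<in> X" using h_r'[of z t] X m(1) by auto
    then show ?thesis using e(3)[of z] z by auto
  qed
  then show "e \<in> endpoints X" using e(1) unfolding endpoints_def by blast
qed

text \<open>The legs of \<open>x\<close> and \<open>y\<close> part at height 0, so the arc between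
  these points passes through \<open>v\<close>, which is neither of its ends.\<close>

lemma root_not_endpoint:
  assumes X: "x \<in> X" "y \<in> X" and ne: "x \<noteq> v" "y \<noteq> v" "\<And>t. 0 < t \<Longrightarrow> t \<le> h x \<Longrightarrow> t \<le> h y \<Longrightarrow> r x t \<noteq> r y t"
  shows "v \<notin> endpoints X"
proof
  assume v: "v \<in> endpoints X"
  have "x \<noteq> y" using ne(3)[of "h x"] h_pos[OF X(1) ne(1)] by auto
  then obtain A where A: "A \<subseteq> X" "arc_from_to A x y"
    using arcwise_connected_X X unfolding arcwise_connected_def by blast
  have "A = span x y 0"
  proof (intro arc_eq_span[OF A])
    show "t \<le> 0" if "0 \<le> t" "t \<le> h x" "t \<le> h y" "r x t = r y t" for t
      using ne(3)[of t] that by force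
  qed (use X h_nonneg r_0 in auto)
  then have "v \<in> A" unfolding span_def using h_nonneg[OF X(1)] r_0[OF X(1)]
    by (auto intro: image_eqI[of _ _ 0])
  then have "v = x \<or> v = y" using v A unfolding endpoints_def by simp
  then show False using ne by auto
qed

end

section \<open>Countably many cuts and the Suslinian property\<close>

locale radial_countable = radial +
  assumes countable_cuts: "\<And>a b. 0 < a \<Longrightarrow> a < b \<Longrightarrow> countable ((\<lambda>x. r x a) ` {x \<in> X. b \<le> h x})"
begin

text \<open>
  The projection to height \<open>a < t\<close> of a connected subset of \<open>{h = t}\<close> is connected and countable,
  hence a single point; let \<open>a\<close> tend to \<open>t\<close>.
\<close>

sublocale radial_dendroid
proof
  fix Z t z z'
  assume Z: "Z \<subseteq> X" "connected Z" "0 < t" "\<And>z. z \<in> Z \<Longrightarrow> h z = t" "z \<in> Z" "z' \<in> Z"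
  have zX: "z \<in> X" "z' \<in> X" using Z by auto
  have t1: "t \<le> 1" using Z(4)[OF Z(5)] h_le_1[OF zX(1)] by simp
  have eq: "r z a = r z' a" if a: "0 < a" "a < t" for a
  proof -
    have "continuous_on Z (\<lambda>x. r x a)"
      using cont_r_fst[of a] a t1 Z(1) by (auto intro: continuous_on_subset)
    then have "connected ((\<lambda>x. r x a) ` Z)" using Z(2) connected_continuous_image by blast
    moreover have "countable ((\<lambda>x. r x a) ` Z)"
      by (rule countable_subset[OF _ countable_cuts[OF a]]) (use Z in force)
    ultimately have "\<not> (\<exists>u w. u \<in> (\<lambda>x. r x a) ` Z \<and> w \<in> (\<lambda>x. r x a) ` Z \<and> u \<noteq> w)"
      using connected_uncountable by metis
    then show ?thesis using Z by blast
  qed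
  have c: "continuous_on (closure {0<..<t}) (r z)" "continuous_on (closure {0<..<t}) (r z')"
    using t1 Z(3) by (auto intro: continuous_on_subset[OF cont_r_snd[OF zX(1)]] continuous_on_subset[OF cont_r_snd[OF zX(2)]])
  have "r z t = r z' t"
    using continuous_constant_on_closure[of "{0<..<t}" "\<lambda>a. dist (r z a) (r z' a)" 0 t] Z(3) eq c
    by (auto intro!: continuous_intros)
  then show "z = z'" using r_h zX Z by metis
qed

text \<open>A nondegenerate subcontinuum contains a segment of some leg, hence a cut at rational
  heights \<open>a < b\<close>. There are only countably many such cuts, and disjoint subcontinua
  use different ones.\<close>

lemma suslinian_X: "suslinian X"
  unfolding suslinian_def
proof (intro conjI continuum_X notI)
  assume "\<exists>\<C>. uncountable \<C> \<and> pairwise disjnt \<C> \<and> (\<forall>A\<in>\<C>. subcontinuum A X \<and> nondegenerate A)"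
  then obtain \<C> where C: "uncountable \<C>" "pairwise disjnt \<C>"
    "\<And>A. A \<in> \<C> \<Longrightarrow> subcontinuum A X" "\<And>A. A \<in> \<C> \<Longrightarrow> nondegenerate A" by blast
  let ?B = "{(a,b) \<in> \<rat> \<times> \<rat>. 0 < a \<and> a < (b::real)}"
  define S where "S = (\<Union>(a,b)\<in>?B. (\<lambda>x. r x a) ` {x \<in> X. b \<le> h x})"
  have "countable ?B"
    by (rule countable_subset[of _ "\<rat> \<times> \<rat>"]) (auto simp: countable_rat)
  then have "countable S"
    unfolding S_def by (intro countable_UN) (auto intro: countable_cuts)
  have "\<exists>z\<in>A. z \<in> S" if A: "A \<in> \<C>" for A
  proof -
    have sA: "compact A" "connected A" "A \<subseteq> X"
      using C(3)[OF A] unfolding subcontinuum_def continuum_def by auto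
    obtain x' y' where xy': "x' \<in> A" "y' \<in> A" "x' \<noteq> y'"
      using C(4)[OF A] unfolding nondegenerate_def by blast
    have "\<exists>x\<in>A. \<exists>y\<in>A. \<exists>m. 0 \<le> m \<and> m < h x \<and> m \<le> h y \<and>
        (\<forall>t. 0 \<le> t \<longrightarrow> t \<le> h x \<longrightarrow> t \<le> h y \<longrightarrow> r x t = r y t \<longrightarrow> t \<le> m)"
    proof -
      have X: "x' \<in> X" "y' \<in> X" using xy' sA by auto
      obtain m where m: "0 \<le> m" "m \<le> h x'" "m \<le> h y'" "r x' m = r y' m"
        "\<And>t. 0 \<le> t \<Longrightarrow> t \<le> h x' \<Longrightarrow> t \<le> h y' \<Longrightarrow> r x' t = r y' t \<Longrightarrow> t \<le> m"
        by (rule meet[OF X], rule that)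
      have "m < h x' \<or> m < h y'"
        using m(2-4) xy'(3) r_h X by (metis order_le_less)
      then show ?thesis
      proof
        assume "m < h x'"
        then show ?thesis using m xy' by blast
      next
        assume "m < h y'"
        then have "\<forall>t. 0 \<le> t \<longrightarrow> t \<le> h y' \<longrightarrow> t \<le> h x' \<longrightarrow> r y' t = r x' t \<longrightarrow> t \<le> m"
          using m(5) by metis
        then show ?thesis using m xy' \<open>m < h y'\<close> by blast
      qed
    qed
    then obtain x y m where xy: "x \<in> A" "y \<in> A" "0 \<le> m" "m < h x" "m \<le> h y"
        "\<And>t. 0 \<le> t \<Longrightarrow> t \<le> h x \<Longrightarrow> t \<le> h y \<Longrightarrow> r x t = r y t \<Longrightarrow> t \<le> m" by blast
    have seg: "r x ` {m..h x} \<subseteq> A"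
      using xy sA by (intro span_subset[of A x y m]) auto
    \<comment> \<open>Rationals \<open>m < a < b < h x\<close>: the point of height \<open>a\<close>
      lies on the segment in \<open>A\<close> and, because \<open>x\<close> is higher than
      \<open>b\<close>, among the cuts for the pair \<open>(a, b)\<close>.\<close>
    obtain b where b: "b \<in> \<rat>" "m < b" "b < h x" using Rats_dense_in_real[OF xy(4)] by blast
    obtain a where a: "a \<in> \<rat>" "m < a" "a < b" using Rats_dense_in_real[OF b(2)] by blast
    have "r x a \<in> (\<lambda>x. r x a) ` {x \<in> X. b \<le> h x}" using xy b sA by auto
    moreover have "(a, b) \<in> ?B" using a b xy by auto
    ultimately have "r x a \<in> S" unfolding S_def by blast
    moreover have "r x a \<in> A" using seg a b by auto
    ultimately show ?thesis by blast
  qed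
  then have "\<forall>A\<in>\<C>. \<exists>z. z \<in> A \<and> z \<in> S" by blast
  then obtain f where f: "\<forall>A\<in>\<C>. f A \<in> A \<and> f A \<in> S" using bchoice[of \<C> "\<lambda>A z. z \<in> A \<and> z \<in> S"] by blast
  have "inj_on f \<C>"
    using f C(2) by (intro inj_onI) (metis disjnt_iff pairwiseD)
  moreover have "countable (f ` \<C>)"
    using f by (intro countable_subset[OF _ \<open>countable S\<close>]) blast
  ultimately show False using C(1) countable_image_inj_on by blast
qed

end

section \<open>Quotients of a radial structure\<close>

locale radial_quotient = radial X h r v
  for X :: "'a::metric_space set" and h r v +
  fixes E :: "'a \<Rightarrow> 'a \<Rightarrow> bool" and F :: "'a \<Rightarrow> 'b::metric_space"
  assumes cont_F: "continuous_on X F"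
    and F_eq: "x \<in> X \<Longrightarrow> y \<in> X \<Longrightarrow> F x = F y \<longleftrightarrow> E x y"
    and E_h: "x \<in> X \<Longrightarrow> y \<in> X \<Longrightarrow> E x y \<Longrightarrow> h x = h y"
    and E_r: "x \<in> X \<Longrightarrow> y \<in> X \<Longrightarrow> t \<in> {0..1} \<Longrightarrow> E x y \<Longrightarrow> E (r x t) (r y t)"
begin

text \<open>Any preimage serves: \<open>E_h\<close> and \<open>E_r\<close> make the values
  independent of the choice.\<close>

definition "Fh z = h (inv_into X F z)"
definition "Fr z t = F (r (inv_into X F z) t)"

lemma Fh: "x \<in> X \<Longrightarrow> Fh (F x) = h x"
  unfolding Fh_def using E_h F_eq inv_into_into[of "F x" F X] f_inv_into_f[of "F x" F X] by auto

lemma Fr: "x \<in> X \<Longrightarrow> t \<in> {0..1} \<Longrightarrow> Fr (F x) t = F (r x t)"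
  unfolding Fr_def using E_r F_eq r_in inv_into_into[of "F x" F X] f_inv_into_f[of "F x" F X] by auto

lemma radial_image: "radial (F ` X) Fh Fr (F v)"
proof
  show "compact (F ` X)" using compact_X cont_F compact_continuous_image by blast
  show "F v \<in> F ` X" using v_in by blast
  show "continuous_on (F ` X) Fh"
    by (rule continuous_on_factor[OF compact_X cont_F])
       (use continuous_on_eq[OF cont_h] Fh in force)
  show "continuous_on (F ` X \<times> {0..1}) (\<lambda>p. Fr (fst p) (snd p))"
  proof -
    \<comment> \<open>Joint continuity descends along the product of \<open>F\<close> with the
      identity. A product of quotient maps need not be a quotient map in general; here compactness
      of \<open>X\<close> times the interval gives it.\<close>
    let ?G = "\<lambda>p. (F (fst p), snd p :: real)"
    have "?G ` (X \<times> {0..1}) = F ` X \<times> {0..1}" by force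
    moreover have "continuous_on (?G ` (X \<times> {0..1})) (\<lambda>p. Fr (fst p) (snd p))"
    proof (rule continuous_on_factor)
      show "compact (X \<times> {0..1::real})" using compact_X by (intro compact_Times) auto
      show "continuous_on (X \<times> {0..1}) ?G"
        by (intro continuous_intros continuous_on_compose2[OF cont_F]) auto
      have "continuous_on (X \<times> {0..1}) (\<lambda>p. F (r (fst p) (snd p)))"
        by (rule continuous_on_compose2[OF cont_F cont_r]) (use r_in in auto)
      then show "continuous_on (X \<times> {0..1}) (\<lambda>p. Fr (fst (?G p)) (snd (?G p)))"
        by (rule continuous_on_eq) (auto simp: Fr)
    qed
    ultimately show ?thesis by simp
  qed
qed (auto simp: Fh Fr h_nonneg h_le_1 r_0 r_h r_in h_r r_r h_in[simplified])

end

section \<open>The gluing relation on a fan\<close>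

text \<open>The axiom excludes branching away from the root, so every point other than
  \<open>v\<close> determines one leg.\<close>

locale radial_fan = radial_dendroid +
  assumes fan: "x \<in> X \<Longrightarrow> y \<in> X \<Longrightarrow> 0 < t \<Longrightarrow> t \<le> h x \<Longrightarrow> t \<le> h y \<Longrightarrow> r x t = r y t \<Longrightarrow>
    0 \<le> s \<Longrightarrow> s \<le> h x \<Longrightarrow> s \<le> h y \<Longrightarrow> r x s = r y s"
begin

text \<open>For \<open>x\<close> other than the root this is the endpoint of the leg through
  \<open>x\<close>. For the root it is some point of greatest height in the whole space.\<close>

definition apex where
  "apex x = (SOME e. e \<in> X \<and> r e (h x) = x \<and> (\<forall>y\<in>X. r y (h x) = x \<longrightarrow> h y \<le> h e))"

lemma apex:
  assumes x: "x \<in> X"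
  shows "apex x \<in> X" "r (apex x) (h x) = x" "\<And>y. y \<in> X \<Longrightarrow> r y (h x) = x \<Longrightarrow> h y \<le> h (apex x)"
proof -
  let ?S = "{y \<in> X. r y (h x) = x}"
  have "closed ?S"
    using continuous_closed_preimage_constant[OF cont_r_fst[OF h_in[OF x]] compact_imp_closed[OF compact_X]] by simp
  then have "compact ?S" by (rule compact_closed_subset[OF compact_X]) blast
  moreover have "?S \<noteq> {}" using x r_h by auto
  moreover have "continuous_on ?S h" using cont_h by (rule continuous_on_subset) auto
  ultimately have "\<exists>e\<in>?S. \<forall>y\<in>?S. h y \<le> h e" by (rule continuous_attains_sup)
  then have "\<exists>e. e \<in> X \<and> r e (h x) = x \<and> (\<forall>y\<in>X. r y (h x) = x \<longrightarrow> h y \<le> h e)" by auto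
  from someI_ex[OF this] have *: "apex x \<in> X \<and> r (apex x) (h x) = x \<and> (\<forall>y\<in>X. r y (h x) = x \<longrightarrow> h y \<le> h (apex x))"
    unfolding apex_def .
  then show "apex x \<in> X" "r (apex x) (h x) = x" "\<And>y. y \<in> X \<Longrightarrow> r y (h x) = x \<Longrightarrow> h y \<le> h (apex x)" by auto
qed

lemma h_apex: "x \<in> X \<Longrightarrow> h x \<le> h (apex x)"
  using apex(3)[of x x] r_h by simp

text \<open>If \<open>y\<close> is not lower than \<open>x\<close>, it competes in the maximum that
  defines \<open>apex x\<close>; otherwise it lies on the arc from the root to \<open>x\<close>. The
  fan axiom carries the agreement from height \<open>t\<close> to the heights of \<open>x\<close>
  and \<open>y\<close>.\<close>

lemma below_apex:
  assumes x: "x \<in> X" and y: "y \<in> X" and t: "0 < t" "t \<le> h x" "t \<le> h y" "r y t = r x t"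
  shows "h y \<le> h (apex x)" "r (apex x) (h y) = y"
proof -
  have "h y \<le> h (apex x) \<and> r (apex x) (h y) = y"
  proof (cases "h x \<le> h y")
    case True
    then have "r y (h x) = x"
      using fan[OF y x, of t "h x"] t r_h[OF x] h_nonneg[OF x] by simp
    then have le: "h y \<le> h (apex x)" using apex(3)[OF x y] by blast
    have "r (apex x) (h y) = r y (h y)"
      using fan[OF apex(1)[OF x] y, of "h x" "h y"] True le t \<open>r y (h x) = x\<close> apex(2)[OF x] h_nonneg[OF y] by simp
    then show ?thesis using le r_h[OF y] by simp
  next
    case False
    then have "r x (h y) = y"
      using fan[OF x y, of t "h y"] t r_h[OF y] h_nonneg[OF y] by simp
    moreover have "r x (h y) = r (apex x) (h y)"
      using r_r[OF apex(1)[OF x] h_in[OF x] h_in[OF y]] apex(2)[OF x] False by simp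
    ultimately show ?thesis using h_apex[OF x] False by simp
  qed
  then show "h y \<le> h (apex x)" "r (apex x) (h y) = y" by auto
qed

lemma r_apex: "x \<in> X \<Longrightarrow> 0 \<le> s \<Longrightarrow> s \<le> h x \<Longrightarrow> r (apex x) s = r x s"
  using r_r[OF apex(1)[of x] h_in[of x], of s] apex(2)[of x] h_in[of x] by simp

lemma apex_eq:
  assumes x: "x \<in> X" and y: "y \<in> X" and t: "0 < t" "t \<le> h x" "t \<le> h y" "r y t = r x t"
  shows "apex y = apex x"
proof -
  have *: "h (apex y) \<le> h (apex x) \<and> r (apex x) (h (apex y)) = apex y"
    if x: "x \<in> X" and y: "y \<in> X" and t: "0 < t" "t \<le> h x" "t \<le> h y" "r y t = r x t" for x y
    using below_apex[OF x apex(1)[OF y] t(1,2)] h_apex[OF y] t r_apex[OF y, of t] by auto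
  have "h (apex x) = h (apex y)" using *[OF x y t] *[OF y x t(1,3,2)] t(4) by auto
  then show ?thesis using *[OF x y t] r_h[OF apex(1)[OF x]] by metis
qed

lemma apex_maximal:
  assumes x: "x \<in> X" "x \<noteq> v" and y: "y \<in> X" "r y (h (apex x)) = apex x"
  shows "y = apex x"
proof -
  have hx: "0 < h x" "h x \<le> h (apex x)" using h_pos x h_apex by auto
  have hy: "h (apex x) \<le> h y"
    using h_r[OF y(1) h_in[OF apex(1)[OF x(1)]]] y(2) by simp
  have "r y (h x) = r (r y (h (apex x))) (h x)"
    using r_r[OF y(1) h_in[OF apex(1)[OF x(1)]] h_in[OF x(1)]] hx by simp
  then have "r y (h x) = x" using y apex(2) x by simp
  then have "h y \<le> h (apex x)" using apex(3) x y by blast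
  then have "h y = h (apex x)" using hy by simp
  then show ?thesis using y r_h by metis
qed

lemma apex_apex: "x \<in> X \<Longrightarrow> x \<noteq> v \<Longrightarrow> apex (apex x) = apex x"
  by (rule apex_eq[of x "apex x" "h x"]) (use apex r_h h_pos h_apex in auto)

section \<open>Geometric grids, partitions of levels, signatures and thresholds\<close>

definition q :: "nat \<Rightarrow> real" where "q n = 1 - 1 / (real n + 2)"

text \<open>The ratio tends to 1, so the grids become finer with \<open>n\<close> and the thresholds
  can approach the height of the endpoint. The offset 2 keeps it at least 1/2, so a cut never falls
  below half the height of its endpoint.\<close>

lemma q: "1/2 \<le> q n" "q n < 1" "0 < q n"
  unfolding q_def by (auto simp: field_simps)

definition grid where "grid n x = (LEAST j. q n ^ j \<le> h (apex x))"

lemma grid: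
  assumes x: "x \<in> X" "x \<noteq> v"
  shows "q n ^ grid n x \<le> h (apex x)" "q n * h (apex x) < q n ^ grid n x"
proof -
  have pos: "0 < h (apex x)" using h_pos[OF x] h_apex[OF x(1)] by simp
  then obtain j where "q n ^ j < h (apex x)" using real_arch_pow_inv[OF _ q(2)] by blast
  then show "q n ^ grid n x \<le> h (apex x)" unfolding grid_def by (metis LeastI less_imp_le)
  show "q n * h (apex x) < q n ^ grid n x"
  proof (cases "grid n x")
    case 0
    have "q n * h (apex x) \<le> q n * 1"
      using h_le_1[OF apex(1)[OF x(1)]] q(3)[of n] by (intro mult_left_mono) auto
    then show ?thesis using 0 q(2)[of n] by simp
  next
    case (Suc i)
    then have "\<not> q n ^ i \<le> h (apex x)" using not_less_Least[of i "\<lambda>j. q n ^ j \<le> h (apex x)"] unfolding grid_def by simp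
    then show ?thesis using Suc q(3)[of n] by simp
  qed
qed

lemma grid_eq:
  assumes "q n ^ j \<le> h (apex x)" "q n * h (apex x) < q n ^ j"
  shows "grid n x = j"
  unfolding grid_def
proof (rule Least_equality)
  fix i assume i: "q n ^ i \<le> h (apex x)"
  show "j \<le> i"
  proof (rule ccontr)
    assume "\<not> j \<le> i"
    then have "q n ^ j \<le> q n ^ Suc i" using q[of n] by (intro power_decreasing) auto
    also have "\<dots> \<le> q n * h (apex x)" using i q(3)[of n] by simp
    finally show False using assms(2) by simp
  qed
qed (rule assms)

text \<open>
  Endpoints with height in the grid interval from \<open>q n ^ j\<close> (included) to \<open>q n ^ j / q n\<close> correspond
  to the points of \<open>Level n j - High n j\<close>, which is partitioned by \<open>piece n j\<close>.
\<close>

definition Level where "Level n j = {z \<in> X. h z = q n ^ j}"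
definition High where "High n j = (\<lambda>y. r y (q n ^ j)) ` {y \<in> X. q n ^ j \<le> q n * h y}"

lemma q_pow: "0 < q n ^ j" "q n ^ j \<le> 1" "q n ^ j \<in> {0..1}"
  using q[of n] by (auto intro: power_le_one)

lemma compact_Level: "compact (Level n j)"
  unfolding Level_def by (rule compact_level)

text \<open>Legs that reach a given height form a compact set, which expresses upper semicontinuity
  of the apex height along a level. Removing it leaves a relatively open part of the level for each
  grid interval.\<close>

lemma closed_High: "closed (High n j)"
proof -
  have "closed {y \<in> X. q n ^ j \<le> q n * h y}"
    using continuous_closed_preimage[OF continuous_on_mult_left[OF cont_h, of "q n"] compact_imp_closed[OF compact_X], of "{q n ^ j..}"]
    by (simp add: vimage_def Int_def)
  then have c: "compact {y \<in> X. q n ^ j \<le> q n * h y}"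
    by (rule compact_closed_subset[OF compact_X]) blast
  have "continuous_on {y \<in> X. q n ^ j \<le> q n * h y} (\<lambda>y. r y (q n ^ j))"
    by (rule continuous_on_subset[OF cont_r_fst[OF q_pow(3)]]) blast
  then show ?thesis
    unfolding High_def using c by (intro compact_imp_closed compact_continuous_image)
qed

text \<open>The bound by the distance to \<open>High\<close> is the null-sequence property in the
  form that limits need: along points that approach \<open>High\<close> the pieces shrink to
  diameter 0. The guard reflects that \<open>infdist\<close> to the empty set is 0.\<close>

definition is_partition where "is_partition n j \<iota> \<longleftrightarrow>
    (\<forall>u \<in> Level n j - High n j. \<exists>V. u \<in> V \<and> V \<subseteq> Level n j - High n j \<and> compact V \<and> compact (Level n j - V) \<and>
      (\<forall>w\<in>Level n j - High n j. \<iota> w = \<iota> u \<longleftrightarrow> w \<in> V)) \<and>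
    (\<forall>u \<in> Level n j - High n j. \<forall>w \<in> Level n j - High n j. \<iota> u = \<iota> w \<longrightarrow>
      dist u w < 1 / (real n + 1) \<and> (High n j \<noteq> {} \<longrightarrow> dist u w \<le> infdist u (High n j)))" for \<iota> :: "_ \<Rightarrow> nat"

definition piece where "piece n j = (SOME \<iota>. is_partition n j \<iota>)"

lemma piece: "is_partition n j (piece n j)"
  unfolding piece_def
proof (rule someI_ex[where P = "is_partition n j"])
  have td: "z = z'" if "Z \<subseteq> Level n j" "connected Z" "z \<in> Z" "z' \<in> Z" for Z z z'
    using levels[of Z "q n ^ j" z z'] that q_pow(1)[of n j] unfolding Level_def by blast
  show "\<exists>\<iota>. is_partition n j \<iota>"
  proof (rule null_clopen_partition[where K = "Level n j" and F = "High n j" and \<delta> = "1 / (real n + 1)"])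
    fix \<iota> :: "'a \<Rightarrow> nat"
    assume "\<And>u. u \<in> Level n j - High n j \<Longrightarrow> \<exists>V. u \<in> V \<and> V \<subseteq> Level n j - High n j \<and> compact V \<and>
        compact (Level n j - V) \<and> (\<forall>w\<in>Level n j - High n j. \<iota> w = \<iota> u \<longleftrightarrow> w \<in> V)"
      "\<And>u w. u \<in> Level n j - High n j \<Longrightarrow> w \<in> Level n j - High n j \<Longrightarrow> \<iota> u = \<iota> w \<Longrightarrow>
        dist u w < 1 / (real n + 1) \<and> (High n j \<noteq> {} \<longrightarrow> dist u w \<le> infdist u (High n j))"
    then have "is_partition n j \<iota>" unfolding is_partition_def by blast
    then show "\<exists>\<iota>. is_partition n j \<iota>" by blast
  qed (use compact_Level closed_High td in auto)
qed

text \<open>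
  The functions \<open>cut\<close>, \<open>sig\<close> and \<open>thresh\<close> depend on \<open>x\<close> only through \<open>apex x\<close>, so they are constant on each
  leg; their values at the root \<open>v\<close>, which lies on every leg, are junk.
\<close>

definition cut where "cut n x = r (apex x) (q n ^ grid n x)"
definition sig where "sig n x = (grid n x, piece n (grid n x) (cut n x))"
definition thresh where "thresh n x = q n ^ Suc (grid n x)"

text \<open>If the cut were in \<open>High\<close>, some point above it would be too high. In a fan
  that point is on the same leg and hence no higher than the apex, against the choice of the grid
  index.\<close>

lemma cut:
  assumes "x \<in> X" "x \<noteq> v"
  shows "cut n x \<in> Level n (grid n x) - High n (grid n x)" "cut n x \<in> X" "h (cut n x) = q n ^ grid n x"
proof -
  have tx: "apex x \<in> X" using apex assms by blast
  show X: "cut n x \<in> X" and H: "h (cut n x) = q n ^ grid n x"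
    unfolding cut_def by (rule r_in[OF tx q_pow(3)], rule h_r'[OF tx less_imp_le[OF q_pow(1)] grid(1)[OF assms]])
  have "cut n x \<notin> High n (grid n x)"
  proof
    assume "cut n x \<in> High n (grid n x)"
    then obtain y where y: "y \<in> X" "q n ^ grid n x \<le> q n * h y" "cut n x = r y (q n ^ grid n x)"
      unfolding High_def by blast
    have "q n ^ grid n x \<le> h y" using y(2) q[of n] h_nonneg[OF y(1)] by (smt (verit) mult_left_le_one_le)
    then have "h y \<le> h (apex (apex x))"
      using below_apex(1)[OF tx y(1) q_pow(1), of n "grid n x"] grid(1)[OF assms] y(3) unfolding cut_def by simp
    then have "q n * h y \<le> q n * h (apex x)" using apex_apex assms q(3)[of n] by simp
    then show False using grid(2)[OF assms, of n] y(2) by simp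
  qed
  then show "cut n x \<in> Level n (grid n x) - High n (grid n x)" using X H unfolding Level_def by blast
qed

lemma apex_eq_sig: "apex x = apex y \<Longrightarrow> sig n x = sig n y" "apex x = apex y \<Longrightarrow> thresh n x = thresh n y"
  unfolding sig_def thresh_def cut_def grid_def by simp_all

lemma sig_eq_thresh: "sig n x = sig n y \<Longrightarrow> thresh n x = thresh n y"
  unfolding sig_def thresh_def by simp

text \<open>The threshold is one grid step below the cut and the endpoint less than one step above
  it. So their ratio exceeds \<open>q n * q n\<close>, and their difference is at most
  \<open>2 * (1 - q n)\<close>.\<close>

lemma thresh:
  assumes "x \<in> X" "x \<noteq> v"
  shows "0 < thresh n x" "thresh n x < h (apex x)" "h (apex x) \<le> thresh n x + 2 / (real n + 2)"
proof -
  show "0 < thresh n x" unfolding thresh_def using q(3) by simp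
  have "thresh n x < q n ^ grid n x" unfolding thresh_def using q[of n] by simp
  then show "thresh n x < h (apex x)" using grid(1)[OF assms, of n] by simp
  have tx: "h (apex x) \<in> {0..1}" using h_in apex assms by blast
  have "q n * (q n * h (apex x)) \<le> thresh n x"
    unfolding thresh_def using grid(2)[OF assms, of n] q(3)[of n] by simp
  moreover have "h (apex x) - q n * (q n * h (apex x)) \<le> 2 * (1 - q n)"
  proof -
    have "h (apex x) - q n * (q n * h (apex x)) = h (apex x) * ((1 - q n) * (1 + q n))" by (simp add: algebra_simps)
    also have "\<dots> \<le> 1 * ((1 - q n) * 2)"
    proof (rule mult_mono)
      show "(1 - q n) * (1 + q n) \<le> (1 - q n) * 2" using q(2)[of n] by (intro mult_left_mono) auto
    qed (use tx q(2,3)[of n] in auto)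
    finally show ?thesis by simp
  qed
  ultimately show "h (apex x) \<le> thresh n x + 2 / (real n + 2)" unfolding q_def by simp
qed

section \<open>Cuts and signatures under limits\<close>

lemma cut_height: "x \<in> X \<Longrightarrow> x \<noteq> v \<Longrightarrow> h x / 2 \<le> h (cut n x)"
proof -
  assume x: "x \<in> X" "x \<noteq> v"
  have "h x / 2 \<le> q n * h (apex x)"
    using mult_mono[of "1/2" "q n" "h x" "h (apex x)"] q[of n] h_apex x h_nonneg by simp
  then show ?thesis using grid(2)[OF x, of n] cut(3)[OF x] by simp
qed

lemma r_cut: "x \<in> X \<Longrightarrow> x \<noteq> v \<Longrightarrow> 0 \<le> s \<Longrightarrow> s \<le> h x \<Longrightarrow> s \<le> h (cut n x) \<Longrightarrow> r (cut n x) s = r x s"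
  using r_r[OF apex(1) q_pow(3)[of n "grid n x"], of x s] r_apex[of x s] h_in[of x] cut(3)[of x n]
  unfolding cut_def by simp

text \<open>At height \<open>s\<close> the cut and \<open>x k\<close> eventually lie over the same
  point, and continuity of \<open>r\<close> passes this to the limit. In a fan, agreement at one
  positive height puts \<open>u\<close> on the leg of \<open>a\<close>.\<close>

lemma cut_limits:
  assumes xk: "\<And>k::nat. x k \<in> X" "\<And>k. x k \<noteq> v" and lim: "x \<longlonglongrightarrow> a" and a: "a \<in> X" "0 < s" "2 * s < h a"
    and cutlim: "(\<lambda>k. cut (n k) (x k)) \<longlonglongrightarrow> u" and su: "\<And>k. s \<le> h (cut (n k) (x k))"
  shows "r u s = r a s"
proof -
  have s1: "s \<in> {0..1}" using a h_in[OF a(1)] by auto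
  have l1: "(\<lambda>k. r (cut (n k) (x k)) s) \<longlonglongrightarrow> r u s"
    using r_lim[OF cutlim tendsto_const[of s]] cut(2) xk s1 by blast
  have l2: "(\<lambda>k. r (x k) s) \<longlonglongrightarrow> r a s"
    using r_lim[OF lim tendsto_const[of s]] xk s1 by blast
  have "\<forall>\<^sub>F k in sequentially. s < h (x k)"
    using order_tendstoD(1)[OF h_lim[OF lim xk(1)], of s] a by simp
  then have "\<forall>\<^sub>F k in sequentially. r (cut (n k) (x k)) s = r (x k) s"
    by eventually_elim (use r_cut xk su s1 in auto)
  then have "(\<lambda>k. r (x k) s) \<longlonglongrightarrow> r u s" using l1 by (simp add: tendsto_cong)
  then show ?thesis using l2 LIMSEQ_unique by blast
qed

text \<open>Bounded grid indices let the cuts converge inside one level, to points \<open>u\<close>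
  and \<open>w\<close> on the legs of \<open>a\<close> and \<open>b\<close>. As \<open>u\<close> and
  \<open>w\<close> differ, \<open>u\<close> is off \<open>High\<close>, and the clopen piece around
  \<open>u\<close> captures the cuts of both sequences and the limit \<open>w\<close>.\<close>

lemma sig_limit:
  assumes xk: "\<And>k::nat. x k \<in> X" "\<And>k. x k \<noteq> v" and yk: "\<And>k. y k \<in> X" "\<And>k. y k \<noteq> v"
    and lim: "x \<longlonglongrightarrow> a" "y \<longlonglongrightarrow> b" and ab: "a \<in> X" "b \<in> X" "a \<noteq> b" "h a = h b" "0 < h a"
    and sig: "\<And>k. sig n (x k) = sig n (y k)"
  shows "\<exists>k. sig n (x k) = sig n a \<and> sig n (x k) = sig n b"
proof -
  let ?t = "h a"
  \<comment> \<open>A grid index of at least \<open>M\<close> would put the cut below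
    \<open>?t/4\<close>, but the cut has at least half the height of \<open>x k\<close>, which
    eventually exceeds \<open>?t/2\<close>. So the indices are bounded and one recurs.\<close>
  obtain M where M: "q n ^ M < ?t/4" using real_arch_pow_inv[OF _ q(2)] ab(5) by (metis divide_pos_pos zero_less_numeral)
  obtain N where N: "\<And>k. N \<le> k \<Longrightarrow> ?t/2 < h (x k)"
    using order_tendstoD(1)[OF h_lim[OF lim(1) xk(1)], of "?t/2"] ab(5) unfolding eventually_sequentially by auto
  have "grid n (x k) < M" if "N \<le> k" for k
  proof (rule ccontr)
    assume "\<not> grid n (x k) < M"
    then have "q n ^ grid n (x k) \<le> q n ^ M" using q[of n] by (intro power_decreasing) auto
    then show False using M N[OF that] cut_height[OF xk(1,2), of k n] cut(3)[OF xk(1,2), of n k] by simp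
  qed
  then have "(\<lambda>k. grid n (x k)) ` {N..} \<subseteq> {..<M}" by auto
  then have "finite ((\<lambda>k. grid n (x k)) ` {N..})" using finite_subset by blast
  then obtain k0 where "infinite {k \<in> {N..}. grid n (x k) = grid n (x k0)}"
    using pigeonhole_infinite[of "{N..}" "\<lambda>k. grid n (x k)"] infinite_Ici by blast
  then obtain s :: "nat \<Rightarrow> nat" where s: "strict_mono s" "\<And>k. s k \<in> {k \<in> {N..}. grid n (x k) = grid n (x k0)}"
    using infinite_enumerate by blast
  define J where "J = grid n (x k0)"
  let ?K = "Level n J" and ?F = "High n J"
  have jx: "grid n (x (s k)) = J" for k using s(2) J_def by blast
  have jy: "grid n (y (s k)) = J" for k using sig[of "s k"] jx[of k] unfolding sig_def by simp
  have cx: "cut n (x (s k)) \<in> ?K - ?F" and cy: "cut n (y (s k)) \<in> ?K - ?F" for k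
    using cut(1)[OF xk, of n "s k"] cut(1)[OF yk, of n "s k"] jx jy by auto
  have "compact (?K \<times> ?K)" by (intro compact_Times compact_Level)
  moreover have "(cut n (x (s k)), cut n (y (s k))) \<in> ?K \<times> ?K" for k using cx cy by blast
  ultimately have "\<exists>l s2. l \<in> ?K \<times> ?K \<and> strict_mono s2 \<and> ((\<lambda>k. (cut n (x (s k)), cut n (y (s k)))) \<circ> s2) \<longlonglongrightarrow> l"
    by (rule compact_subseq)
  then obtain l s2 where l: "l \<in> ?K \<times> ?K" "strict_mono s2"
    "((\<lambda>k. (cut n (x (s k)), cut n (y (s k)))) \<circ> s2) \<longlonglongrightarrow> l"
    by blast
  obtain u w where uw: "l = (u, w)" by (cases l)
  define S where "S = s \<circ> s2"
  have "strict_mono S" unfolding S_def using s(1) l(2) strict_mono_o by blast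
  have lu: "(\<lambda>k. cut n (x (S k))) \<longlonglongrightarrow> u"
    using tendsto_fst[OF l(3)] unfolding uw S_def by (simp add: o_def)
  have lw: "(\<lambda>k. cut n (y (S k))) \<longlonglongrightarrow> w"
    using tendsto_snd[OF l(3)] unfolding uw S_def by (simp add: o_def)
  have uK: "u \<in> ?K" and wK: "w \<in> ?K" using l(1) uw by auto
  have uX: "u \<in> X" "h u = q n ^ J" and wX: "w \<in> X" "h w = q n ^ J" using uK wK unfolding Level_def by auto
  have cxS: "cut n (x (S k)) \<in> ?K - ?F" and cyS: "cut n (y (S k)) \<in> ?K - ?F" for k
    using cx cy unfolding S_def by auto
  define g where "g = min (q n ^ J) (?t/4)"
  have g: "0 < g" "2 * g < ?t" "g \<le> q n ^ J" unfolding g_def using q_pow[of n J] ab(5) by auto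
  have ru: "r u g = r a g"
    using cut_limits[of "\<lambda>k. x (S k)" a g "\<lambda>_. n" u] xk LIMSEQ_subseq_LIMSEQ[OF lim(1) \<open>strict_mono S\<close>]
      ab g lu cxS unfolding Level_def by (auto simp: o_def)
  have rw: "r w g = r b g"
    using cut_limits[of "\<lambda>k. y (S k)" b g "\<lambda>_. n" w] yk LIMSEQ_subseq_LIMSEQ[OF lim(2) \<open>strict_mono S\<close>]
      ab g lw cyS unfolding Level_def by (auto simp: o_def)
  have "u \<noteq> w"
  proof
    assume "u = w"
    then have "r a g = r b g" using ru rw by simp
    then have "r a ?t = r b ?t" using fan[OF ab(1,2) g(1), of ?t] g ab by simp
    then show False using ab r_h by metis
  qed
  have sigS: "piece n J (cut n (x (S k))) = piece n J (cut n (y (S k)))" for k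
    using sig[of "S k"] jx[of "s2 k"] jy[of "s2 k"] unfolding sig_def S_def by simp
  have P: "is_partition n J (piece n J)" by (rule piece)
  \<comment> \<open>A piece is no wider than its distance to \<open>High\<close>, so if
    \<open>u\<close> were in \<open>High\<close>, the cuts of both sequences would have the same
    limit.\<close>
  have uF: "u \<notin> ?F"
  proof
    assume uF: "u \<in> ?F"
    have "dist (cut n (x (S k))) (cut n (y (S k))) \<le> infdist (cut n (x (S k))) ?F" for k
      using P cxS[of k] cyS[of k] sigS[of k] uF unfolding is_partition_def by blast
    moreover have "(\<lambda>k. infdist (cut n (x (S k))) ?F) \<longlonglongrightarrow> infdist u ?F"
      by (rule tendsto_infdist[OF lu])
    moreover have "(\<lambda>k. dist (cut n (x (S k))) (cut n (y (S k)))) \<longlonglongrightarrow> dist u w"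
      by (rule tendsto_dist[OF lu lw])
    ultimately have "dist u w \<le> infdist u ?F" by (intro LIMSEQ_le) auto
    then show False using uF \<open>u \<noteq> w\<close> by simp
  qed
  then obtain V where V: "u \<in> V" "V \<subseteq> ?K - ?F" "compact V" "compact (?K - V)"
    "\<forall>z\<in>?K - ?F. piece n J z = piece n J u \<longleftrightarrow> z \<in> V"
    using P uK unfolding is_partition_def by blast
  have "open (- (?K - V))" using V(4) compact_imp_closed by blast
  then have "\<forall>\<^sub>F k in sequentially. cut n (x (S k)) \<in> - (?K - V)"
    by (rule topological_tendstoD[OF lu]) (use V in blast)
  then have ev: "\<forall>\<^sub>F k in sequentially. piece n J (cut n (x (S k))) = piece n J u"
    by eventually_elim (use cxS V(5) in blast)
  then obtain k1 where k1: "\<And>k. k \<ge> k1 \<Longrightarrow> piece n J (cut n (x (S k))) = piece n J u"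
    unfolding eventually_sequentially by blast
  have "cut n (y (S (k + k1))) \<in> V" for k
    using k1[of "k + k1"] sigS[of "k + k1"] cyS[of "k + k1"] V(5) by simp
  moreover have "(\<lambda>k. cut n (y (S (k + k1)))) \<longlonglongrightarrow> w" using LIMSEQ_ignore_initial_segment[OF lw] .
  ultimately have "w \<in> V" by (rule closed_sequentially[OF compact_imp_closed[OF V(3)]])
  then have wF: "w \<notin> ?F" and pw: "piece n J w = piece n J u" using V by auto
  \<comment> \<open>Identifies \<open>u\<close> and \<open>w\<close> as the cuts of \<open>a\<close>
    and \<open>b\<close>: being off \<open>High\<close> keeps the apex in the grid interval of
    \<open>J\<close>.\<close>
  have *: "sig n z = (J, piece n J c)"
    if z: "z \<in> X" "g \<le> h z" "z \<noteq> v" and c: "c \<in> X" "h c = q n ^ J" "c \<notin> ?F" and rc: "r c g = r z g" for z c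
  proof -
    have topc: "apex c = apex z"
      using apex_eq[OF z(1) c(1) g(1) z(2)] g(3) c(2) rc by simp
    have "grid n z = J"
    proof (rule grid_eq)
      show "q n ^ J \<le> h (apex z)" using h_apex[OF c(1)] c(2) topc by simp
      show "q n * h (apex z) < q n ^ J"
      proof (rule ccontr)
        assume "\<not> q n * h (apex z) < q n ^ J"
        then have "r (apex c) (q n ^ J) \<in> ?F" unfolding High_def using apex(1)[OF c(1)] topc by auto
        then show False using apex(2)[OF c(1)] c by simp
      qed
    qed
    moreover have "cut n z = c" unfolding cut_def calculation using apex(2)[OF c(1)] c(2) topc by simp
    ultimately show ?thesis unfolding sig_def by simp
  qed
  have "a \<noteq> v" "b \<noteq> v" using ab h_v by auto
  then have "sig n a = (J, piece n J u)" "sig n b = (J, piece n J w)"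
    using *[of a u] *[of b w] ab uX wX uF wF ru rw g by auto
  moreover have "sig n (x (S k1)) = (J, piece n J u)"
    using k1[of k1] jx[of "s2 k1"] unfolding sig_def S_def by simp
  ultimately show ?thesis using pw by metis
qed

text \<open>As the stage tends to infinity, the diameters of the pieces tend to 0, so the cuts of
  both sequences share a limit \<open>u\<close>. The cuts keep at least a quarter of the height of
  \<open>a\<close>, which places \<open>u\<close> on the legs of both \<open>a\<close> and
  \<open>b\<close>.\<close>

lemma sig_separates:
  assumes xk: "\<And>k::nat. x k \<in> X" "\<And>k. x k \<noteq> v" and yk: "\<And>k. y k \<in> X" "\<And>k. y k \<noteq> v"
    and lim: "x \<longlonglongrightarrow> a" "y \<longlonglongrightarrow> b" and ab: "a \<in> X" "b \<in> X" "h a = h b" "0 < h a"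
    and sig: "\<And>k. sig (n k) (x k) = sig (n k) (y k)" and n: "filterlim n at_top sequentially"
  shows "a = b"
proof -
  let ?t = "h a"
  obtain N where N: "\<And>k. N \<le> k \<Longrightarrow> ?t/2 < h (x k)"
    using order_tendstoD(1)[OF h_lim[OF lim(1) xk(1)], of "?t/2"] ab(4) unfolding eventually_sequentially by auto
  define c where "c k = cut (n (k + N)) (x (k + N))" for k
  define d where "d k = cut (n (k + N)) (y (k + N))" for k
  have cX: "c k \<in> X" "d k \<in> X" for k unfolding c_def d_def using cut(2) xk yk by auto
  have grideq: "grid (n k) (x k) = grid (n k) (y k)" for k using sig[of k] unfolding sig_def by simp
  have hc: "h (d k) = h (c k)" "?t/4 \<le> h (c k)" for k
  proof -
    show "h (d k) = h (c k)" unfolding c_def d_def using cut(3) xk yk grideq by simp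
    show "?t/4 \<le> h (c k)" unfolding c_def using cut_height[OF xk, of "k + N" "n (k + N)"] N[of "k + N"] by simp
  qed
  have dist: "dist (c k) (d k) < 1 / (real (n (k + N)) + 1)" for k
  proof -
    let ?m = "n (k + N)" and ?j = "grid (n (k + N)) (x (k + N))"
    have "c k \<in> Level ?m ?j - High ?m ?j" "d k \<in> Level ?m ?j - High ?m ?j"
      unfolding c_def d_def using cut(1)[OF xk, of ?m "k + N"] cut(1)[OF yk, of ?m "k + N"] grideq[of "k + N"] by auto
    moreover have "piece ?m ?j (c k) = piece ?m ?j (d k)"
      using sig[of "k + N"] grideq[of "k + N"] unfolding sig_def c_def d_def by simp
    ultimately show ?thesis using piece[of ?m ?j] unfolding is_partition_def by blast
  qed
  obtain u s where u: "u \<in> X" "strict_mono s" "(c \<circ> s) \<longlonglongrightarrow> u"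
    using compact_subseq[OF compact_X, of c] cX by blast
  have "(\<lambda>k. 1 / (real (n (k + N)) + 1)) \<longlonglongrightarrow> 0"
  proof -
    have "filterlim (\<lambda>k. n (k + N)) sequentially sequentially"
      by (intro filterlim_compose[OF n] filterlim_add_const_nat_at_top)
    from filterlim_compose[OF LIMSEQ_inverse_real_of_nat this] show ?thesis
      by (simp add: divide_inverse add.commute)
  qed
  then have "(\<lambda>k. dist (c k) (d k)) \<longlonglongrightarrow> 0"
    by (rule tendsto_sandwich[OF _ _ tendsto_const, rotated 2]) (use dist less_imp_le in \<open>auto intro!: always_eventually\<close>)
  then have "((\<lambda>k. dist (c k) (d k)) \<circ> s) \<longlonglongrightarrow> 0" using u(2) LIMSEQ_subseq_LIMSEQ by blast
  moreover have "(\<lambda>k. dist (c (s k)) u) \<longlonglongrightarrow> 0" using iffD1[OF tendsto_dist_iff u(3)] unfolding o_def .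
  ultimately have "(\<lambda>k. dist (c (s k)) (d (s k)) + dist (c (s k)) u) \<longlonglongrightarrow> 0"
    using tendsto_add[of "\<lambda>k. dist (c (s k)) (d (s k))" 0 sequentially "\<lambda>k. dist (c (s k)) u" 0] by (simp add: o_def)
  then have "(\<lambda>k. dist (d (s k)) u) \<longlonglongrightarrow> 0"
    by (rule tendsto_sandwich[OF _ _ tendsto_const, rotated 2])
       (auto intro!: always_eventually dist_triangle3)
  then have "(d \<circ> s) \<longlonglongrightarrow> u" by (subst tendsto_dist_iff) (simp add: o_def)
  have s': "strict_mono (\<lambda>k. s k + N)" using u(2) by (simp add: strict_mono_def)
  have "r u (?t/4) = r a (?t/4)"
    using cut_limits[of "\<lambda>k. x (s k + N)" a "?t/4" "\<lambda>k. n (s k + N)" u] xk LIMSEQ_subseq_LIMSEQ[OF lim(1) s']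
      ab u(3) hc unfolding c_def by (auto simp: o_def)
  moreover have "r u (?t/4) = r b (?t/4)"
    using cut_limits[of "\<lambda>k. y (s k + N)" b "?t/4" "\<lambda>k. n (s k + N)" u] yk LIMSEQ_subseq_LIMSEQ[OF lim(2) s']
      ab \<open>(d \<circ> s) \<longlonglongrightarrow> u\<close> hc unfolding d_def by (auto simp: o_def)
  ultimately have "r a ?t = r b ?t" using fan[OF ab(1,2), of "?t/4" ?t] ab by simp
  then show ?thesis using ab r_h by metis
qed

text \<open>Agreement at all stages up to \<open>n\<close>, and not at \<open>n\<close> alone, makes
  the relation transitive: of two witnesses the smaller one serves. The grid index inside
  \<open>sig\<close> fixes \<open>thresh\<close>, so the condition on the height is the same for
  \<open>x\<close> and \<open>y\<close>.\<close>

definition glue where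
  "glue x y \<longleftrightarrow> x = y \<or> (x \<noteq> v \<and> y \<noteq> v \<and> h x = h y \<and> (\<exists>n. h x \<le> thresh n x \<and> (\<forall>j\<le>n. sig j x = sig j y)))"

lemma glue_sym: "glue x y \<Longrightarrow> glue y x"
  unfolding glue_def by (metis order_refl sig_eq_thresh)

lemma glue_trans: "glue x y \<Longrightarrow> glue y z \<Longrightarrow> glue x z"
proof -
  assume *: "glue x y" "glue y z"
  show "glue x z"
  proof (cases "x = y \<or> y = z")
    case False
    obtain n where n: "h x \<le> thresh n x" "\<forall>j\<le>n. sig j x = sig j y" using * False unfolding glue_def by auto
    obtain m where m: "h y \<le> thresh m y" "\<forall>j\<le>m. sig j y = sig j z" using * False unfolding glue_def by auto
    have h: "h x = h y" "h y = h z" "x \<noteq> v" "z \<noteq> v" using * False unfolding glue_def by auto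
    have "\<exists>k. h x \<le> thresh k x \<and> (\<forall>j\<le>k. sig j x = sig j z)"
    proof (cases "n \<le> m")
      case True
      have "sig j x = sig j z" if "j \<le> n" for j
        using n(2) m(2) True that by (metis order_trans)
      then show ?thesis using n(1) by blast
    next
      case False
      have "sig j x = sig j z" if "j \<le> m" for j
        using n(2) m(2) False that by (metis order_trans nle_le)
      moreover have "thresh m x = thresh m y" using n(2) False by (intro sig_eq_thresh) simp
      then have "h x \<le> thresh m x" using m(1) h by simp
      ultimately show ?thesis by blast
    qed
    then show ?thesis using h unfolding glue_def by auto
  qed (use * in auto)
qed

text \<open>If one witnessing stage recurs infinitely often, \<open>sig_limit\<close> transfers the
  agreement to the limits. Otherwise the stages tend to infinity and \<open>sig_separates\<close>
  makes the limits equal.\<close>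

lemma glue_closed:
  assumes xk: "\<And>k::nat. x k \<in> X" and yk: "\<And>k. y k \<in> X" and gl: "\<And>k. glue (x k) (y k)"
    and lim: "x \<longlonglongrightarrow> a" "y \<longlonglongrightarrow> b"
  shows "glue a b"
proof (rule ccontr)
  assume ng: "\<not> glue a b"
  then have "a \<noteq> b" unfolding glue_def by blast
  have aX: "a \<in> X" and bX: "b \<in> X"
    using closed_sequentially[OF compact_imp_closed[OF compact_X], of x a]
      closed_sequentially[OF compact_imp_closed[OF compact_X], of y b] xk yk lim by auto
  have "h (x k) = h (y k)" for k using gl[of k] unfolding glue_def by auto
  then have hab: "h a = h b" using LIMSEQ_unique[OF h_lim[OF lim(1) xk]] h_lim[OF lim(2) yk] by simp
  then have pos: "0 < h a" using \<open>a \<noteq> b\<close> h_eq_0 h_nonneg aX bX by (metis order_le_less)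
  then have ab_v: "a \<noteq> v" "b \<noteq> v" using hab h_v by auto
  have "(\<lambda>k. dist (x k) (y k)) \<longlonglongrightarrow> dist a b" using lim by (rule tendsto_dist)
  then have "\<forall>\<^sub>F k in sequentially. 0 < dist (x k) (y k)"
    by (rule order_tendstoD) (use \<open>a \<noteq> b\<close> in simp)
  then obtain N where N: "\<And>k. N \<le> k \<Longrightarrow> x k \<noteq> y k"
    unfolding eventually_sequentially by auto
  define x' where "x' k = x (k + N)" for k
  define y' where "y' k = y (k + N)" for k
  have X': "x' k \<in> X" "y' k \<in> X" "x' k \<noteq> v" "y' k \<noteq> v" for k
    using xk yk gl[of "k + N"] N[of "k + N"] unfolding x'_def y'_def glue_def by auto
  have lim': "x' \<longlonglongrightarrow> a" "y' \<longlonglongrightarrow> b"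
    unfolding x'_def y'_def using LIMSEQ_ignore_initial_segment lim by blast+
  have "\<exists>n. h (x' k) \<le> thresh n (x' k) \<and> (\<forall>j\<le>n. sig j (x' k) = sig j (y' k))" for k
    using gl[of "k + N"] N[of "k + N"] unfolding x'_def y'_def glue_def by auto
  then obtain n where n: "\<And>k. h (x' k) \<le> thresh (n k) (x' k)" "\<And>k j. j \<le> n k \<Longrightarrow> sig j (x' k) = sig j (y' k)"
    by metis
  show False
  proof (cases "\<exists>m. infinite {k. n k = m}")
    case True
    then obtain m where m: "infinite {k. n k = m}" by blast
    obtain s :: "nat \<Rightarrow> nat" where s: "strict_mono s" "\<And>k. s k \<in> {k. n k = m}" using infinite_enumerate[OF m] by blast
    have lims: "(\<lambda>k. x' (s k)) \<longlonglongrightarrow> a" "(\<lambda>k. y' (s k)) \<longlonglongrightarrow> b"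
      using LIMSEQ_subseq_LIMSEQ[OF lim'(1) s(1)] LIMSEQ_subseq_LIMSEQ[OF lim'(2) s(1)] by (auto simp: o_def)
    have sigs: "sig j (x' (s k)) = sig j (y' (s k))" if "j \<le> m" for j k
      using n(2)[of j "s k"] s(2)[of k] that by auto
    \<comment> \<open>\<open>sig_limit\<close> yields a single good index, so it is applied to a
      subsequence of bad ones.\<close>
    have ev: "\<forall>\<^sub>F k in sequentially. sig j (x' (s k)) = sig j a \<and> sig j (x' (s k)) = sig j b" if j: "j \<le> m" for j
    proof (rule ccontr)
      assume "\<not> ?thesis"
      then have "infinite {k. \<not> (sig j (x' (s k)) = sig j a \<and> sig j (x' (s k)) = sig j b)}"
        unfolding cofinite_eq_sequentially[symmetric] eventually_cofinite by simp
      then obtain s2 :: "nat \<Rightarrow> nat" where s2: "strict_mono s2"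
        "\<And>k. s2 k \<in> {k. \<not> (sig j (x' (s k)) = sig j a \<and> sig j (x' (s k)) = sig j b)}"
        using infinite_enumerate by blast
      have "(\<lambda>k. x' (s (s2 k))) \<longlonglongrightarrow> a" "(\<lambda>k. y' (s (s2 k))) \<longlonglongrightarrow> b"
        using LIMSEQ_subseq_LIMSEQ[OF lims(1) s2(1)] LIMSEQ_subseq_LIMSEQ[OF lims(2) s2(1)] by (auto simp: o_def)
      then obtain k where "sig j (x' (s (s2 k))) = sig j a \<and> sig j (x' (s (s2 k))) = sig j b"
        using sig_limit[of "\<lambda>k. x' (s (s2 k))" "\<lambda>k. y' (s (s2 k))" a b j] X' aX bX \<open>a \<noteq> b\<close> hab pos sigs[OF j] by blast
      then show False using s2(2)[of k] by blast
    qed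
    then have "\<forall>\<^sub>F k in sequentially. \<forall>j\<in>{..m}. sig j (x' (s k)) = sig j a \<and> sig j (x' (s k)) = sig j b"
      by (intro eventually_ball_finite) auto
    then obtain K where K: "\<And>k j. K \<le> k \<Longrightarrow> j \<le> m \<Longrightarrow> sig j (x' (s k)) = sig j a \<and> sig j (x' (s k)) = sig j b"
      unfolding eventually_sequentially by auto
    have "h (x' (s k)) \<le> thresh m a" if "K \<le> k" for k
      using n(1)[of "s k"] s(2)[of k] K[OF that, of m] sig_eq_thresh[of m "x' (s k)" a] by auto
    then have "h a \<le> thresh m a"
      using LIMSEQ_le_const2[OF h_lim[OF lims(1)]] X' by blast
    moreover have "sig j a = sig j b" if "j \<le> m" for j using K[OF order_refl that] by metis
    ultimately have "glue a b" unfolding glue_def using ab_v hab by blast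
    then show False using ng by blast
  next
    case False
    have "filterlim n at_top sequentially"
      unfolding filterlim_at_top
    proof
      fix Z
      have "{k. \<not> Z \<le> n k} = (\<Union>m<Z. {k. n k = m})" by auto
      moreover have "finite (\<Union>m<Z. {k. n k = m})" using False by blast
      ultimately have "finite {k. \<not> Z \<le> n k}" by simp
      then show "\<forall>\<^sub>F k in sequentially. Z \<le> n k"
        unfolding cofinite_eq_sequentially[symmetric] eventually_cofinite .
    qed
    then have "a = b"
      using sig_separates[of x' y' a b n] X' lim' aX bX hab pos n(2) by blast
    then show False using \<open>a \<noteq> b\<close> by blast
  qed
qed

text \<open>Signatures and thresholds are constant on legs, and the condition
  \<open>h x <= thresh n x\<close> only becomes easier lower down. At height 0 both points are the
  root.\<close>

lemma glue_r:
  assumes x: "x \<in> X" "y \<in> X" and t: "t \<in> {0..1}" and g: "glue x y"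
  shows "glue (r x t) (r y t)"
proof (cases "x = y")
  case False
  then obtain n where n: "h x \<le> thresh n x" "\<And>j. j \<le> n \<Longrightarrow> sig j x = sig j y" and h: "h x = h y" and v: "x \<noteq> v" "y \<noteq> v"
    using g unfolding glue_def by auto
  consider "t = 0" | "h x \<le> t" | "0 < t" "t < h x" using t by fastforce
  then show ?thesis
  proof cases
    case 1
    then show ?thesis using r_0 x unfolding glue_def by simp
  next
    case 2
    then show ?thesis using r_ge[of _ t] x t h g by simp
  next
    case 3
    have *: "r z t \<in> X" "h (r z t) = t" "apex (r z t) = apex z" if "z \<in> X" "h z = h x" for z
    proof -
      show X: "r z t \<in> X" and H: "h (r z t) = t" using r_in h_r' that t 3 by auto
      have "r (r z t) t = r z t" using r_r[OF that(1) t t] by simp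
      then show "apex (r z t) = apex z" by (intro apex_eq[OF that(1) X 3(1)]) (use 3 that H in auto)
    qed
    have "r x t \<noteq> v" "r y t \<noteq> v" using *(2) x h 3 h_v by (metis less_irrefl)+
    moreover have "t \<le> thresh n (r x t)" using apex_eq_sig(2)[OF *(3)] x n(1) 3 by simp
    moreover have "sig j (r x t) = sig j (r y t)" if "j \<le> n" for j
      using apex_eq_sig(1)[OF *(3)] x h n(2)[OF that] by simp
    ultimately show ?thesis unfolding glue_def using *(2) x h by auto
  qed
qed (simp add: glue_def)

text \<open>All thresholds lie strictly below the height of the endpoint, so no stage can witness a
  gluing there.\<close>

lemma glue_maximal:
  assumes e: "e \<in> X" "e \<noteq> v" "\<And>x. x \<in> X \<Longrightarrow> r x (h e) = e \<Longrightarrow> x = e" and "glue e x"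
  shows "x = e"
proof (rule ccontr)
  assume "x \<noteq> e"
  then obtain n where "h e \<le> thresh n e" using assms unfolding glue_def by auto
  moreover have "apex e = e" using e(3)[of "apex e"] apex e(1) by blast
  ultimately show False using thresh(2)[OF e(1,2), of n] by simp
qed

text \<open>Up to gluing, a point at height \<open>a <= thresh n x\<close> is determined by its
  signatures at stages up to \<open>n\<close>, a finite list of pairs of naturals. Thresholds tend
  to the height of the endpoint, so each leg that reaches \<open>b\<close> is covered by some
  \<open>n\<close>.\<close>

lemma glue_countable_cuts:
  assumes F: "\<And>x y. x \<in> X \<Longrightarrow> y \<in> X \<Longrightarrow> glue x y \<Longrightarrow> F x = F y" and a: "0 < a" "a < b"
  shows "countable ((\<lambda>x. F (r x a)) ` {x \<in> X. b \<le> h x})"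
proof -
  define code where "code n x = map (\<lambda>j. sig j x) [0..<Suc n]" for n x
  let ?S = "\<lambda>n. {x \<in> X. b \<le> h x \<and> a \<le> thresh n x}"
  have "countable ((\<lambda>x. F (r x a)) ` ?S n)" for n
  proof -
    have eq: "F (r x a) = F (r y a)" if xy: "x \<in> ?S n" "y \<in> ?S n" "code n x = code n y" for x y
    proof -
      have "sig j x = sig j y" if "j \<le> n" for j
      proof -
        have "code n x ! j = code n y ! j" using xy(3) by simp
        then show ?thesis using that unfolding code_def by (simp del: upt_Suc)
      qed
      have *: "r z a \<in> X" "h (r z a) = a" "apex (r z a) = apex z" if "z \<in> ?S n" for z
      proof -
        have z: "z \<in> X" "a \<le> h z" "a \<in> {0..1}" using that a h_le_1[of z] by auto
        show X: "r z a \<in> X" and H: "h (r z a) = a" using r_in h_r' z a by auto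
        have "r (r z a) a = r z a" using r_r[OF z(1,3,3)] by simp
        then show "apex (r z a) = apex z" by (intro apex_eq[OF z(1) X a(1)]) (use z H in auto)
      qed
      have "r x a \<noteq> v" "r y a \<noteq> v" using *(2) xy a h_v by (metis less_irrefl)+
      moreover have "a \<le> thresh n (r x a)" using apex_eq_sig(2)[OF *(3)] xy by simp
      moreover have "sig j (r x a) = sig j (r y a)" if "j \<le> n" for j
        using apex_eq_sig(1)[OF *(3)] xy \<open>\<And>j. j \<le> n \<Longrightarrow> sig j x = sig j y\<close>[OF that] by simp
      ultimately have "glue (r x a) (r y a)" unfolding glue_def using *(2) xy by auto
      then show ?thesis using F *(1) xy by blast
    qed
    have "(\<lambda>x. F (r x a)) ` ?S n \<subseteq> (\<lambda>c. F (r (SOME x. x \<in> ?S n \<and> code n x = c) a)) ` UNIV"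
    proof
      fix z assume "z \<in> (\<lambda>x. F (r x a)) ` ?S n"
      then obtain x where x: "x \<in> ?S n" "z = F (r x a)" by blast
      let ?y = "SOME y. y \<in> ?S n \<and> code n y = code n x"
      have "?y \<in> ?S n \<and> code n ?y = code n x" by (rule someI[of _ x]) (use x in blast)
      then have "z = F (r ?y a)" using eq[of x ?y] x by simp
      then show "z \<in> (\<lambda>c. F (r (SOME x. x \<in> ?S n \<and> code n x = c) a)) ` UNIV" by blast
    qed
    moreover have "countable (UNIV :: (nat \<times> nat) list set)" by (rule countableI_type)
    ultimately show ?thesis by (meson countable_image countable_subset)
  qed
  then have "countable (\<Union>n. (\<lambda>x. F (r x a)) ` ?S n)" by blast
  moreover have "(\<lambda>x. F (r x a)) ` {x \<in> X. b \<le> h x} \<subseteq> (\<Union>n. (\<lambda>x. F (r x a)) ` ?S n)"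
  proof -
    have "\<exists>n. a \<le> thresh n x" if x: "x \<in> X" "b \<le> h x" for x
    proof -
      have "x \<noteq> v" using x a h_v by auto
      \<comment> \<open>The gap between threshold and endpoint is at most
        \<open>2 / (real n + 2)\<close>; this \<open>n\<close> makes it smaller than
        \<open>b - a\<close>.\<close>
      obtain n :: nat where n: "2 / (b - a) < real n" using reals_Archimedean2 by blast
      then have "2 < real n * (b - a)" using a by (simp add: field_simps)
      then have "2 < (real n + 2) * (b - a)" using a by (simp add: algebra_simps)
      then have "2 / (real n + 2) < b - a" by (simp add: field_simps)
      moreover have "h x \<le> h (apex x)" by (rule h_apex[OF x(1)])
      ultimately have "a \<le> thresh n x" using thresh(3)[OF x(1) \<open>x \<noteq> v\<close>, of n] x(2) by linarith
      then show ?thesis by blast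
    qed
    then show ?thesis by blast
  qed
  ultimately show ?thesis using countable_subset by blast
qed

section \<open>The quotient and its endpoints\<close>

lemma glue_sig: "glue x y \<Longrightarrow> sig 0 x = sig 0 y"
  unfolding glue_def by auto

lemma suslinian_model:
  assumes root: "v \<notin> endpoints X" and dense: "v \<in> closure (endpoints X)"
  shows "\<exists>D :: (nat \<Rightarrow> real) set. suslinian D \<and> smooth_dendroid D \<and> endpoints D homeomorphic endpoints X"
proof -
  obtain F :: "'a \<Rightarrow> nat \<Rightarrow> real" where F: "continuous_on X F"
    "\<And>x y. x \<in> X \<Longrightarrow> y \<in> X \<Longrightarrow> F x = F y \<longleftrightarrow> glue x y"
  proof (rule quotient_embedding[where L = X and E = glue])
    show "glue x x" for x unfolding glue_def by simp
  qed (use compact_X glue_sym glue_trans glue_closed in blast)+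
  interpret Q: radial_quotient X h r v glue F
  proof
    show "h x = h y" if "glue x y" for x y using that unfolding glue_def by auto
  qed (use F glue_r in auto)
  interpret I: radial "F ` X" Q.Fh Q.Fr "F v" by (rule Q.radial_image)
  interpret R: radial_countable "F ` X" Q.Fh Q.Fr "F v"
  proof
    fix a b :: real assume ab: "0 < a" "a < b"
    have "(\<lambda>z. Q.Fr z a) ` {z \<in> F ` X. b \<le> Q.Fh z} \<subseteq> (\<lambda>x. F (r x a)) ` {x \<in> X. b \<le> h x}"
    proof
      fix w assume "w \<in> (\<lambda>z. Q.Fr z a) ` {z \<in> F ` X. b \<le> Q.Fh z}"
      then obtain x where x: "x \<in> X" "b \<le> Q.Fh (F x)" "w = Q.Fr (F x) a" by blast
      then have "b \<le> h x" using Q.Fh by simp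
      moreover have "a \<in> {0..1}" using ab \<open>b \<le> h x\<close> h_le_1[OF x(1)] by simp
      ultimately show "w \<in> (\<lambda>x. F (r x a)) ` {x \<in> X. b \<le> h x}" using x Q.Fr by auto
    qed
    moreover have "countable ((\<lambda>x. F (r x a)) ` {x \<in> X. b \<le> h x})"
      by (rule glue_countable_cuts[OF _ ab]) (use F(2) in blast)
    ultimately show "countable ((\<lambda>z. Q.Fr z a) ` {z \<in> F ` X. b \<le> Q.Fh z})"
      by (rule countable_subset)
  qed
  define M where "M = endpoints X"
  have M: "M = {e \<in> X. e \<noteq> v \<and> (\<forall>x\<in>X. r x (h e) = e \<longrightarrow> x = e)}"
    unfolding M_def by (rule endpoints_eq[OF root])
  have MD: "e \<in> X" "e \<noteq> v" "\<And>x. x \<in> X \<Longrightarrow> r x (h e) = e \<Longrightarrow> x = e" "apex e = e" if "e \<in> M" for e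
  proof -
    show *: "e \<in> X" "e \<noteq> v" "\<And>x. x \<in> X \<Longrightarrow> r x (h e) = e \<Longrightarrow> x = e" using that unfolding M by auto
    show "apex e = e" using *(3)[of "apex e"] apex[OF *(1)] by blast
  qed
  have FM: "y = e" if "e \<in> M" "y \<in> X" "F y = F e" for e y
    using glue_maximal[of e y] MD[OF that(1)] F(2)[of e y] that by auto
  have below_sig: "sig 0 (r e t) = sig 0 e" if e: "e \<in> X" and t: "0 < t" "t \<le> h e" for e t
  proof (rule apex_eq_sig(1))
    have t1: "t \<in> {0..1}" using t h_le_1[OF e] by simp
    show "apex (r e t) = apex e"
      by (rule apex_eq[OF e r_in[OF e t1] t(1)]) (use r_r[OF e t1 t1] h_r' e t in auto)
  qed
  \<comment> \<open>An endpoint \<open>e2\<close> near the vertex is lower than the threshold of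
    \<open>e1\<close> at stage 0. Their signatures already differ at stage 0, so the two legs are
    glued at no positive height and the root lies between them.\<close>
  have rootD: "F v \<notin> endpoints (F ` X)"
  proof -
    have "M \<noteq> {}" using dense unfolding M_def by auto
    then obtain e1 where e1: "e1 \<in> M" by blast
    have pos: "0 < thresh 0 e1" using thresh(1) MD e1 by blast
    then obtain d where d: "d > 0" "\<And>x. x \<in> X \<Longrightarrow> dist x v < d \<Longrightarrow> dist (h x) (h v) < thresh 0 e1"
      using cont_h v_in unfolding continuous_on_iff by metis
    obtain e2 where e2: "e2 \<in> M" "dist e2 v < d"
      using dense d(1) unfolding closure_approachable M_def by blast
    have "h e2 < thresh 0 e1" using d(2)[of e2] MD(1)[OF e2(1)] e2 h_v h_nonneg by (simp add: dist_real_def)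
    then have "thresh 0 e2 < thresh 0 e1" using thresh(2)[of e2 0] MD[OF e2(1)] by simp
    then have sig: "sig 0 e1 \<noteq> sig 0 e2" using sig_eq_thresh[of 0 e1 e2] by auto
    show ?thesis
    proof (rule R.root_not_endpoint[of "F e1" "F e2"])
      show "F e1 \<noteq> F v" "F e2 \<noteq> F v" using FM[of _ v] v_in MD(2) e1 e2(1) by metis+
      fix t assume t: "0 < t" "t \<le> Q.Fh (F e1)" "t \<le> Q.Fh (F e2)"
      then have t': "t \<le> h e1" "t \<le> h e2" using Q.Fh MD(1) e1 e2(1) by auto
      then have t1: "t \<in> {0..1}" using t h_le_1 MD(1) e1 by fastforce
      show "Q.Fr (F e1) t \<noteq> Q.Fr (F e2) t"
      proof
        assume "Q.Fr (F e1) t = Q.Fr (F e2) t"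
        then have "glue (r e1 t) (r e2 t)"
          using Q.Fr t1 MD(1) e1 e2(1) F(2) r_in by auto
        then show False using glue_sig below_sig t t' MD(1) e1 e2(1) sig by metis
      qed
    qed (use MD e1 e2 in auto)
  qed
  have ends: "endpoints (F ` X) = F ` M"
    unfolding R.endpoints_eq[OF rootD]
  proof (intro set_eqI iffI)
    fix z assume "z \<in> {z \<in> F ` X. z \<noteq> F v \<and> (\<forall>x\<in>F ` X. Q.Fr x (Q.Fh z) = z \<longrightarrow> x = z)}"
    then obtain x where x: "x \<in> X" "z = F x" "F x \<noteq> F v"
      "\<And>y. y \<in> X \<Longrightarrow> Q.Fr (F y) (Q.Fh (F x)) = F x \<Longrightarrow> F y = F x" by auto
    have xv: "x \<noteq> v" using x by auto
    \<comment> \<open>The image of \<open>apex x\<close> lies above \<open>F x\<close>, so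
      maximality of \<open>F x\<close> makes the two equal.\<close>
    have "Q.Fr (F (apex x)) (Q.Fh (F x)) = F x"
      using Q.Fr Q.Fh x(1) apex[OF x(1)] h_in by simp
    then have "F (apex x) = z" using x apex(1)[OF x(1)] by blast
    moreover have "apex x \<in> M"
    proof -
      have "apex x \<noteq> v" using h_apex[OF x(1)] h_pos[OF x(1) xv] h_v by auto
      then show ?thesis unfolding M using apex(1)[OF x(1)] apex_maximal[OF x(1) xv] by blast
    qed
    ultimately show "z \<in> F ` M" by blast
  next
    fix z assume "z \<in> F ` M"
    then obtain e where e: "e \<in> M" "z = F e" by blast
    note e' = MD[OF e(1)]
    have "w = z" if w: "w \<in> F ` X" "Q.Fr w (Q.Fh z) = z" for w
    proof -
      obtain y where y: "y \<in> X" "w = F y" using w(1) by blast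
      have "F (r y (h e)) = F e" using w(2) y e(2) e'(1) Q.Fr Q.Fh h_in by simp
      then have "r y (h e) = e" using FM[OF e(1)] r_in[OF y(1)] h_in[OF e'(1)] by blast
      then show ?thesis using e'(3)[OF y(1)] y e by simp
    qed
    moreover have "z \<noteq> F v" using FM[OF e(1) v_in] e(2) e'(2) by metis
    ultimately show "z \<in> {z \<in> F ` X. z \<noteq> F v \<and> (\<forall>x\<in>F ` X. Q.Fr x (Q.Fh z) = z \<longrightarrow> x = z)}"
      using e e'(1) by blast
  qed
  have MX: "M \<subseteq> X" using MD(1) by blast
  \<comment> \<open>Each endpoint is a whole class, so \<open>F\<close> maps the trace on
    \<open>M\<close> of a closed set onto the trace of its compact image. Thus \<open>F\<close> is
    closed on \<open>M\<close>, although \<open>M\<close> need not be compact.\<close>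
  obtain g where "homeomorphism M (F ` M) F g"
  proof (rule homeomorphism_injective_closed_map[of M F "F ` M"])
    show "continuous_on M F" using F(1) MX continuous_on_subset by blast
    show "inj_on F M" using FM MX by (intro inj_onI) blast
    fix U assume "closedin (top_of_set M) U"
    then obtain C where C: "closed C" "U = M \<inter> C" using closedin_closed by blast
    have "compact (X \<inter> C)" using compact_X C(1) by (rule compact_Int_closed)
    then have "compact (F ` (X \<inter> C))"
      using F(1) by (intro compact_continuous_image) (auto intro: continuous_on_subset)
    moreover have "F ` U = F ` M \<inter> F ` (X \<inter> C)"
    proof
      show "F ` M \<inter> F ` (X \<inter> C) \<subseteq> F ` U"
      proof
        fix z assume "z \<in> F ` M \<inter> F ` (X \<inter> C)"
        then obtain e x where ex: "e \<in> M" "z = F e" "x \<in> X" "x \<in> C" "z = F x" by blast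
        then have "x = e" using FM[of e x] by simp
        then show "z \<in> F ` U" using ex C by blast
      qed
    qed (use C MX in blast)
    ultimately show "closedin (top_of_set (F ` M)) (F ` U)"
      by (metis closedin_closed_Int compact_imp_closed)
  qed auto
  then have "M homeomorphic F ` M" unfolding homeomorphic_def by blast
  then have "endpoints (F ` X) homeomorphic endpoints X"
    using ends homeomorphic_sym M_def by metis
  then show ?thesis using R.suslinian_X R.smooth_X by blast
qed

end

section \<open>The order of a smooth fan\<close>

locale dendroid_space =
  fixes X :: "'a::metric_space set"
  assumes dend: "dendroid X"
begin

abbreviation ar where "ar \<equiv> the_arc X"

lemma compact_X: "compact X" and closed_X: "closed X"
  using dend unfolding dendroid_def continuum_def by (auto simp: compact_imp_closed)

lemma ar_refl [simp]: "ar x x = {x}"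
  by (simp add: the_arc_def)

lemma ar_arc: "x \<in> X \<Longrightarrow> y \<in> X \<Longrightarrow> x \<noteq> y \<Longrightarrow> arc_from_to (ar x y) x y"
  using the_arc_props[OF dend] by blast

lemma ar_in: "x \<in> X \<Longrightarrow> y \<in> X \<Longrightarrow> ar x y \<subseteq> X"
  using the_arc_props[OF dend] by (cases "x = y") auto

lemma ar_ends: "x \<in> X \<Longrightarrow> y \<in> X \<Longrightarrow> x \<in> ar x y" "x \<in> X \<Longrightarrow> y \<in> X \<Longrightarrow> y \<in> ar x y"
  using arc_from_to_ends[OF ar_arc] by (cases "x = y"; force)+

lemma ar_compact: "x \<in> X \<Longrightarrow> y \<in> X \<Longrightarrow> compact (ar x y)"
  using arc_from_to_cont(2)[OF ar_arc] by (cases "x = y") auto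

lemma ar_closed: "x \<in> X \<Longrightarrow> y \<in> X \<Longrightarrow> closed (ar x y)"
  using ar_compact compact_imp_closed by blast

lemma ar_connected: "x \<in> X \<Longrightarrow> y \<in> X \<Longrightarrow> connected (ar x y)"
  using arc_from_to_cont(4)[OF ar_arc] by (cases "x = y") auto

lemma ar_eq: "A \<subseteq> X \<Longrightarrow> arc_from_to A x y \<Longrightarrow> ar x y = A"
proof -
  assume A: "A \<subseteq> X" "arc_from_to A x y"
  then have "x \<in> X" "y \<in> X" "x \<noteq> y" using arc_from_to_ends arc_from_to_neq by blast+
  then show ?thesis
    using dendroid_arc_unique[OF dend ar_in ar_arc A] by blast
qed

lemma ar_sym: "x \<in> X \<Longrightarrow> y \<in> X \<Longrightarrow> ar x y = ar y x"
  using ar_eq[OF ar_in arc_from_to_sym[OF ar_arc], of y x] by (cases "x = y") auto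

lemma ar_least: "K \<subseteq> X \<Longrightarrow> compact K \<Longrightarrow> connected K \<Longrightarrow> x \<in> K \<Longrightarrow> y \<in> K \<Longrightarrow> ar x y \<subseteq> K"
  using subcontinuum_contains_arc[OF dend ar_in ar_arc, of x y K]
  by (cases "x = y") (auto simp: subcontinuum_def continuum_def)

lemma ar_triangle: "x \<in> X \<Longrightarrow> y \<in> X \<Longrightarrow> z \<in> X \<Longrightarrow> ar x y \<subseteq> ar x z \<union> ar z y"
proof -
  assume X: "x \<in> X" "y \<in> X" "z \<in> X"
  show "ar x y \<subseteq> ar x z \<union> ar z y"
  proof (rule ar_least)
    show "connected (ar x z \<union> ar z y)"
      using X ar_connected ar_ends by (intro connected_Un) blast+
  qed (use X ar_in ar_compact ar_ends in \<open>auto intro: compact_Un\<close>)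
qed

lemma ar_prefix:
  assumes "x \<in> X" "y \<in> X" "continuous_on {0..1} g" "inj_on g {0..1::real}" "g ` {0..1} = ar x y" "g 0 = x" "g 1 = y" "u \<in> {0..1}"
  shows "ar x (g u) = g ` {0..u}" "ar (g u) y = g ` {u..1}"
proof -
  have sub: "g ` {0..1} \<subseteq> X" using assms ar_in by simp
  show "ar x (g u) = g ` {0..u}"
  proof (cases "u = 0")
    case False
    have "arc_from_to (g ` {0..u}) (g 0) (g u)"
      using False assms(3,4,8) by (intro arc_from_to_image) (auto intro: continuous_on_subset[OF assms(3)] inj_on_subset[OF assms(4)])
    moreover have "g ` {0..u} \<subseteq> X" using sub assms(8) by auto
    ultimately show ?thesis using ar_eq assms(6) by blast
  qed (use assms in simp)
  show "ar (g u) y = g ` {u..1}"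
  proof (cases "u = 1")
    case False
    have "arc_from_to (g ` {u..1}) (g u) (g 1)"
      using False assms(3,4,8) by (intro arc_from_to_image) (auto intro: continuous_on_subset[OF assms(3)] inj_on_subset[OF assms(4)])
    moreover have "g ` {u..1} \<subseteq> X" using sub assms(8) by auto
    ultimately show ?thesis using ar_eq assms(7) by blast
  qed (use assms in simp)
qed

lemma ar_split:
  assumes X: "x \<in> X" "y \<in> X" and z: "z \<in> ar x y"
  shows "ar x y = ar x z \<union> ar z y" "ar x z \<inter> ar z y = {z}"
proof -
  have "ar x y = ar x z \<union> ar z y \<and> ar x z \<inter> ar z y = {z}"
  proof (cases "x = y")
    case False
    obtain g where g: "continuous_on {0..1} g" "inj_on g {0..1::real}" "g ` {0..1} = ar x y" "g 0 = x" "g 1 = y"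
      using arc_from_to_param[OF ar_arc[OF X False]] by blast
    obtain u where u: "u \<in> {0..1}" "z = g u" using z g(3) by blast
    note e = ar_prefix[OF X g u(1)]
    have "{0..1} = {0..u} \<union> {u..1}" using u(1) by auto
    then have "ar x y = ar x z \<union> ar z y" using e u(2) g(3) by (metis image_Un)
    moreover have "g ` {0..u} \<inter> g ` {u..1} = g ` ({0..u} \<inter> {u..1})"
      using u(1) by (intro inj_on_image_Int[OF g(2), symmetric]) auto
    moreover have "{0..u} \<inter> {u..1} = {u}" using u(1) by auto
    ultimately show ?thesis using e u(2) by simp
  qed (use z in simp)
  then show "ar x y = ar x z \<union> ar z y" "ar x z \<inter> ar z y = {z}" by auto
qed

section \<open>The tree order of a dendroid rooted at a point\<close>

lemma le_in: "v \<in> X \<Longrightarrow> x \<in> X \<Longrightarrow> z \<in> ar v x \<Longrightarrow> z \<in> X"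
  using ar_in by blast

lemma le_trans: "v \<in> X \<Longrightarrow> x \<in> X \<Longrightarrow> y \<in> ar v x \<Longrightarrow> z \<in> ar v y \<Longrightarrow> z \<in> ar v x"
  using ar_split(1)[of v x y] by blast

lemma le_antisym: "v \<in> X \<Longrightarrow> x \<in> X \<Longrightarrow> z \<in> ar v x \<Longrightarrow> x \<in> ar v z \<Longrightarrow> z = x"
  using ar_split(2)[of v x z] ar_ends(2)[of z x] le_in[of v x z] by (metis IntI singletonD)

text \<open>If neither point were below the other, each would lie between the other and
  \<open>x\<close>, which forces them to be equal.\<close>

lemma le_linear:
  assumes X: "v \<in> X" "x \<in> X" and y: "y \<in> ar v x" and z: "z \<in> ar v x"
  shows "y \<in> ar v z \<or> z \<in> ar v y"
proof (rule ccontr)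
  assume n: "\<not> ?thesis"
  have yz: "y \<in> X" "z \<in> X" using le_in X y z by blast+
  have "y \<in> ar z x" "z \<in> ar y x" using n ar_split(1)[OF X y] ar_split(1)[OF X z] y z by blast+
  then have "z = y" using ar_split(2)[OF yz(2) X(2), of y] ar_ends(1)[of z y] yz by (metis IntI singletonD)
  then show False using n ar_ends(2) X yz by blast
qed

text \<open>\<open>m\<close> is the last point of \<open>ar v x\<close> on \<open>ar v y\<close>.
  The arcs from \<open>m\<close> to \<open>x\<close> and to \<open>y\<close> meet only in
  \<open>m\<close> and together cover \<open>ar x y\<close>, so connectedness puts \<open>m\<close>
  on it.\<close>

lemma median:
  assumes X: "v \<in> X" "x \<in> X" "y \<in> X"
  obtains m where "m \<in> X" "m \<in> ar v x" "m \<in> ar v y" "m \<in> ar x y" "ar v x \<inter> ar v y = ar v m"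
proof -
  let ?I = "ar v x \<inter> ar v y"
  have "\<exists>m. m \<in> ?I \<and> ?I \<subseteq> ar v m"
  proof (cases "v = x")
    case False
    obtain g where g: "continuous_on {0..1} g" "inj_on g {0..1::real}" "g ` {0..1} = ar v x" "g 0 = v" "g 1 = x"
      using arc_from_to_param[OF ar_arc[OF X(1,2) False]] by blast
    let ?U = "{0..1} \<inter> g -` ar v y"
    have "closed ?U" using continuous_closed_preimage[OF g(1) _ ar_closed[OF X(1,3)]] by simp
    then have "compact ?U" using compact_Int_closed[OF compact_Icc, of ?U 0 1] by (simp add: Int_assoc[symmetric])
    moreover have "0 \<in> ?U" using g(4) ar_ends X by simp
    ultimately obtain u where u: "u \<in> ?U" "\<And>t. t \<in> ?U \<Longrightarrow> t \<le> u"
      using compact_attains_sup[of ?U] by blast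
    have "ar v (g u) = g ` {0..u}" using ar_prefix(1)[OF X(1,2) g, of u] u by blast
    moreover have "?I \<subseteq> g ` {0..u}"
    proof
      fix z assume "z \<in> ?I"
      then obtain t where "t \<in> {0..1}" "z = g t" "z \<in> ar v y" using g(3) by blast
      then have "t \<in> {0..u}" using u(2)[of t] by auto
      then show "z \<in> g ` {0..u}" using \<open>z = g t\<close> by blast
    qed
    ultimately show ?thesis using u(1) g(3) by (intro exI[of _ "g u"]) blast
  next
    case True
    then show ?thesis using ar_ends X by (intro exI[of _ v]) auto
  qed
  then obtain m where m: "m \<in> ar v x" "m \<in> ar v y" "?I \<subseteq> ar v m" by blast
  have mX: "m \<in> X" using le_in X m by blast
  have I: "?I = ar v m" using m ar_split(1)[OF X(1,2) m(1)] ar_split(1)[OF X(1,3) m(2)] by blast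
  have xmy: "ar x m \<inter> ar m y = {m}"
  proof -
    have "ar x m \<subseteq> ar v x" using ar_split(1)[OF X(1,2) m(1)] ar_sym[OF X(2) mX] by blast
    moreover have "ar m y \<subseteq> ar v y" using ar_split(1)[OF X(1,3) m(2)] by blast
    ultimately have "ar x m \<inter> ar m y \<subseteq> ar v m \<inter> ar m x" using I ar_sym[OF X(2) mX] by blast
    then show ?thesis using ar_split(2)[OF X(1,2) m(1)] ar_ends X mX by blast
  qed
  have "ar x m \<inter> ar x y \<noteq> {}" "ar m y \<inter> ar x y \<noteq> {}" using ar_ends X mX by blast+
  moreover have "closed (ar x m)" "closed (ar m y)" "connected (ar x y)"
    using ar_closed ar_connected X mX by blast+
  ultimately have "ar x m \<inter> ar m y \<inter> ar x y \<noteq> {}"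
    using connected_closedD[of "ar x y" "ar x m" "ar m y"] ar_triangle[OF X(2,3) mX] by blast
  then have "m \<in> ar x y" using xmy by simp
  then show ?thesis using that mX m(1,2) I by blast
qed

text \<open>Suppose infinitely many of the arcs avoid a ball around \<open>y\<close>. Outside the
  ball no connected set joins \<open>v\<close> to \<open>a\<close>, since its closure would contain
  \<open>ar v a\<close> and hence \<open>y\<close>. So a clopen set separates \<open>v\<close> from
  \<open>a\<close>, and then from \<open>x k\<close> for large \<open>k\<close>, although an arc
  joins them.\<close>

lemma ar_lsc:
  assumes X: "v \<in> X" "\<And>k::nat. x k \<in> X" and lim: "x \<longlonglongrightarrow> a" and y: "y \<in> ar v a" and e: "0 < e"
  shows "\<forall>\<^sub>F k in sequentially. \<exists>z\<in>ar v (x k). dist y z < e"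
proof (rule ccontr)
  assume "\<not> ?thesis"
  then have "infinite {k. \<not> (\<exists>z\<in>ar v (x k). dist y z < e)}"
    unfolding cofinite_eq_sequentially[symmetric] eventually_cofinite by simp
  then obtain s :: "nat \<Rightarrow> nat" where s: "strict_mono s" "\<And>k. s k \<in> {k. \<not> (\<exists>z\<in>ar v (x k). dist y z < e)}"
    using infinite_enumerate by blast
  have aX: "a \<in> X" using closed_sequentially[OF closed_X X(2) lim] .
  have lims: "(\<lambda>k. x (s k)) \<longlonglongrightarrow> a" using LIMSEQ_subseq_LIMSEQ[OF lim s(1)] by (simp add: o_def)
  let ?K = "X - ball y e"
  have K: "compact ?K" using compact_X by (intro compact_diff) auto
  have arK: "ar v (x (s k)) \<subseteq> ?K" for k using s(2)[of k] ar_in X by fastforce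
  have vK: "v \<in> ?K" using arK[of 0] ar_ends X by blast
  have xK: "x (s k) \<in> ?K" for k using arK[of k] ar_ends X by blast
  have aK: "a \<in> ?K" by (rule closed_sequentially[OF compact_imp_closed[OF K] xK lims])
  obtain V where V: "V \<subseteq> ?K" "compact V" "compact (?K - V)" "v \<in> V" "V \<inter> {a} = {}"
  proof (rule clopen_separation_connected[OF K])
    fix Z assume Z: "Z \<subseteq> ?K" "connected Z" "v \<in> Z"
    show "Z \<inter> {a} = {}"
    proof (rule ccontr)
      assume "Z \<inter> {a} \<noteq> {}"
      have clZ: "closure Z \<subseteq> ?K" using Z(1) closure_minimal compact_imp_closed[OF K] by blast
      have "compact (closure Z)" by (rule compact_closed_subset[OF K _ clZ]) simp
      then have "ar v a \<subseteq> closure Z"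
        using Z \<open>Z \<inter> {a} \<noteq> {}\<close> clZ closure_subset by (intro ar_least connected_imp_connected_closure) blast+
      then show False using y clZ e by auto
    qed
  qed (use vK in auto)
  have "\<forall>\<^sub>F k in sequentially. x (s k) \<in> - V"
    by (rule topological_tendstoD[OF lims]) (use V compact_imp_closed in blast)+
  then obtain k where k: "x (s k) \<notin> V" unfolding eventually_sequentially by auto
  have "connected (ar v (x (s k)))" using ar_connected X by blast
  moreover have "closed V" "closed (?K - V)" using V compact_imp_closed by blast+
  moreover have "ar v (x (s k)) \<subseteq> V \<union> (?K - V)" using arK by blast
  moreover have "V \<inter> ar v (x (s k)) \<noteq> {}" "(?K - V) \<inter> ar v (x (s k)) \<noteq> {}"
    using V(4) ar_ends X k xK by blast+
  ultimately show False using connected_closedD[of "ar v (x (s k))" V "?K - V"] by blast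
qed

text \<open>Upper semicontinuity of \<open>ar v x\<close> in \<open>x\<close>. With the lower
  semicontinuity of \<open>ar_lsc\<close> it expresses smoothness at \<open>v\<close> without
  Hausdorff distances.\<close>

definition closed_order where
  "closed_order v \<longleftrightarrow> v \<in> X \<and> (\<forall>x y a b. (\<forall>k::nat. x k \<in> X \<and> y k \<in> ar v (x k)) \<and> x \<longlonglongrightarrow> a \<and> y \<longlonglongrightarrow> b \<longrightarrow> b \<in> ar v a)"

lemma closed_orderD:
  assumes "closed_order v" "\<And>k::nat. x k \<in> X" "\<And>k. y k \<in> ar v (x k)" "x \<longlonglongrightarrow> a" "y \<longlonglongrightarrow> b"
  shows "b \<in> ar v a"
  using assms unfolding closed_order_def by blast

lemma closed_order_frequently:
  assumes v: "closed_order v" and x: "\<And>k::nat. x k \<in> X" and inf: "infinite {k. y k \<in> ar v (x k)}"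
    and lim: "x \<longlonglongrightarrow> a" "y \<longlonglongrightarrow> b"
  shows "b \<in> ar v a"
proof -
  obtain s :: "nat \<Rightarrow> nat" where s: "strict_mono s" "\<And>k. s k \<in> {k. y k \<in> ar v (x k)}"
    using infinite_enumerate[OF inf] by blast
  show ?thesis
    by (rule closed_orderD[OF v, of "x \<circ> s" "y \<circ> s"])
       (use s x lim LIMSEQ_subseq_LIMSEQ in auto)
qed

lemma smooth_imp_closed_order:
  assumes p: "p \<in> X" and sm: "\<And>s x. x \<in> X \<Longrightarrow> (\<forall>n::nat. s n \<in> X) \<and> s \<longlonglongrightarrow> x \<Longrightarrow>
        (\<lambda>n. hausdorff_dist (the_arc X (s n) p) (the_arc X x p)) \<longlonglongrightarrow> 0"
  shows "closed_order p"
  unfolding closed_order_def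
proof (intro conjI p allI impI, elim conjE)
  fix x y :: "nat \<Rightarrow> 'a" and a b
  assume xy: "\<forall>k. x k \<in> X \<and> y k \<in> ar p (x k)" and lim: "x \<longlonglongrightarrow> a" "y \<longlonglongrightarrow> b"
  have aX: "a \<in> X" using closed_sequentially[OF closed_X _ lim(1)] xy by blast
  have lim0: "(\<lambda>n. hausdorff_dist (ar p (x n)) (ar p a)) \<longlonglongrightarrow> 0"
    using sm[OF aX, of x] xy lim(1) ar_sym[OF p] aX by simp
  have bound: "infdist (y n) (ar p a) \<le> hausdorff_dist (ar p (x n)) (ar p a)" for n
    using xy aX p ar_compact by (intro infdist_hausdorff) auto
  have "(\<lambda>n. infdist (y n) (ar p a)) \<longlonglongrightarrow> 0"
    by (rule tendsto_sandwich[OF always_eventually always_eventually tendsto_const lim0])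
       (use bound infdist_nonneg in blast)+
  then have "infdist b (ar p a) = 0"
    using LIMSEQ_unique tendsto_infdist[OF lim(2)] by blast
  then show "b \<in> ar p a"
    using in_closed_iff_infdist_zero[OF ar_closed[OF p aX]] ar_ends[OF p aX] by blast
qed

text \<open>Arcs are unique, so points whose arc passes through \<open>w\<close> lie in different
  arc components of the complement of \<open>w\<close>.\<close>

lemma ramification_pointI:
  assumes w: "w \<in> X" and abc: "a \<in> X - {w}" "b \<in> X - {w}" "c \<in> X - {w}"
    and sep: "w \<in> ar a b" "w \<in> ar b c" "w \<in> ar a c"
  shows "ramification_point X w"
proof -
  let ?C = "arc_component (X - {w})"
  have neq: "?C x \<noteq> ?C y" if "x \<in> X - {w}" "y \<in> X - {w}" "w \<in> ar x y" for x y
  proof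
    assume "?C x = ?C y"
    then have "y \<in> ?C x" using that unfolding arc_component_def by auto
    then consider "y = x" | A where "A \<subseteq> X - {w}" "arc_from_to A x y" unfolding arc_component_def by blast
    then show False
    proof cases
      case 1
      then show ?thesis using that by auto
    next
      case 2
      then have "ar x y = A" using ar_eq by blast
      then show ?thesis using 2 that by blast
    qed
  qed
  have 3: "card {?C a, ?C b, ?C c} = 3"
    using neq[OF abc(1,2) sep(1)] neq[OF abc(2,3) sep(2)] neq[OF abc(1,3) sep(3)] by auto
  have "order_at X w \<ge> 3"
  proof (cases "finite (?C ` (X - {w}))")
    case True
    then have "card {?C a, ?C b, ?C c} \<le> card (?C ` (X - {w}))"
      using abc by (intro card_mono) auto
    then show ?thesis using True 3 unfolding order_at_def Let_def by (simp add: numeral_eq_enat)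
  qed (simp add: order_at_def)
  then show ?thesis using w unfolding ramification_point_def by blast
qed

text \<open>Arcs between other points avoid an endpoint, so its complement has at most one arc
  component.\<close>

lemma ramification_not_endpoint:
  assumes "ramification_point X v"
  shows "v \<notin> endpoints X"
proof
  assume v: "v \<in> endpoints X"
  let ?C = "arc_component (X - {v})"
  have "?C x = X - {v}" if x: "x \<in> X - {v}" for x
  proof
    show "X - {v} \<subseteq> ?C x"
    proof
      fix y assume y: "y \<in> X - {v}"
      show "y \<in> ?C x"
      proof (cases "y = x")
        case False
        have "arc_from_to (ar x y) x y" "ar x y \<subseteq> X" using ar_arc ar_in x y False by auto
        then have "v \<notin> ar x y" using v x y unfolding endpoints_def by blast
        then show ?thesis using \<open>arc_from_to (ar x y) x y\<close> \<open>ar x y \<subseteq> X\<close> y unfolding arc_component_def by blast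
      qed (use x in \<open>simp add: arc_component_def\<close>)
    qed
  qed (auto simp: arc_component_def)
  then have sub: "?C ` (X - {v}) \<subseteq> {X - {v}}" by blast
  then have "finite (?C ` (X - {v}))" "card (?C ` (X - {v})) \<le> 1"
    using finite_subset card_mono[OF _ sub] by auto
  then have "order_at X v \<le> 1" unfolding order_at_def Let_def by (simp add: one_enat_def)
  moreover have "3 \<le> order_at X v" using assms unfolding ramification_point_def by blast
  ultimately have "(3::enat) \<le> 1" using order_trans by blast
  then show False by (simp add: numeral_eq_enat one_enat_def)
qed

text \<open>
  If a limit \<open>b\<close> of points of the arcs \<open>ar v (x k)\<close> left \<open>ar v a\<close>, then the branching points \<open>m k\<close> of
  \<open>ar p (x k)\<close> and \<open>ar p v\<close> would be ramification points other than \<open>v\<close>, or else \<open>p\<close> itself; in the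
  latter case two of the \<open>x k\<close> would branch at \<open>p\<close> or at another point different from \<open>v\<close>.
\<close>

lemma closed_order_transfer:
  assumes p: "closed_order p" and v: "v \<in> X" and uniq: "\<And>w. ramification_point X w \<Longrightarrow> w = v"
  shows "closed_order v"
proof (cases "p = v")
  case pv: False
  have pX: "p \<in> X" using p unfolding closed_order_def by blast
  have key: "b \<in> ar v a"
    if xX: "\<And>k::nat. x k \<in> X" and yk: "\<And>k. y k \<in> ar v (x k)" and lim: "x \<longlonglongrightarrow> a" "y \<longlonglongrightarrow> b"
      and mk: "\<And>k. m k \<in> X \<and> m k \<in> ar p (x k) \<and> m k \<in> ar p v \<and> m k \<in> ar (x k) v \<and> ar p (x k) \<inter> ar p v = ar p (m k)"
      and ml: "m \<longlonglongrightarrow> m'" for x y a b m m'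
  proof (rule ccontr)
    assume nb: "b \<notin> ar v a"
    have aX: "a \<in> X" using closed_sequentially[OF closed_X xX lim(1)] .
    have yX: "y k \<in> X" for k using ar_in[OF v xX] yk by blast
    \<comment> \<open>\<open>c\<close> plays for \<open>a\<close> the role that \<open>m k\<close>
      plays for \<open>x k\<close>. In the order rooted at \<open>p\<close>, the limit
      \<open>m'\<close> will turn out to lie strictly below \<open>c\<close>.\<close>
    obtain c where c: "c \<in> X" "c \<in> ar p a" "c \<in> ar p v" "c \<in> ar a v" "ar p a \<inter> ar p v = ar p c"
      by (rule median[OF pX aX v], rule that)
    have vk: "ar v (x k) = ar v (m k) \<union> ar (m k) (x k)" for k
      using ar_split(1)[OF v xX, of "m k"] mk[of k] ar_sym[OF v xX] by simp
    have sp1: "ar p (x k) = ar p (m k) \<union> ar (m k) (x k)" "ar p (m k) \<inter> ar (m k) (x k) = {m k}" for k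
      using ar_split[OF pX xX, of "m k"] mk[of k] by auto
    have sp2: "ar p v = ar p (m k) \<union> ar (m k) v" "ar p (m k) \<inter> ar (m k) v = {m k}" for k
      using ar_split[OF pX v, of "m k"] mk[of k] by auto
    have above: "m k \<in> ar p (y k) \<and> (y k \<in> ar p v \<or> y k \<in> ar p (x k))" for k
    proof (cases "y k \<in> ar (m k) (x k)")
      case True
      then have "y k \<in> ar p (x k)" using sp1 by blast
      moreover then have "m k \<in> ar p (y k) \<or> y k \<in> ar p (m k)"
        using le_linear[OF pX xX, of "m k" k "y k"] mk[of k] by blast
      moreover have "m k \<in> ar p (y k)" if "y k \<in> ar p (m k)"
      proof -
        have "y k = m k" using sp1(2)[of k] that True by blast
        then show ?thesis using ar_ends(2)[OF pX, of "m k"] mk[of k] by simp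
      qed
      ultimately show ?thesis by blast
    next
      case False
      then have T: "y k \<in> ar (m k) v" using yk[of k] vk[of k] ar_sym[OF v, of "m k"] mk[of k] by blast
      then have "y k \<in> ar p v" using sp2 by blast
      moreover then have "m k \<in> ar p (y k) \<or> y k \<in> ar p (m k)"
        using le_linear[OF pX v, of "m k" "y k"] mk[of k] by blast
      moreover have "m k \<in> ar p (y k)" if "y k \<in> ar p (m k)"
      proof -
        have "y k = m k" using sp2(2)[of k] that T by blast
        then show ?thesis using ar_ends(2)[OF pX, of "m k"] mk[of k] by simp
      qed
      ultimately show ?thesis by blast
    qed
    have va: "ar v a = ar v c \<union> ar c a"
      using ar_split(1)[OF v aX, of c] c(4) ar_sym[OF v aX] by simp
    have b_cases: "b \<in> ar p v \<or> b \<in> ar p a"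
    proof (cases "infinite {k. y k \<in> ar p v}")
      case True
      then show ?thesis
        using closed_order_frequently[OF p, of "\<lambda>_. v" y v b] v lim(2) by simp
    next
      case False
      have "UNIV = {k. y k \<in> ar p v} \<union> {k. y k \<in> ar p (x k)}" using above by blast
      then have "infinite {k. y k \<in> ar p (x k)}" using False by (metis finite_Un infinite_UNIV_nat)
      then show ?thesis using closed_order_frequently[OF p xX _ lim] by blast
    qed
    \<comment> \<open>\<open>ar v a\<close> consists of the arcs from \<open>c\<close> to
      \<open>v\<close> and to \<open>a\<close>. A point off it that is below \<open>v\<close> or
      \<open>a\<close> lies strictly below \<open>c\<close>.\<close>
    have bc: "b \<in> ar p c" "b \<noteq> c"
    proof -
      have "ar p v = ar p c \<union> ar c v" "ar p a = ar p c \<union> ar c a"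
        using ar_split(1)[OF pX v c(3)] ar_split(1)[OF pX aX c(2)] by auto
      then show "b \<in> ar p c" using b_cases nb va ar_sym[OF v c(1)] by blast
      show "b \<noteq> c" using nb c(4) ar_sym[OF v aX] by auto
    qed
    have m'b: "m' \<in> ar p b"
      using closed_orderD[OF p yX _ lim(2) ml] above by blast
    have m'c: "c \<in> ar p m' \<Longrightarrow> False"
      using le_antisym[OF pX c(1) bc(1)] le_trans[OF pX _ m'b, of c] bc ar_in[OF pX c(1)] by blast
    have "\<forall>\<^sub>F k in sequentially. m k \<noteq> x k \<and> m k \<noteq> v"
    proof -
      \<comment> \<open>If \<open>m k\<close> were \<open>v\<close> (or, further on,
        \<open>x k\<close>) infinitely often, then \<open>v\<close> (or \<open>a\<close>), and hence
        \<open>c\<close>, would lie below \<open>m'\<close>.\<close>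
      have "finite {k. m k = v}"
      proof (rule ccontr)
        assume inf: "infinite {k. m k = v}"
        have "{k. m k = v} \<subseteq> {k. v \<in> ar p (m k)}" using ar_ends(2)[OF pX v] by auto
        then have "infinite {k. v \<in> ar p (m k)}" using inf finite_subset by blast
        then have "v \<in> ar p m'"
          using closed_order_frequently[OF p, of m "\<lambda>_. v" m' v] mk ml by simp
        then have "c \<in> ar p m'" using le_trans[OF pX _ _ c(3), of m'] m'b ar_in[OF pX] le_in[OF pX] c b_cases aX v by blast
        then show False by (rule m'c)
      qed
      moreover have "finite {k. m k = x k}"
      proof (rule ccontr)
        assume inf: "infinite {k. m k = x k}"
        have "{k. m k = x k} \<subseteq> {k. x k \<in> ar p (m k)}" using ar_ends(2)[OF pX xX] by auto
        then have "infinite {k. x k \<in> ar p (m k)}" using inf finite_subset by blast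
        then have "a \<in> ar p m'"
          using closed_order_frequently[OF p, of m x m' a] mk ml lim(1) by simp
        then have "c \<in> ar p m'" using le_trans[OF pX _ _ c(2), of m'] m'b ar_in[OF pX] le_in[OF pX] c b_cases aX v by blast
        then show False by (rule m'c)
      qed
      ultimately show ?thesis
        unfolding cofinite_eq_sequentially[symmetric] eventually_cofinite by (simp add: Collect_disj_eq)
    qed
    then obtain N where N: "\<And>k. N \<le> k \<Longrightarrow> m k \<noteq> x k \<and> m k \<noteq> v"
      unfolding eventually_sequentially by blast
    have mp: "m k = p" if "N \<le> k" for k
    proof (rule ccontr)
      assume "m k \<noteq> p"
      then have "ramification_point X (m k)"
        using mk[of k] N[OF that] pX v xX by (intro ramification_pointI[of "m k" p "x k" v]) auto
      then show False using uniq N[OF that] by blast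
    qed
    have "c \<noteq> p"
    proof
      assume "c = p"
      then have "b = p" using bc(1) by simp
      then show False using bc \<open>c = p\<close> by simp
    qed
    have capv: "ar p (x k) \<inter> ar p v = {p}" if "N \<le> k" for k using mk[of k] mp[OF that] by simp
    have c_not: "c \<notin> ar p (x k)" if "N \<le> k" for k using capv[OF that] c(3) \<open>c \<noteq> p\<close> by blast
    have xp: "x k \<noteq> p" if "N \<le> k" for k using N[OF that] mp[OF that] by metis
    have p_vx: "p \<in> ar (x k) v" if "N \<le> k" for k using mk[of k] mp[OF that] by simp
    \<comment> \<open>If \<open>x N\<close> and \<open>x k\<close> parted at \<open>p\<close>, the
      three directions to them and to \<open>v\<close> would make \<open>p\<close> a ramification
      point. Elsewhere only \<open>v\<close> could be one, and \<open>v\<close> is not below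
      \<open>x N\<close>.\<close>
    have comparable: "x N \<in> ar p (x k) \<or> x k \<in> ar p (x N)" if k: "N \<le> k" for k
    proof -
      obtain w where w: "w \<in> X" "w \<in> ar p (x N)" "w \<in> ar p (x k)" "w \<in> ar (x N) (x k)"
        by (rule median[OF pX xX xX], rule that)
      have "w \<noteq> p"
      proof
        assume "w = p"
        then have "ramification_point X p"
          using pX v xX w(4) xp[OF k] xp[of N] p_vx[OF k] p_vx[of N] pv
          by (intro ramification_pointI[of p "x N" "x k" v]) auto
        then show False using uniq pv by blast
      qed
      have "w \<noteq> v" using capv[of N] w(2) ar_ends(2)[OF pX v] pv by auto
      then have "\<not> ramification_point X w" using uniq by blast
      then have "w = x N \<or> w = x k"
        using ramification_pointI[of w p "x N" "x k"] w pX xX \<open>w \<noteq> p\<close> by blast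
      then show ?thesis using w by blast
    qed
    \<comment> \<open>Either infinitely many \<open>x k\<close> lie below \<open>x N\<close>, and so
      do \<open>a\<close> and \<open>c\<close>; or \<open>x N\<close> lies below \<open>a\<close>
      and is comparable with \<open>c\<close>. Both contradict that the arcs from \<open>p\<close>
      to \<open>x N\<close> and to \<open>v\<close> share only \<open>p\<close>.\<close>
    show False
    proof (cases "infinite {k. x k \<in> ar p (x N)}")
      case True
      then have "a \<in> ar p (x N)"
        using closed_order_frequently[OF p, of "\<lambda>_. x N" x "x N" a] xX lim(1) by simp
      then have "c \<in> ar p (x N)" using le_trans[OF pX xX] c(2) by blast
      then show False using c_not[of N] by simp
    next
      case False
      have "{N..} \<subseteq> {k. x k \<in> ar p (x N)} \<union> {k. x N \<in> ar p (x k)}" using comparable by auto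
      then have "infinite {k. x N \<in> ar p (x k)}"
        using False infinite_Ici finite_subset by (metis finite_Un)
      then have "x N \<in> ar p a"
        using closed_order_frequently[OF p, of x "\<lambda>_. x N" a "x N"] xX lim(1) by simp
      then have "x N \<in> ar p c \<or> c \<in> ar p (x N)" using le_linear[OF pX aX] c(2) by blast
      then have "x N \<in> ar p v" using c_not[of N] le_trans[OF pX v c(3)] by auto
      then have "x N = p" using capv[of N] ar_ends(2)[OF pX xX, of N] by blast
      then show False using xp[of N] by simp
    qed
  qed
  show ?thesis
    unfolding closed_order_def
  proof (intro conjI v allI impI, elim conjE)
    fix x y :: "nat \<Rightarrow> 'a" and a b
    assume xy: "\<forall>k. x k \<in> X \<and> y k \<in> ar v (x k)" and lim: "x \<longlonglongrightarrow> a" "y \<longlonglongrightarrow> b"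
    have "\<exists>m. m \<in> X \<and> m \<in> ar p (x k) \<and> m \<in> ar p v \<and> m \<in> ar (x k) v \<and> ar p (x k) \<inter> ar p v = ar p m" for k
      using median[OF pX _ v, of "x k"] xy by metis
    then obtain m where m: "\<And>k. m k \<in> X \<and> m k \<in> ar p (x k) \<and> m k \<in> ar p v \<and> m k \<in> ar (x k) v \<and> ar p (x k) \<inter> ar p v = ar p (m k)"
      by metis
    obtain m' s where s: "strict_mono s" "(m \<circ> s) \<longlonglongrightarrow> m'" using compact_subseq[OF compact_X, of m] m by blast
    show "b \<in> ar v a"
      by (rule key[of "x \<circ> s" "y \<circ> s" a b "m \<circ> s" m'])
         (use xy m s LIMSEQ_subseq_LIMSEQ[OF _ s(1)] lim in auto)
  qed
qed (use p in simp)

end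

section \<open>A Whitney-type height along the arcs from the root\<close>

locale rooted_dendroid = dendroid_space +
  fixes v assumes order: "closed_order v"
begin

lemma vX: "v \<in> X" using order unfolding closed_order_def by blast

text \<open>Lower semicontinuity of the arcs, \<open>ar_lsc\<close>, bounds the distances from
  above; the closed order bounds them from below.\<close>

lemma continuous_infdist_ar: "continuous_on X (\<lambda>x. infdist c (ar v x))"
  unfolding continuous_on_sequentially
proof (intro allI ballI impI, elim conjE)
  fix x :: "nat \<Rightarrow> 'a" and a assume a: "a \<in> X" and xX: "\<forall>n. x n \<in> X" and lim: "x \<longlonglongrightarrow> a"
  let ?I = "infdist c (ar v a)"
  have "\<forall>\<^sub>F k in sequentially. dist (infdist c (ar v (x k))) ?I < e" if e: "0 < e" for e
  proof -
    have upper: "\<forall>\<^sub>F k in sequentially. infdist c (ar v (x k)) < ?I + e"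
    proof -
      have "\<exists>y\<in>ar v a. dist c y < ?I + e/2"
        by (rule infdist_lessD) (use e ar_ends[OF vX a] in auto)
      then obtain y where y: "y \<in> ar v a" "dist c y < ?I + e/2" by blast
      have "\<forall>\<^sub>F k in sequentially. \<exists>z\<in>ar v (x k). dist y z < e/2"
        by (rule ar_lsc[OF vX _ lim y(1)]) (use xX e in auto)
      then show ?thesis
      proof eventually_elim
        case (elim k)
        then obtain z where z: "z \<in> ar v (x k)" "dist y z < e/2" by blast
        have "infdist c (ar v (x k)) \<le> dist c z" using z(1) by (rule infdist_le)
        also have "\<dots> \<le> dist c y + dist y z" by (rule dist_triangle)
        finally show ?case using y(2) z(2) by simp
      qed
    qed
    have lower: "\<forall>\<^sub>F k in sequentially. ?I - e < infdist c (ar v (x k))"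
    proof (rule ccontr)
      assume "\<not> ?thesis"
      then have "infinite {k. \<not> ?I - e < infdist c (ar v (x k))}"
        unfolding cofinite_eq_sequentially[symmetric] eventually_cofinite by simp
      then obtain s :: "nat \<Rightarrow> nat" where s: "strict_mono s" "\<And>k. s k \<in> {k. \<not> ?I - e < infdist c (ar v (x k))}"
        using infinite_enumerate by blast
      have "\<exists>y\<in>ar v (x (s k)). dist c y < ?I - e/2" for k
        by (rule infdist_lessD) (use e s(2)[of k] ar_ends[OF vX] xX in auto)
      then obtain y where y: "\<And>k. y k \<in> ar v (x (s k))" "\<And>k. dist c (y k) < ?I - e/2" by metis
      have yX: "y k \<in> X" for k using y(1) ar_in[OF vX] xX by blast
      obtain b s' where b: "strict_mono s'" "(y \<circ> s') \<longlonglongrightarrow> b" using compact_subseq[OF compact_X, of y] yX by blast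
      have "strict_mono (s \<circ> s')" using s(1) b(1) by (rule strict_mono_o)
      then have "(\<lambda>k. x (s (s' k))) \<longlonglongrightarrow> a" using LIMSEQ_subseq_LIMSEQ[OF lim] by (simp add: o_def)
      then have "b \<in> ar v a"
        using closed_orderD[OF order, of "\<lambda>k. x (s (s' k))" "y \<circ> s'" a b] xX y(1) b(2) by auto
      then have "?I \<le> dist c b" by (rule infdist_le)
      moreover have "(\<lambda>k. dist c ((y \<circ> s') k)) \<longlonglongrightarrow> dist c b" by (intro tendsto_intros b)
      then have "dist c b \<le> ?I - e/2"
        using y(2) by (intro LIMSEQ_le_const2[of _ "dist c b"]) (auto intro: less_imp_le)
      ultimately show False using e by simp
    qed
    from upper lower show ?thesis
      by eventually_elim (auto simp: dist_real_def)
  qed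
  then show "((\<lambda>x. infdist c (ar v x)) \<circ> x) \<longlonglongrightarrow> infdist c (ar v a)"
    unfolding tendsto_iff o_def by blast
qed

definition dseq :: "nat \<Rightarrow> 'a" where "dseq = (SOME d. \<forall>x\<in>X. \<forall>e>0. \<exists>n. dist x (d n) < e)"

lemma dseq: "x \<in> X \<Longrightarrow> 0 < e \<Longrightarrow> \<exists>n. dist x (dseq n) < e"
proof -
  have "\<exists>d :: nat \<Rightarrow> 'a. \<forall>x\<in>X. \<forall>e>0. \<exists>n. dist x (d n) < e"
    by (rule compact_countable_dense[OF compact_X]) blast
  then have "\<forall>x\<in>X. \<forall>e>0. \<exists>n. dist x (dseq n) < e" unfolding dseq_def by (rule someI_ex)
  then show "x \<in> X \<Longrightarrow> 0 < e \<Longrightarrow> \<exists>n. dist x (dseq n) < e" by blast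
qed

text \<open>A Whitney-map formula: \<open>1 / (1 + infdist)\<close> grows with the arc, the value at
  the degenerate arc \<open>{v}\<close> is subtracted so that the root gets height 0, and the
  weights sum to 1.\<close>

definition hterm where "hterm n x = (1/2)^Suc n * (1 / (1 + infdist (dseq n) (ar v x)) - 1 / (1 + dist (dseq n) v))"
definition ht where "ht x = (\<Sum>n. hterm n x)"

lemma infdist_ar_mono: "x \<in> X \<Longrightarrow> z \<in> ar v x \<Longrightarrow> infdist c (ar v x) \<le> infdist c (ar v z)"
  using ar_split(1)[OF vX, of x z] ar_ends(1)[OF vX, of z] le_in[OF vX, of x z]
  by (intro infdist_mono) auto

lemma hterm_mono: "x \<in> X \<Longrightarrow> z \<in> ar v x \<Longrightarrow> hterm n z \<le> hterm n x"
  unfolding hterm_def using infdist_ar_mono[of x z "dseq n"] infdist_nonneg[of "dseq n"]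
  by (intro mult_left_mono diff_right_mono divide_left_mono) (auto intro!: mult_pos_pos add_pos_nonneg)

lemma hterm_v: "hterm n v = 0"
  unfolding hterm_def by simp

lemma hterm_bounds: "x \<in> X \<Longrightarrow> 0 \<le> hterm n x" "hterm n x \<le> (1/2)^Suc n"
proof -
  show "x \<in> X \<Longrightarrow> 0 \<le> hterm n x"
    using hterm_mono[of x v n] hterm_v ar_ends(1)[OF vX] by simp
  have "1 / (1 + infdist (dseq n) (ar v x)) \<le> 1" using infdist_nonneg[of "dseq n" "ar v x"] by simp
  moreover have "0 \<le> 1 / (1 + dist (dseq n) v)" by simp
  ultimately have "1 / (1 + infdist (dseq n) (ar v x)) - 1 / (1 + dist (dseq n) v) \<le> 1" by linarith
  then show "hterm n x \<le> (1/2)^Suc n" unfolding hterm_def by (intro mult_left_le) auto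
qed

lemma summable_half: "summable (\<lambda>n. (1/2::real)^Suc n)"
  using power_half_series sums_summable by blast

lemma summable_hterm: "x \<in> X \<Longrightarrow> summable (\<lambda>n. hterm n x)"
  by (rule summable_comparison_test[OF _ summable_half]) (use hterm_bounds in auto)

lemma ht_v: "ht v = 0"
  unfolding ht_def by (simp add: hterm_v)

lemma ht_bounds: "x \<in> X \<Longrightarrow> 0 \<le> ht x" "x \<in> X \<Longrightarrow> ht x \<le> 1"
proof -
  assume x: "x \<in> X"
  show "0 \<le> ht x" unfolding ht_def using summable_hterm[OF x] hterm_bounds(1)[OF x] by (rule suminf_nonneg)
  have "ht x \<le> (\<Sum>n. (1/2::real)^Suc n)"
    unfolding ht_def by (rule suminf_le[OF _ summable_hterm[OF x] summable_half]) (rule hterm_bounds)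
  then show "ht x \<le> 1" using power_half_series sums_unique by fastforce
qed

lemma continuous_ht: "continuous_on X ht"
proof -
  have u: "uniform_limit X (\<lambda>n x. \<Sum>i<n. hterm i x) (\<lambda>x. \<Sum>i. hterm i x) sequentially"
    by (rule Weierstrass_m_test[OF _ summable_half]) (use hterm_bounds in auto)
  have "continuous_on X (hterm n)" for n
    unfolding hterm_def using infdist_nonneg[of "dseq n"]
    by (intro continuous_intros continuous_infdist_ar) (smt (verit))
  then have c: "\<forall>\<^sub>F n in sequentially. continuous_on X (\<lambda>x. \<Sum>i<n. hterm i x)"
    by (intro always_eventually allI continuous_on_sum) auto
  show ?thesis using uniform_limit_theorem[OF c u] unfolding ht_def by simp
qed

text \<open>\<open>x\<close> has positive distance from the shorter arc. A member of the dense
  sequence within half of that distance is nearer to \<open>ar v x\<close> than to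
  \<open>ar v z\<close>, so its term is strictly larger.\<close>

lemma ht_less:
  assumes x: "x \<in> X" and z: "z \<in> ar v x" "z \<noteq> x"
  shows "ht z < ht x"
proof -
  have zX: "z \<in> X" using le_in[OF vX x z(1)] .
  have "x \<notin> ar v z" using le_antisym[OF vX x z(1)] z(2) by blast
  then have d: "0 < infdist x (ar v z)"
    using in_closed_iff_infdist_zero[OF ar_closed[OF vX zX]] ar_ends[OF vX zX] infdist_nonneg[of x "ar v z"]
    by (metis empty_iff less_le)
  obtain n where n: "dist x (dseq n) < infdist x (ar v z) / 2" using dseq[OF x] d by (metis half_gt_zero)
  have "infdist (dseq n) (ar v x) \<le> dist (dseq n) x" using ar_ends(2)[OF vX x] by (rule infdist_le)
  moreover have "infdist x (ar v z) \<le> infdist (dseq n) (ar v z) + dist x (dseq n)" by (rule infdist_triangle)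
  ultimately have "infdist (dseq n) (ar v x) < infdist (dseq n) (ar v z)" using n by (simp add: dist_commute)
  then have "1 / (1 + infdist (dseq n) (ar v z)) < 1 / (1 + infdist (dseq n) (ar v x))"
    using infdist_nonneg[of "dseq n" "ar v x"] by (intro divide_strict_left_mono) auto
  then have "0 < hterm n x - hterm n z" unfolding hterm_def by (simp add: field_simps(7)[symmetric] right_diff_distrib[symmetric])
  moreover have sm: "summable (\<lambda>n. hterm n x - hterm n z)"
    using summable_hterm x zX by (intro summable_diff)
  ultimately have "0 < (\<Sum>n. hterm n x - hterm n z)"
    using hterm_mono[OF x z(1)] by (intro suminf_pos2[of _ n]) auto
  also have "\<dots> = ht x - ht z"
    unfolding ht_def using suminf_diff[OF summable_hterm[OF x] summable_hterm[OF zX]] by simp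
  finally show ?thesis by simp
qed

lemma ht_le: "x \<in> X \<Longrightarrow> z \<in> ar v x \<Longrightarrow> ht z \<le> ht x"
  using ht_less[of x z] by (cases "z = x") auto

lemma ht_inj:
  assumes x: "x \<in> X" and yz: "y \<in> ar v x" "z \<in> ar v x" "ht y = ht z"
  shows "y = z"
proof -
  have X: "y \<in> X" "z \<in> X" using le_in[OF vX x] yz by auto
  show ?thesis
    using le_linear[OF vX x yz(1,2)] ht_less[OF X(1), of z] ht_less[OF X(2), of y] yz(3) by auto
qed

definition rt where "rt x t = (THE y. y \<in> ar v x \<and> ht y = min t (ht x))"

lemma rt:
  assumes x: "x \<in> X" and t: "0 \<le> t"
  shows "rt x t \<in> ar v x" "ht (rt x t) = min t (ht x)" "rt x t \<in> X"
proof -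
  have "continuous_on (ar v x) ht" using continuous_ht ar_in[OF vX x] by (rule continuous_on_subset)
  then have "connected (ht ` ar v x)" using ar_connected[OF vX x] by (rule connected_continuous_image)
  moreover have "0 \<in> ht ` ar v x" using ar_ends(1)[OF vX x] ht_v by force
  moreover have "ht x \<in> ht ` ar v x" using ar_ends(2)[OF vX x] by blast
  ultimately have "{0..ht x} \<subseteq> ht ` ar v x" by (rule connected_contains_Icc)
  moreover have "min t (ht x) \<in> {0..ht x}" using t ht_bounds(1)[OF x] by auto
  ultimately obtain y where y: "y \<in> ar v x" "ht y = min t (ht x)" by (metis imageE subsetD)
  have "\<exists>!y. y \<in> ar v x \<and> ht y = min t (ht x)"
    using y ht_inj[OF x] by (intro ex1I[of _ y]) auto
  from theI'[OF this] have "rt x t \<in> ar v x \<and> ht (rt x t) = min t (ht x)" unfolding rt_def .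
  then show "rt x t \<in> ar v x" "ht (rt x t) = min t (ht x)" "rt x t \<in> X" using le_in[OF vX x] by auto
qed

lemma rt_eq: "x \<in> X \<Longrightarrow> 0 \<le> t \<Longrightarrow> y \<in> ar v x \<Longrightarrow> ht y = min t (ht x) \<Longrightarrow> rt x t = y"
  using ht_inj[of x "rt x t" y] rt[of x t] by simp

text \<open>By compactness it suffices to identify subsequential limits. Such a limit lies on
  \<open>ar v a\<close> because the order is closed, and has the right height by continuity of
  \<open>ht\<close>; a point of an arc from the root is determined by its height.\<close>

lemma rt_limit:
  assumes x: "\<And>k::nat. x k \<in> X" "x \<longlonglongrightarrow> a" and t: "\<And>k. 0 \<le> t k" "t \<longlonglongrightarrow> s"
  shows "(\<lambda>k. rt (x k) (t k)) \<longlonglongrightarrow> rt a s"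
proof (rule compact_LIMSEQ[OF compact_X])
  show "rt (x k) (t k) \<in> X" for k using rt x t by blast
  have aX: "a \<in> X" using closed_sequentially[OF closed_X x] .
  have s0: "0 \<le> s" using LIMSEQ_le_const[OF t(2), of 0] t(1) by blast
  fix f :: "nat \<Rightarrow> nat" and l assume f: "strict_mono f" and l: "(\<lambda>k. rt (x (f k)) (t (f k))) \<longlonglongrightarrow> l"
  have xf: "(\<lambda>k. x (f k)) \<longlonglongrightarrow> a" "(\<lambda>k. t (f k)) \<longlonglongrightarrow> s"
    using LIMSEQ_subseq_LIMSEQ[OF x(2) f] LIMSEQ_subseq_LIMSEQ[OF t(2) f] by (auto simp: o_def)
  have 1: "l \<in> ar v a"
    by (rule closed_orderD[OF order _ _ xf(1) l]) (use x(1) rt t(1) in auto)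
  have lX: "l \<in> X" using le_in[OF vX aX 1] .
  have "(\<lambda>k. ht (rt (x (f k)) (t (f k)))) \<longlonglongrightarrow> ht l"
    using continuous_ht[unfolded continuous_on_sequentially, rule_format, of l "\<lambda>k. rt (x (f k)) (t (f k))"] lX l rt(3) x(1) t(1)
    by (auto simp: o_def)
  moreover have "(\<lambda>k. ht (x (f k))) \<longlonglongrightarrow> ht a"
    using continuous_ht[unfolded continuous_on_sequentially, rule_format, of a "\<lambda>k. x (f k)"] aX xf(1) x(1)
    by (auto simp: o_def)
  then have "(\<lambda>k. min (t (f k)) (ht (x (f k)))) \<longlonglongrightarrow> min s (ht a)" using xf(2) by (intro tendsto_min)
  ultimately have "ht l = min s (ht a)" using rt(2) x(1) t(1) LIMSEQ_unique by simp
  then show "l = rt a s" using rt_eq[OF aX s0 1] by simp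
qed

text \<open>The closure of \<open>Z\<close> contains \<open>ar z z'\<close> and with it the median,
  which lies below both points at the same height and so equals both.\<close>

lemma levels:
  assumes Z: "Z \<subseteq> X" "connected Z" "\<And>z. z \<in> Z \<Longrightarrow> ht z = t" "z \<in> Z" "z' \<in> Z"
  shows "z = z'"
proof -
  have X: "z \<in> X" "z' \<in> X" using Z by auto
  have cX: "closure Z \<subseteq> X" using Z(1) closed_X by (rule closure_minimal)
  have "ht w = t" if "w \<in> closure Z" for w
    by (rule continuous_constant_on_closure[OF continuous_on_subset[OF continuous_ht cX] Z(3) that])
  moreover have "ar z z' \<subseteq> closure Z"
    using Z cX closure_subset[of Z] compact_closed_subset[OF compact_X closed_closure cX]
    by (intro ar_least connected_imp_connected_closure) auto
  moreover obtain m where m: "m \<in> X" "m \<in> ar v z" "m \<in> ar v z'" "m \<in> ar z z'"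
    by (rule median[OF vX X], rule that)
  ultimately have "ht m = t" by blast
  then have "ht m = ht z" "ht m = ht z'" using Z by auto
  then show ?thesis using ht_less[OF X(1) m(2)] ht_less[OF X(2) m(3)] by auto
qed

text \<open>Agreement at a positive height moves the median off the root. It is then no ramification
  point, so it is \<open>x\<close> or \<open>y\<close>, and one arc contains the other.\<close>

lemma rt_fan:
  assumes uniq: "\<And>w. ramification_point X w \<Longrightarrow> w = v"
    and X: "x \<in> X" "y \<in> X" and t: "0 < t" "t \<le> ht x" "t \<le> ht y" and eq: "rt x t = rt y t"
    and s: "0 \<le> s" "s \<le> ht x" "s \<le> ht y"
  shows "rt x s = rt y s"
proof -
  obtain m where m: "m \<in> X" "m \<in> ar v x" "m \<in> ar v y" "m \<in> ar x y" "ar v x \<inter> ar v y = ar v m"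
    by (rule median[OF vX X], rule that)
  have t0: "0 \<le> t" using t by simp
  have "rt x t \<in> ar v m" using rt(1)[OF X(1) t0] rt(1)[OF X(2) t0] eq m(5) by auto
  then have "ht (rt x t) \<le> ht m" by (rule ht_le[OF m(1)])
  then have "m \<noteq> v" using rt(2)[OF X(1) t0] t ht_v by auto
  then have "m = x \<or> m = y"
    using uniq ramification_pointI[of m v x y] m X vX by blast
  moreover have *: "rt x s = rt y s" if "x \<in> X" "y \<in> X" "x \<in> ar v y" "s \<le> ht x" "s \<le> ht y" for x y
    using rt[OF that(1) s(1)] le_trans[OF vX that(2,3)] that
    by (intro rt_eq[OF that(2) s(1), symmetric]) auto
  ultimately show ?thesis using X m s by metis
qed

lemma radial_fan:
  assumes uniq: "\<And>w. ramification_point X w \<Longrightarrow> w = v"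
  shows "radial_fan X ht rt v"
proof
  show "compact X" "v \<in> X" "continuous_on X ht" by (rule compact_X vX continuous_ht)+
  show "z = z'" if "Z \<subseteq> X" "connected Z" "\<And>z. z \<in> Z \<Longrightarrow> ht z = t" "z \<in> Z" "z' \<in> Z" for Z t z z'
    using that by (rule levels)
  show "rt x s = rt y s" if "x \<in> X" "y \<in> X" "0 < t" "t \<le> ht x" "t \<le> ht y" "rt x t = rt y t"
    "0 \<le> s" "s \<le> ht x" "s \<le> ht y" for x y t s
    using uniq that by (rule rt_fan)
  show "continuous_on (X \<times> {0..1}) (\<lambda>p. rt (fst p) (snd p))"
    unfolding continuous_on_sequentially
  proof (intro allI ballI impI, elim conjE)
    fix p :: "nat \<Rightarrow> 'a \<times> real" and a assume "a \<in> X \<times> {0..1::real}" and p: "\<forall>n. p n \<in> X \<times> {0..1}" "p \<longlonglongrightarrow> a"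
    show "((\<lambda>p. rt (fst p) (snd p)) \<circ> p) \<longlonglongrightarrow> rt (fst a) (snd a)"
      unfolding o_def
      by (rule rt_limit) (use p tendsto_fst[OF p(2)] tendsto_snd[OF p(2)] in \<open>auto simp: mem_Times_iff\<close>)
  qed
  fix x assume x: "x \<in> X"
  show "rt x 0 = v" using rt_eq[OF x, of 0 v] ht_v ar_ends(1)[OF vX x] ht_bounds(1)[OF x] by simp
  show "rt x (ht x) = x" using rt_eq[OF x, of "ht x" x] ar_ends(2)[OF vX x] ht_bounds(1)[OF x] by simp
  fix t :: real assume t: "t \<in> {0..1}"
  fix s :: real assume s: "s \<in> {0..1}"
  show "rt (rt x t) s = rt x (min s t)"
  proof (rule rt_eq[OF x, symmetric])
    have X: "rt x t \<in> X" "0 \<le> s" "0 \<le> t" using rt(3)[OF x] t s by auto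
    show "rt (rt x t) s \<in> ar v x" using le_trans[OF vX x rt(1)[OF x X(3)] rt(1)[OF X(1,2)]] .
    show "ht (rt (rt x t) s) = min (min s t) (ht x)" using rt(2)[OF X(1,2)] rt(2)[OF x X(3)] by simp
  qed (use s t in auto)
qed (use ht_bounds rt in auto)

end

theorem mainTheorem6:
  fixes L :: "'a::metric_space set"
  assumes "lelek_fan L"
  shows "\<exists>D :: (nat \<Rightarrow> real) set.
           suslinian D \<and> smooth_dendroid D \<and> endpoints D homeomorphic endpoints L"
proof -
  have fan: "fan L" and sm: "smooth_dendroid L" and dense: "L \<subseteq> closure (endpoints L)"
    using assms unfolding lelek_fan_def by auto
  obtain v where v: "ramification_point L v" and uniq: "\<And>w. ramification_point L w \<Longrightarrow> w = v"
    using fan unfolding fan_def by blast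
  interpret dendroid_space L
    by unfold_locales (use fan in \<open>simp add: fan_def\<close>)
  obtain p where p: "p \<in> L" "\<And>s x. x \<in> L \<Longrightarrow> (\<forall>n::nat. s n \<in> L) \<and> s \<longlonglongrightarrow> x \<Longrightarrow>
        (\<lambda>n. hausdorff_dist (the_arc L (s n) p) (the_arc L x p)) \<longlonglongrightarrow> 0"
    using sm unfolding smooth_dendroid_def by blast
  have vL: "v \<in> L" using v unfolding ramification_point_def by blast
  \<comment> \<open>Smoothness provides only some \<open>p\<close>. The root has to be the vertex,
    since \<open>radial_fan\<close> allows no branching elsewhere.\<close>
  have "closed_order v"
    using closed_order_transfer[OF smooth_imp_closed_order[OF p] vL uniq] by blast
  then interpret rooted_dendroid L v by unfold_locales
  interpret radial_fan L ht rt v by (rule radial_fan[OF uniq])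
  show ?thesis
    using suslinian_model[OF ramification_not_endpoint[OF v]] vL dense by blast
qed

end
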